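(* Let $0<p\le q<\infty$, $0<r<1$, $\omega\in\mathcal{D}$, let $\varphi,\psi$ be holomorphic self-maps of $\mathbb{B}_n$, $u,v$ weights (Borel functions on $\mathbb{B}_n$), and $\mu$ a positive Borel measure on $\mathbb{B}_n$. If $uC_\varphi-vC_\psi:A^p_\omega\to L^q_\mu$ is bounded (respectively compact), then both measures $\eta_{\varphi,u}+\sigma_{\varphi,r}$ and $\eta_{\psi,v}+\sigma_{\psi,r}$ are $q$-Carleson measures (respectively vanishing $q$-Carleson measures) for $A^p_\omega$, where $$\eta_{\varphi,u}=(|\rho u|^qd\mu)\circ\varphi^{-1},\ \eta_{\psi,v}=(|\rho v|^qd\mu)\circ\psi^{-1},\ \sigma_{\varphi,r}=(\chi_{G_r}|u-v|^qd\mu)\circ\varphi^{-1},\ \sigma_{\psi,r}=(\chi_{G_r}|u-v|^qd\mu)\circ\psi^{-1},$$ with $\rho(z)=\rho(\varphi(z),\psi(z))$ and $G_r=\{z:\rho(z)<r\}$.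
   Context: $\mathbb{B}_n$ is the open unit ball of $\mathbb{C}^n$, $dV$ the normalized volume measure. A radial weight is a positive, measurable, integrable $\omega$ with $\omega(z)=\omega(|z|)$; $\hat\omega(r)=\int_r^1\omega(s)ds$. $\omega\in\hat{\mathcal D}$ if there is $C\ge1$ with $\hat\omega(r)\le C\hat\omega(\frac{1+r}{2})$ for all $r\in[0,1)$; $\omega\in\check{\mathcal D}$ if there are $C,K>1$ with $\hat\omega(r)\ge C\hat\omega(1-\frac{1-r}{K})$ for all $r\in[0,1)$; $\mathcal D=\hat{\mathcal D}\cap\check{\mathcal D}$. $A^p_\omega$ is the space of holomorphic $f$ with $\|f\|^p_{A^p_\omega}=\int|f|^p\omega\,dV<\infty$; $L^q_\mu$ the space of measurable $g$ with $\int|g|^qd\mu<\infty$. $(uC_\varphi f)(z)=u(z)f(\varphi(z))$. The pseudohyperbolic distance is $\rho(a,z)=|\varphi_a(z)|$ with $\varphi_a$ the involutive automorphism exchanging $a$ and $0$. $(\nu\circ\varphi^{-1})(E)=\nu(\varphi^{-1}(E))$. A positive Borel measure $\nu$ is a $q$-Carleson measure for $A^p_\omega$ if the identity $A^p_\omega\to L^q_\nu$ is bounded, vanishing if it is compact; a linear map is compact if it maps bounded sequences to sequences with a convergent subsequence. *)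

theory Defs
  imports "HOL-Analysis.Analysis"
begin

definition Bn :: "(complex ^ 'n) set" where
  "Bn = ball 0 1"

definition dV :: "(complex ^ 'n) measure" where
  "dV = density (restrict_space lborel Bn) (\<lambda>_. inverse (emeasure lborel (Bn :: (complex ^ 'n) set)))"

definition Bn_borel :: "(complex ^ 'n) measure" where
  "Bn_borel = restrict_space borel Bn"

definition holo_on :: "(complex ^ 'n \<Rightarrow> complex) \<Rightarrow> (complex ^ 'n) set \<Rightarrow> bool" where
  "holo_on f S \<longleftrightarrow> (\<forall>z\<in>S. \<exists>L. (f has_derivative L) (at z) \<and> (\<forall>c w. L (c *s w) = c * L w))"

definition holo_map_on :: "(complex ^ 'n \<Rightarrow> complex ^ 'm) \<Rightarrow> (complex ^ 'n) set \<Rightarrow> bool" where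
  "holo_map_on F S \<longleftrightarrow> (\<forall>j. holo_on (\<lambda>z. F z $ j) S)"

definition holo_self_map :: "(complex ^ 'n \<Rightarrow> complex ^ 'n) \<Rightarrow> bool" where
  "holo_self_map F \<longleftrightarrow> holo_map_on F Bn \<and> F ` Bn \<subseteq> Bn"

definition herm :: "complex ^ 'n \<Rightarrow> complex ^ 'n \<Rightarrow> complex" where
  "herm z w = (\<Sum>i\<in>UNIV. z $ i * cnj (w $ i))"

definition projP :: "complex ^ 'n \<Rightarrow> complex ^ 'n \<Rightarrow> complex ^ 'n" where
  "projP a z = (if a = 0 then 0 else (herm z a / herm a a) *s a)"

definition projQ :: "complex ^ 'n \<Rightarrow> complex ^ 'n \<Rightarrow> complex ^ 'n" where
  "projQ a z = z - projP a z"

text \<open>The involutive automorphism of the ball exchanging a and 0 (Rudin).\<close>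
definition autom :: "complex ^ 'n \<Rightarrow> complex ^ 'n \<Rightarrow> complex ^ 'n" where
  "autom a z = (1 / (1 - herm z a)) *s
      (a - projP a z - complex_of_real (sqrt (1 - (norm a)\<^sup>2)) *s projQ a z)"

definition pseudo_hyp :: "complex ^ 'n \<Rightarrow> complex ^ 'n \<Rightarrow> real" where
  "pseudo_hyp a z = norm (autom a z)"

text \<open>A radial weight is given by its profile omega on [0,1); omega(z) = omega(norm z).\<close>
definition radial_weight :: "(real \<Rightarrow> real) \<Rightarrow> ('n::finite) itself \<Rightarrow> bool" where
  "radial_weight \<omega> _ \<longleftrightarrow>
     (\<forall>r\<in>{0..<1}. \<omega> r > 0) \<and>
     \<omega> \<in> borel_measurable (restrict_space borel {0..<1}) \<and>
     (\<integral>\<^sup>+ z. ennreal (\<omega> (norm z)) \<partial>(dV :: (complex ^ 'n) measure)) < \<infinity>"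

definition omega_hat :: "(real \<Rightarrow> real) \<Rightarrow> real \<Rightarrow> ennreal" where
  "omega_hat \<omega> r = (\<integral>\<^sup>+ s. ennreal (\<omega> s) * indicator {r..<1} s \<partial>lborel)"

definition D_hat :: "(real \<Rightarrow> real) \<Rightarrow> bool" where
  "D_hat \<omega> \<longleftrightarrow> (\<exists>C\<ge>1. \<forall>r\<in>{0..<1}. omega_hat \<omega> r \<le> ennreal C * omega_hat \<omega> ((1 + r) / 2))"

definition D_check :: "(real \<Rightarrow> real) \<Rightarrow> bool" where
  "D_check \<omega> \<longleftrightarrow> (\<exists>C>1. \<exists>K>1. \<forall>r\<in>{0..<1}.
      omega_hat \<omega> r \<ge> ennreal C * omega_hat \<omega> (1 - (1 - r) / K))"

definition D_class :: "(real \<Rightarrow> real) \<Rightarrow> bool" where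
  "D_class \<omega> \<longleftrightarrow> D_hat \<omega> \<and> D_check \<omega>"

definition Apw :: "real \<Rightarrow> (real \<Rightarrow> real) \<Rightarrow> (complex ^ 'n \<Rightarrow> complex) set" where
  "Apw p \<omega> = {f. holo_on f Bn \<and>
      (\<integral>\<^sup>+ z. ennreal (norm (f z) powr p * \<omega> (norm z)) \<partial>dV) < \<infinity>}"

definition Apw_normp :: "real \<Rightarrow> (real \<Rightarrow> real) \<Rightarrow> (complex ^ 'n \<Rightarrow> complex) \<Rightarrow> real" where
  "Apw_normp p \<omega> f = enn2real (\<integral>\<^sup>+ z. ennreal (norm (f z) powr p * \<omega> (norm z)) \<partial>dV)"

definition Lq :: "real \<Rightarrow> 'a measure \<Rightarrow> ('a \<Rightarrow> complex) set" where
  "Lq q M = {g. g \<in> borel_measurable M \<and> (\<integral>\<^sup>+ z. ennreal (norm (g z) powr q) \<partial>M) < \<infinity>}"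

definition Lq_normp :: "real \<Rightarrow> 'a measure \<Rightarrow> ('a \<Rightarrow> complex) \<Rightarrow> real" where
  "Lq_normp q M g = enn2real (\<integral>\<^sup>+ z. ennreal (norm (g z) powr q) \<partial>M)"

definition bounded_op ::
  "real \<Rightarrow> (real \<Rightarrow> real) \<Rightarrow> real \<Rightarrow> (complex ^ 'n) measure
     \<Rightarrow> ((complex ^ 'n \<Rightarrow> complex) \<Rightarrow> (complex ^ 'n \<Rightarrow> complex)) \<Rightarrow> bool" where
  "bounded_op p \<omega> q M T \<longleftrightarrow>
     (\<forall>f\<in>Apw p \<omega>. T f \<in> Lq q M) \<and>
     (\<exists>C. \<forall>f\<in>Apw p \<omega>. Lq_normp q M (T f) powr (1/q) \<le> C * Apw_normp p \<omega> f powr (1/p))"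

definition compact_op ::
  "real \<Rightarrow> (real \<Rightarrow> real) \<Rightarrow> real \<Rightarrow> (complex ^ 'n) measure
     \<Rightarrow> ((complex ^ 'n \<Rightarrow> complex) \<Rightarrow> (complex ^ 'n \<Rightarrow> complex)) \<Rightarrow> bool" where
  "compact_op p \<omega> q M T \<longleftrightarrow>
     (\<forall>f\<in>Apw p \<omega>. T f \<in> Lq q M) \<and>
     (\<forall>fs :: nat \<Rightarrow> (complex ^ 'n \<Rightarrow> complex).
        (\<forall>k. fs k \<in> Apw p \<omega>) \<and> (\<exists>B. \<forall>k. Apw_normp p \<omega> (fs k) \<le> B) \<longrightarrow>
        (\<exists>s g. strict_mono s \<and> g \<in> Lq q M \<and>
           (\<lambda>j. Lq_normp q M (\<lambda>z. T (fs (s j)) z - g z)) \<longlonglongrightarrow> 0))"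

definition carleson :: "real \<Rightarrow> (real \<Rightarrow> real) \<Rightarrow> real \<Rightarrow> (complex ^ 'n) measure \<Rightarrow> bool" where
  "carleson p \<omega> q \<nu> \<longleftrightarrow> bounded_op p \<omega> q \<nu> (\<lambda>f. f)"

definition vanishing_carleson :: "real \<Rightarrow> (real \<Rightarrow> real) \<Rightarrow> real \<Rightarrow> (complex ^ 'n) measure \<Rightarrow> bool" where
  "vanishing_carleson p \<omega> q \<nu> \<longleftrightarrow> compact_op p \<omega> q \<nu> (\<lambda>f. f)"

definition measure_add :: "'a measure \<Rightarrow> 'a measure \<Rightarrow> 'a measure" where
  "measure_add M N = measure_of (space M) (sets M) (\<lambda>A. emeasure M A + emeasure N A)"

definition pushfwd :: "(complex ^ 'n) measure \<Rightarrow> (complex ^ 'n \<Rightarrow> ennreal)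
     \<Rightarrow> (complex ^ 'n \<Rightarrow> complex ^ 'n) \<Rightarrow> (complex ^ 'n) measure" where
  "pushfwd \<mu> g F = distr (density \<mu> g) Bn_borel F"

definition wcomp_diff :: "(complex ^ 'n \<Rightarrow> complex) \<Rightarrow> (complex ^ 'n \<Rightarrow> complex ^ 'n)
     \<Rightarrow> (complex ^ 'n \<Rightarrow> complex) \<Rightarrow> (complex ^ 'n \<Rightarrow> complex ^ 'n)
     \<Rightarrow> (complex ^ 'n \<Rightarrow> complex) \<Rightarrow> (complex ^ 'n \<Rightarrow> complex)" where
  "wcomp_diff u \<phi> v \<psi> f = (\<lambda>z. u z * f (\<phi> z) - v z * f (\<psi> z))"

end

theory Submission
  imports Defs "HOL-Complex_Analysis.Complex_Analysis"
begin

text \<open>Let \<open>\<tau>\<close> be the tail integral of the weight, \<open>W(a) = (1 - |a|)\<^sup>n \<tau>(|a|)\<close>, and \<open>T\<close> the operator.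
  Everything passes through the averages \<open>\<nu>(\<Delta>(a,s)) / W(a)\<^bsup>q/p\<^esup>\<close> over pseudohyperbolic balls: their
  boundedness (vanishing at the boundary) makes \<open>\<nu>\<close> a (vanishing) \<open>q\<close>-Carleson measure, by the sub-mean
  value property of \<open>|f|\<^sup>p\<close>, the comparison of \<open>\<omega>\<close> with the smooth weight \<open>\<tau>(r)/(1 - r)\<close> and Tonelli.
  The averages are bounded by testing \<open>T\<close> on \<open>f\<^sub>a = W(a)\<^bsup>-1/p\<^esup> ((1 - |a|\<^sup>2)/(1 - <z,a>))\<^sup>\<gamma>\<close> and on
  \<open>f\<^sub>a g\<close> with \<open>g\<close> a component of the automorphism \<open>\<phi>\<^sub>a\<close>: the combination
  \<open>T(f\<^sub>a g) - (g \<circ> \<psi>) T f\<^sub>a = u (f\<^sub>a \<circ> \<phi>) (g \<circ> \<phi> - g \<circ> \<psi>)\<close> isolates \<open>\<rho> u\<close>, and on \<open>G\<^sub>r\<close>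
  the identity \<open>(u - v) (f\<^sub>a \<circ> \<phi>) = T f\<^sub>a - v (f\<^sub>a \<circ> \<phi> - f\<^sub>a \<circ> \<psi>)\<close> then isolates \<open>u - v\<close>.\<close>

section \<open>Integral means on circles\<close>

text \<open>The weight has no pointwise regularity, so it is never averaged over a pseudohyperbolic
  ball; only its tail appears there. \<open>D_hat\<close> makes the tail doubling, hence
  \<open>W\<close> comparable at any two points of such a ball and the kernels integrable;
  \<open>D_check\<close> is what allows the weight to be replaced by the smooth one. Since
  \<open>p\<close> may be below 1, Jensen's inequality and weak convergence are not at hand:
  subharmonicity of \<open>|f|^p\<close> is derived on complex lines by reflecting zeros and taking
  a logarithm, and compactness is exploited through pointwise convergence and Fatou's lemma. The
  averages are needed at every radius and not only at 3/4: on \<open>G\<close> the point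
  \<open>\<psi> z\<close> lies in a larger ball about \<open>a\<close> than \<open>\<phi> z\<close>,
  so the bound for \<open>u - v\<close> at one radius rests on the bound for \<open>\<rho> v\<close>
  at a larger one. The error term there is harmless because the values of the test function at
  \<open>\<phi> z\<close> and \<open>\<psi> z\<close> differ by at most a multiple of
  \<open>\<rho> z\<close>. The exponent is taken so large that the test functions have bounded norm
  and also tend to 0 pointwise at the boundary, which the compact case needs.\<close>

lemma integral_circle_rotate:
  fixes f :: "real \<Rightarrow> real"
  assumes cont: "continuous_on UNIV f" and per: "\<And>t. f (t + 2 * pi) = f t"
    and a: "0 \<le> a" "a \<le> 2 * pi"
  shows "integral {0..2*pi} (\<lambda>t. f (t + a)) = integral {0..2*pi} f"
proof -
  have int: "f integrable_on {x..y}" for x y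
    by (intro integrable_continuous_real continuous_on_subset[OF cont]) auto
  have "integral {0..2*pi} (\<lambda>t. f (t + a)) = integral {a..2*pi + a} f"
    using integral_shift_real_ivl[of a a "2 * pi + a" f] by simp
  also have "\<dots> = integral {a..2*pi} f + integral {2*pi..2*pi + a} f"
    using a int by (intro Henstock_Kurzweil_Integration.integral_combine[symmetric]) auto
  also have "integral {2*pi..2*pi + a} f = integral {0..a} (\<lambda>t. f (t + 2*pi))"
    using integral_shift_real_ivl[of "2*pi" "2*pi" "2 * pi + a" f] by simp
  also have "\<dots> = integral {0..a} f" by (simp add: per)
  also have "integral {a..2*pi} f + integral {0..a} f = integral {0..2*pi} f"
    using a int Henstock_Kurzweil_Integration.integral_combine[of 0 a "2*pi" f] by simp
  finally show ?thesis .
qed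

text \<open>Linearise the modulus on the inner circle by a unimodular factor; the resulting integral is
  holomorphic in the radius and the maximum principle applies.\<close>
lemma circle_mean_norm_mono:
  assumes hol: "H holomorphic_on ball 0 R" and nz: "\<And>z. z \<in> ball 0 R \<Longrightarrow> H z \<noteq> 0"
    and r: "0 \<le> r1" "r1 \<le> r2" "r2 < R"
  shows "integral {0..2*pi} (\<lambda>t. norm (H (of_real r1 * cis t)))
     \<le> integral {0..2*pi} (\<lambda>t. norm (H (of_real r2 * cis t)))"
proof -
  define \<psi> where "\<psi> t = cnj (sgn (H (of_real r1 * cis t)))" for t
  define F where "F l = integral {0..2*pi} (\<lambda>t. H (l * cis t) * \<psi> t)" for l
  have contH: "continuous_on (ball 0 R) H" by (rule holomorphic_on_imp_continuous_on[OF hol])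
  have "continuous_on (ball 0 R) (deriv H)"
    using hol by (intro holomorphic_on_imp_continuous_on holomorphic_deriv) auto
  note contH' = this
  have circ: "continuous_on UNIV (\<lambda>t. H (l * cis t))" if "l \<in> ball 0 R" for l
    using that by (intro continuous_on_compose2[OF contH] continuous_intros) (auto simp: norm_mult)
  have cpsi: "continuous_on UNIV \<psi>"
    unfolding \<psi>_def sgn_div_norm using r
    by (intro continuous_intros circ) (auto simp: norm_mult intro!: nz)
  have psi1: "norm (\<psi> t) = 1" for t
    using nz[of "of_real r1 * cis t"] r by (simp add: \<psi>_def norm_sgn norm_mult)
  have intF: "(\<lambda>t. H (l * cis t) * \<psi> t) integrable_on {0..2*pi}" if "l \<in> ball 0 R" for l
    by (intro integrable_continuous_real continuous_on_mult continuous_on_subset[OF circ[OF that]]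
          continuous_on_subset[OF cpsi]) auto
  have holF: "F holomorphic_on ball 0 R"
  proof -
    have "(\<lambda>l. integral (cbox 0 (2*pi)) (\<lambda>t. H (l * cis t) * \<psi> t)) holomorphic_on ball 0 R"
    proof (rule leibniz_rule_holomorphic)
      fix l t assume l: "l \<in> ball (0::complex) R" and "t \<in> cbox 0 (2 * pi)"
      have "(H has_field_derivative deriv H (l * cis t)) (at (l * cis t))"
        using l hol by (intro holomorphic_derivI[of _ "ball 0 R"]) (auto simp: norm_mult)
      then show "((\<lambda>x. H (x * cis t) * \<psi> t) has_field_derivative deriv H (l * cis t) * cis t * \<psi> t)
          (at l within ball 0 R)"
        by (intro DERIV_cmult_right DERIV_chain2[of H, THEN DERIV_subset] derivative_eq_intros) auto
    next
      have "continuous_on (ball 0 R \<times> cbox 0 (2*pi)) (\<lambda>x. deriv H (fst x * cis (snd x)) * cis (snd x) * \<psi> (snd x))"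
        by (intro continuous_intros continuous_on_compose2[OF contH'] continuous_on_compose2[OF cpsi])
          (auto simp: norm_mult)
      then show "continuous_on (ball 0 R \<times> cbox 0 (2*pi)) (\<lambda>(x, t). deriv H (x * cis t) * cis t * \<psi> t)"
        by (simp add: case_prod_beta)
    qed (use intF in auto)
    then show ?thesis by (simp add: F_def[abs_def])
  qed
  have "norm (F (of_real r1)) \<le> integral {0..2*pi} (\<lambda>t. norm (H (of_real r2 * cis t)))"
  proof (rule maximum_modulus_frontier[of F "cball 0 r2"])
    show "F holomorphic_on interior (cball 0 r2)"
      by (rule holomorphic_on_subset[OF holF]) (use r in auto)
    show "continuous_on (closure (cball 0 r2)) F"
      by (rule continuous_on_subset[OF holomorphic_on_imp_continuous_on[OF holF]]) (use r in auto)
    fix z :: complex assume "z \<in> frontier (cball 0 r2)"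
    then have z: "norm z = r2" using r by simp
    obtain a where a: "0 \<le> a" "a < 2 * pi" "z = of_real r2 * cis a"
      using Arg2pi[of z] z by (intro that[of "Arg2pi z"]) (simp_all add: is_Arg_def cis_conv_exp)
    have zin: "z \<in> ball 0 R" using z r by simp
    have "norm (F z) \<le> integral {0..2*pi} (\<lambda>t. norm (H (z * cis t)))"
      unfolding F_def
      by (intro integral_norm_bound_integral intF zin integrable_continuous_real continuous_intros
          continuous_on_subset[OF circ[OF zin]]) (auto simp: norm_mult psi1)
    \<comment> \<open>Rotation invariance makes the bound the same at every point \<open>z\<close>
      of the outer circle, which is what the maximum principle asks for.\<close>
    also have "(\<lambda>t. norm (H (z * cis t))) = (\<lambda>t. norm (H (of_real r2 * cis (t + a))))"
      by (simp add: a(3) cis_mult mult.assoc add.commute)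
    also have "integral {0..2*pi} \<dots> = integral {0..2*pi} (\<lambda>t. norm (H (of_real r2 * cis t)))"
      using a r by (intro integral_circle_rotate[where f = "\<lambda>t. norm (H (of_real r2 * cis t))"]
          continuous_intros circ) (auto simp: cis_mult[symmetric])
    finally show "norm (F z) \<le> integral {0..2*pi} (\<lambda>t. norm (H (of_real r2 * cis t)))" .
  qed (use r in auto)
  moreover have "F (of_real r1) = of_real (integral {0..2*pi} (\<lambda>t. norm (H (of_real r1 * cis t))))"
  proof -
    have *: "H (of_real r1 * cis t) * \<psi> t = of_real (norm (H (of_real r1 * cis t)))" for t
      unfolding \<psi>_def sgn_div_norm
      by (cases "H (of_real r1 * cis t) = 0")
        (auto simp: complex_norm_square[symmetric] scaleR_conv_of_real field_simps power2_eq_square mult.left_commute)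
    have "continuous_on {0..2*pi} (\<lambda>t. norm (H (of_real r1 * cis t)))"
      using r by (intro continuous_intros continuous_on_subset[OF circ]) auto
    then have "((\<lambda>t. norm (H (of_real r1 * cis t))) has_integral
        integral {0..2*pi} (\<lambda>t. norm (H (of_real r1 * cis t)))) {0..2*pi}"
      by (intro integrable_integral integrable_continuous_real)
    from has_integral_of_real[OF this] show ?thesis
      unfolding F_def * by (rule integral_unique)
  qed
  moreover have "integral {0..2*pi} (\<lambda>t. norm (H (of_real r1 * cis t))) \<ge> 0"
    using r by (intro integral_nonneg integrable_continuous_real continuous_intros
        continuous_on_subset[OF circ]) auto
  ultimately show ?thesis by simp
qed

text \<open>Not divided by the length of the circle, so the value at radius 0 is
  \<open>2 * pi * norm (g 0) powr p\<close>; the sub-mean value inequality uses it in that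
  form.\<close>

definition circle_pmean :: "real \<Rightarrow> (complex \<Rightarrow> complex) \<Rightarrow> real \<Rightarrow> real" where
  "circle_pmean p g r = integral {0..2*pi} (\<lambda>t. norm (g (of_real r * cis t)) powr p)"

lemma continuous_on_norm_powr:
  fixes f :: "'a::topological_space \<Rightarrow> 'b::real_normed_vector"
  assumes "continuous_on S f" "p > 0"
  shows "continuous_on S (\<lambda>x. norm (f x) powr p)"
  using assms by (intro continuous_on_powr' continuous_intros) auto

lemma circle_pmean_integrable:
  assumes "continuous_on (ball 0 R) g" "0 \<le> r" "r < R" "p > 0"
  shows "(\<lambda>t. norm (g (of_real r * cis t)) powr p) integrable_on {a..b}"
  using assms
  by (intro integrable_continuous_real continuous_on_norm_powr continuous_on_compose2[OF assms(1)] continuous_intros)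
    (auto simp: norm_mult)

text \<open>A zero-free function on a disc has a holomorphic logarithm \<open>L\<close>, and
  \<open>|g|^p = |exp (p L)|\<close> reduces the claim to exponent 1. Zeros are allowed on the
  circle of radius \<open>r2\<close> itself, so that radius is reached by continuity from the
  left.\<close>

lemma circle_pmean_mono_zero_free:
  assumes hol: "g holomorphic_on UNIV" and nz: "\<And>z. z \<in> ball 0 r2 \<Longrightarrow> g z \<noteq> 0"
    and r: "0 \<le> r1" "r1 < r2" and p: "p > 0"
  shows "circle_pmean p g r1 \<le> circle_pmean p g r2"
proof -
  have cg: "continuous_on UNIV g" using hol holomorphic_on_imp_continuous_on by blast
  obtain L where L: "L holomorphic_on ball 0 r2" "\<And>z. z \<in> ball 0 r2 \<Longrightarrow> g z = exp (L z)"
    using contractible_imp_holomorphic_log[of g "ball 0 r2"] holomorphic_on_subset[OF hol] nz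
      convex_imp_contractible[OF convex_ball] by (metis subset_UNIV)
  define H where "H z = exp (of_real p * L z)" for z
  have normH: "norm (H z) = norm (g z) powr p" if "z \<in> ball 0 r2" for z
    using that by (simp add: H_def L powr_def)
  have "H holomorphic_on ball 0 r2" unfolding H_def by (intro holomorphic_intros L)
  have le: "circle_pmean p g r1 \<le> circle_pmean p g s" if "r1 \<le> s" "s < r2" for s
  proof -
    have "circle_pmean p g x = integral {0..2*pi} (\<lambda>t. norm (H (of_real x * cis t)))" if "0 \<le> x" "x < r2" for x
      unfolding circle_pmean_def using that by (intro integral_cong) (simp add: normH norm_mult)
    then show ?thesis
      using circle_mean_norm_mono[OF \<open>H holomorphic_on ball 0 r2\<close>, of r1 s] that r by (simp add: H_def)
  qed
  have "continuous_on UNIV (\<lambda>s. integral (cbox 0 (2*pi)) (\<lambda>t. norm (g (of_real s * cis t)) powr p))"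
  proof (rule integral_continuous_on_param)
    show "continuous_on (UNIV \<times> cbox 0 (2 * pi)) (\<lambda>(s, t). norm (g (of_real s * cis t)) powr p)"
      unfolding case_prod_beta
      by (intro continuous_on_norm_powr p continuous_on_compose2[OF cg] continuous_intros) auto
  qed
  then have "continuous_on UNIV (circle_pmean p g)"
    by (simp add: circle_pmean_def[abs_def])
  then have "(circle_pmean p g \<longlongrightarrow> circle_pmean p g r2) (at_left r2)"
    by (simp add: continuous_on_eq_continuous_within continuous_within filterlim_at_split)
  moreover have "eventually (\<lambda>s. circle_pmean p g r1 \<le> circle_pmean p g s) (at_left r2)"
    using eventually_at_left_real[OF r(2)] by eventually_elim (auto intro: le)
  ultimately show ?thesis
    by (intro tendsto_lowerbound[of "circle_pmean p g"]) auto
qed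

text \<open>Reflecting the zeros inside the disc at its boundary circle (Blaschke factors).\<close>
lemma poly_reflect_zeros:
  fixes P :: "complex poly"
  assumes "P \<noteq> 0" and r: "r > 0"
  shows "\<exists>Q. (\<forall>z\<in>ball 0 r. poly Q z \<noteq> 0) \<and> (\<forall>z\<in>cball 0 r. norm (poly P z) \<le> norm (poly Q z))
     \<and> (\<forall>z\<in>sphere 0 r. norm (poly Q z) = norm (poly P z))"
  using assms(1)
proof (induction "degree P" arbitrary: P rule: less_induct)
  case less
  show ?case
  proof (cases "\<exists>a\<in>ball 0 r. poly P a = 0")
    case False
    then show ?thesis by (intro exI[of _ P]) auto
  next
    case True
    then obtain a where a: "norm a < r" "poly P a = 0" by auto
    then obtain P' where P': "P = [:-a, 1:] * P'" by (auto simp: poly_eq_0_iff_dvd dvd_def)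
    have "P' \<noteq> 0" using less.prems P' by auto
    have "degree P' < degree P" using P' \<open>P' \<noteq> 0\<close> by (simp add: degree_mult_eq del: mult_pCons_left)
    from less.hyps[OF this \<open>P' \<noteq> 0\<close>] obtain Q where
      Q: "\<And>z. z \<in> ball 0 r \<Longrightarrow> poly Q z \<noteq> 0" "\<And>z. z \<in> cball 0 r \<Longrightarrow> norm (poly P' z) \<le> norm (poly Q z)"
       "\<And>z. z \<in> sphere 0 r \<Longrightarrow> norm (poly Q z) = norm (poly P' z)" by blast
    \<comment> \<open>The factor \<open>z - a\<close> is replaced by its reflection, which has the
      same modulus on the circle of radius \<open>r\<close>, a larger one inside, and its zero
      outside; all three facts are read off \<open>key\<close>.\<close>
    let ?b = "\<lambda>z. of_real r - cnj a * z / of_real r"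
    have key: "(norm (?b z))\<^sup>2 - (norm (z - a))\<^sup>2 = (r\<^sup>2 - (norm a)\<^sup>2) * (r\<^sup>2 - (norm z)\<^sup>2) / r\<^sup>2" for z
    proof -
      have "of_real r * ?b z = of_real (r\<^sup>2) - cnj a * z" using r by (simp add: field_simps power2_eq_square)
      then have "r * norm (?b z) = norm (of_real (r\<^sup>2) - cnj a * z)"
        using r by (metis norm_mult norm_of_real abs_of_pos)
      then have "r\<^sup>2 * (norm (?b z))\<^sup>2 = (norm (of_real (r\<^sup>2) - cnj a * z))\<^sup>2"
        by (simp flip: power_mult_distrib)
      also have "\<dots> = r\<^sup>2 * (norm (z - a))\<^sup>2 + (r\<^sup>2 - (norm a)\<^sup>2) * (r\<^sup>2 - (norm z)\<^sup>2)"
        by (simp add: cmod_power2) (simp add: algebra_simps power2_eq_square)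
      finally show ?thesis using r by (simp add: field_simps)
    qed
    have A: "norm (z - a) \<le> norm (?b z)" if "norm z \<le> r" for z
    proof (rule power2_le_imp_le)
      have "0 \<le> (r\<^sup>2 - (norm a)\<^sup>2) * (r\<^sup>2 - (norm z)\<^sup>2) / r\<^sup>2"
        using that a r by (intro divide_nonneg_nonneg mult_nonneg_nonneg) (auto intro!: power_mono)
      then show "(norm (z - a))\<^sup>2 \<le> (norm (?b z))\<^sup>2" using key[of z] by linarith
    qed auto
    have B: "norm (?b z) = norm (z - a)" if "norm z = r" for z
    proof (rule power2_eq_imp_eq)
      show "(norm (?b z))\<^sup>2 = (norm (z - a))\<^sup>2" using key[of z] that by simp
    qed auto
    have C: "?b z \<noteq> 0" if "norm z < r" for z
    proof
      assume "?b z = 0"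
      with A[of z] that have "z = a" by simp
      have "0 < (r\<^sup>2 - (norm a)\<^sup>2) * (r\<^sup>2 - (norm z)\<^sup>2) / r\<^sup>2"
        using a r that by (intro divide_pos_pos mult_pos_pos) (auto intro!: power_strict_mono)
      then have "0 < (norm (?b z))\<^sup>2 - (norm (z - a))\<^sup>2" by (simp only: key)
      moreover have "norm (?b z) = 0" "norm (z - a) = 0"
        using \<open>?b z = 0\<close> \<open>z = a\<close> by (simp_all only: norm_zero diff_self)
      ultimately show False by simp
    qed
    have pb: "poly ([:of_real r, - cnj a / of_real r:] * Q) z = ?b z * poly Q z" for z
      by (simp add: algebra_simps)
    have pP: "poly P z = (z - a) * poly P' z" for z by (simp add: P' algebra_simps)
    show ?thesis
      by (intro exI[of _ "[:of_real r, - cnj a / of_real r:] * Q"] conjI ballI; unfold pb pP norm_mult)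
        (use A B C Q in \<open>auto intro!: mult_mono\<close>)
  qed
qed

text \<open>Let \<open>Q\<close> be \<open>P\<close> with its zeros reflected. On the inner circle
  \<open>P\<close> is dominated by \<open>Q\<close>, to \<open>Q\<close> the zero-free case applies,
  and on the outer circle \<open>Q\<close> and \<open>P\<close> agree in modulus.\<close>

lemma circle_pmean_mono_poly:
  assumes r: "0 \<le> r1" "r1 < r2" and p: "p > 0"
  shows "circle_pmean p (poly P) r1 \<le> circle_pmean p (poly P) r2"
proof (cases "P = 0")
  case True
  then show ?thesis by (simp add: circle_pmean_def)
next
  case False
  have "r2 > 0" using r by simp
  have hol: "poly P' holomorphic_on UNIV" for P' by (intro holomorphic_intros)
  obtain Q where Q: "\<And>z. z \<in> ball 0 r2 \<Longrightarrow> poly Q z \<noteq> 0" "\<And>z. z \<in> cball 0 r2 \<Longrightarrow> norm (poly P z) \<le> norm (poly Q z)"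
       "\<And>z. z \<in> sphere 0 r2 \<Longrightarrow> norm (poly Q z) = norm (poly P z)"
    using poly_reflect_zeros[OF False \<open>r2 > 0\<close>] by blast
  have int: "(\<lambda>t. norm (poly P' (of_real s * cis t)) powr p) integrable_on {0..2*pi}" if "s \<ge> 0" for P' s
    using that p by (intro circle_pmean_integrable[of "s+1"] continuous_intros) auto
  have "circle_pmean p (poly P) r1 \<le> circle_pmean p (poly Q) r1"
    unfolding circle_pmean_def using r p
    by (intro integral_le int) (auto intro!: powr_mono2 Q simp: norm_mult)
  also have "\<dots> \<le> circle_pmean p (poly Q) r2"
    using Q r p hol by (intro circle_pmean_mono_zero_free) auto
  also have "\<dots> = circle_pmean p (poly P) r2"
    unfolding circle_pmean_def using r by (intro integral_cong) (simp add: Q norm_mult)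
  finally show ?thesis .
qed

text \<open>Taylor polynomials reduce the claim to functions with finitely many zeros. They converge
  pointwise and are bounded by one constant on the closed disc of radius \<open>r2\<close>, so both
  means pass to the limit by dominated convergence.\<close>

lemma circle_pmean_mono:
  assumes hol: "g holomorphic_on ball 0 R" and r: "0 \<le> r1" "r1 \<le> r2" "r2 < R" and p: "p > 0"
  shows "circle_pmean p g r1 \<le> circle_pmean p g r2"
proof (cases "r1 = r2")
  case False
  define c where "c n = (deriv ^^ n) g 0 / fact n" for n
  define P where "P N = (\<Sum>n<N. monom (c n) n)" for N
  have polyP: "poly (P N) z = (\<Sum>n<N. c n * z ^ n)" for N z
    by (simp add: P_def poly_sum poly_monom)
  have sums: "(\<lambda>n. c n * z ^ n) sums g z" if "z \<in> ball 0 R" for z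
    using holomorphic_power_series[OF hol that] by (simp add: c_def)
  have "summable (\<lambda>n. norm (c n * of_real r2 ^ n))"
  proof -
    have "of_real ((r2 + R) / 2) \<in> ball (0::complex) R" using r by (simp del: of_real_add of_real_divide)
    from powser_insidea[OF sums_summable[OF sums[OF this]], of "of_real r2"] show ?thesis
      using r by (simp del: of_real_add of_real_divide)
  qed
  note sabs = this
  define B where "B = (\<Sum>n. norm (c n * of_real r2 ^ n))"
  have bound: "norm (poly (P N) z) \<le> B" if "norm z \<le> r2" for N z
  proof -
    have "norm (poly (P N) z) \<le> (\<Sum>n<N. norm (c n * z ^ n))" unfolding polyP by (rule norm_sum)
    also have "\<dots> \<le> (\<Sum>n<N. norm (c n * of_real r2 ^ n))"
      using that r by (intro sum_mono) (auto simp: norm_mult norm_power intro!: mult_left_mono power_mono)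
    also have "\<dots> \<le> B" unfolding B_def by (rule sum_le_suminf[OF sabs]) auto
    finally show ?thesis .
  qed
  have lim: "(\<lambda>N. circle_pmean p (poly (P N)) s) \<longlonglongrightarrow> circle_pmean p g s" if s: "0 \<le> s" "s \<le> r2" for s
    unfolding circle_pmean_def
  proof (rule dominated_convergence[where h = "\<lambda>_. B powr p"])
    show "(\<lambda>t. norm (poly (P N) (of_real s * cis t)) powr p) integrable_on {0..2*pi}" for N
      using s p by (intro circle_pmean_integrable[of "s+1"] continuous_intros) auto
    show "norm (norm (poly (P N) (of_real s * cis t)) powr p) \<le> B powr p" for N t
      using s p by (auto intro!: powr_mono2 bound simp: norm_mult)
    fix t
    have "(\<lambda>N. poly (P N) (of_real s * cis t)) \<longlonglongrightarrow> g (of_real s * cis t)"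
      using sums[of "of_real s * cis t"] s r unfolding polyP sums_def by (simp add: norm_mult)
    then show "(\<lambda>N. norm (poly (P N) (of_real s * cis t)) powr p) \<longlonglongrightarrow> norm (g (of_real s * cis t)) powr p"
      using p by (intro tendsto_powr2 tendsto_norm tendsto_const) auto
  qed auto
  show ?thesis
    using r p False by (intro LIMSEQ_le[OF lim lim]) (auto intro!: exI[of _ 0] circle_pmean_mono_poly)
qed auto

lemma nn_integral_circle:
  assumes "continuous_on (ball 0 R) g" "0 \<le> r" "r < R" "p > 0"
  shows "(\<integral>\<^sup>+t. ennreal (norm (g (of_real r * cis t)) powr p) * indicator {0..2*pi} t \<partial>lborel)
    = ennreal (circle_pmean p g r)"
proof -
  have c: "continuous_on UNIV (\<lambda>t. norm (g (of_real r * cis t)) powr p)"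
    using assms by (intro continuous_on_norm_powr continuous_on_compose2[OF assms(1)] continuous_intros)
      (auto simp: norm_mult)
  have "((\<lambda>t. norm (g (of_real r * cis t)) powr p) has_integral circle_pmean p g r) {0..2*pi}"
    unfolding circle_pmean_def by (intro integrable_integral circle_pmean_integrable[OF assms])
  then show ?thesis
    by (intro nn_integral_has_integral_lebesgue') (use c in \<open>auto\<close>)
qed

section \<open>Lebesgue measure, isometries and polar coordinates\<close>

lemma nn_integral_lborel_shift:
  fixes f :: "'a::euclidean_space \<Rightarrow> ennreal"
  assumes [measurable]: "f \<in> borel_measurable borel"
  shows "(\<integral>\<^sup>+x. f (c + x) \<partial>lborel) = (\<integral>\<^sup>+x. f x \<partial>lborel)"
proof -
  have "(\<integral>\<^sup>+x. f x \<partial>lborel) = (\<integral>\<^sup>+x. f x \<partial>(distr lborel borel ((+) c)))"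
    by (simp add: lborel_distr_plus)
  also have "\<dots> = (\<integral>\<^sup>+x. f (c + x) \<partial>lborel)"
    by (subst nn_integral_distr) auto
  finally show ?thesis by simp
qed

lemma nn_integral_lborel_scale:
  fixes f :: "'a::euclidean_space \<Rightarrow> ennreal"
  assumes [measurable]: "f \<in> borel_measurable borel" and c: "c > 0"
  shows "(\<integral>\<^sup>+x. f x \<partial>lborel) = ennreal (c ^ DIM('a)) * (\<integral>\<^sup>+x. f (c *\<^sub>R x) \<partial>lborel)"
  using c
  by (subst lborel_affine[of c 0])
    (auto simp: nn_integral_density nn_integral_distr nn_integral_cmult)

lemma emeasure_lborel_ball_pos:
  "emeasure lborel (ball (c::'a::euclidean_space) 1) \<noteq> 0" "emeasure lborel (ball (c::'a) 1) \<noteq> \<infinity>"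
proof -
  show "emeasure lborel (ball c 1) \<noteq> \<infinity>"
    using emeasure_bounded_finite[of "ball c 1"] by (auto simp: less_top)
  obtain a b where ab: "c \<in> box a b" "cbox a b \<subseteq> ball c 1"
    by (meson open_ball open_contains_cbox centre_in_ball zero_less_one)
  have "emeasure lborel (box a b) \<noteq> 0"
  proof -
    have *: "a \<bullet> i < b \<bullet> i" if "i \<in> Basis" for i
      using ab(1) that by (fastforce simp: mem_box)
    have "emeasure lborel (box a b) = ennreal (\<Prod>i\<in>Basis. (b - a) \<bullet> i)"
      using * by (intro emeasure_lborel_box) (auto intro: less_imp_le)
    moreover have "(\<Prod>i\<in>Basis. (b - a) \<bullet> i) > 0"
      using * by (intro prod_pos) (auto simp: inner_diff_left)
    ultimately show ?thesis by (simp add: ennreal_eq_0_iff)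
  qed
  moreover have "emeasure lborel (box a b) \<le> emeasure lborel (ball c 1)"
    using ab(2) box_subset_cbox by (intro emeasure_mono) auto
  ultimately show "emeasure lborel (ball c 1) \<noteq> 0" by auto
qed

text \<open>Uniqueness of Haar measure by Tonelli: test the product of the image measure and Lebesgue
  measure on the product of a set and the unit ball, whose preimages under the isometry are
  translates of the ball.\<close>
lemma lborel_distr_orthogonal:
  fixes U :: "'a::euclidean_space \<Rightarrow> 'a"
  assumes U: "orthogonal_transformation U"
  shows "distr lborel borel U = lborel"
proof (rule measure_eqI)
  have lin: "linear U" using U orthogonal_transformation_linear by blast
  have [measurable]: "U \<in> borel_measurable borel"
    using linear_continuous_on[of U UNIV] lin
    by (simp add: linear_conv_bounded_linear borel_measurable_continuous_onI)
  obtain V where V: "\<And>x. U (V x) = x"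
    using orthogonal_transformation_surj[OF U] by (metis surj_f_inv_f)
  let ?B = "ball (0::'a) 1"
  have [measurable]: "?B \<in> sets borel" by simp
  fix A assume "A \<in> sets (distr lborel borel U)"
  then have A[measurable]: "A \<in> sets borel" by simp
  have MA: "emeasure (distr lborel borel U) A = (\<integral>\<^sup>+x. indicator A (U x) \<partial>lborel)"
    by (simp add: nn_integral_distr flip: nn_integral_indicator)
  have shift: "(\<integral>\<^sup>+x. indicator A (U x + y) \<partial>lborel) = (\<integral>\<^sup>+x. indicator A (U x) \<partial>lborel)" for y
    using nn_integral_lborel_shift[of "\<lambda>x. indicator A (U x)" "V y"]
    by (simp add: linear_add[OF lin] V add.commute)
  have "emeasure lborel ?B * emeasure (distr lborel borel U) A
      = (\<integral>\<^sup>+y. indicator ?B y * (\<integral>\<^sup>+x. indicator A (U x + y) \<partial>lborel) \<partial>lborel)"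
    by (subst shift, subst nn_integral_multc) (simp_all add: MA)
  also have "\<dots> = (\<integral>\<^sup>+y. (\<integral>\<^sup>+x. indicator ?B y * indicator A (U x + y) \<partial>lborel) \<partial>lborel)"
    by (subst nn_integral_cmult) auto
  also have "\<dots> = (\<integral>\<^sup>+x. (\<integral>\<^sup>+y. indicator ?B y * indicator A (U x + y) \<partial>lborel) \<partial>lborel)"
    by (rule lborel_pair.Fubini') measurable
  also have "\<dots> = (\<integral>\<^sup>+x. (\<integral>\<^sup>+y. indicator ?B (y - U x) * indicator A y \<partial>lborel) \<partial>lborel)"
  proof (rule nn_integral_cong)
    fix x
    show "(\<integral>\<^sup>+y. indicator ?B y * indicator A (U x + y) \<partial>lborel)
      = (\<integral>\<^sup>+y. indicator ?B (y - U x) * indicator A y \<partial>lborel)"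
      using nn_integral_lborel_shift[of "\<lambda>y. indicator ?B (y - U x) * indicator A y" "U x"] by simp
  qed
  also have "\<dots> = (\<integral>\<^sup>+y. (\<integral>\<^sup>+x. indicator ?B (y - U x) * indicator A y \<partial>lborel) \<partial>lborel)"
    by (rule lborel_pair.Fubini') measurable
  also have "\<dots> = (\<integral>\<^sup>+y. emeasure lborel ?B * indicator A y \<partial>lborel)"
  proof (rule nn_integral_cong)
    fix y
    have "indicator ?B (y - U x) = (indicator ?B (- V y + x) :: ennreal)" for x
    proof -
      have "y - U x = U (V y - x)" by (simp add: linear_diff[OF lin] V)
      then show ?thesis
        using orthogonal_transformation_norm[OF U, of "V y - x"]
        by (simp add: indicator_def norm_minus_commute)
    qed
    then have "(\<integral>\<^sup>+x. indicator ?B (y - U x) \<partial>lborel) = (\<integral>\<^sup>+x. indicator ?B (- V y + x) \<partial>lborel)"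
      by simp
    also have "\<dots> = emeasure lborel ?B"
      by (subst nn_integral_lborel_shift) auto
    finally show "(\<integral>\<^sup>+x. indicator ?B (y - U x) * indicator A y \<partial>lborel) = emeasure lborel ?B * indicator A y"
      by (subst nn_integral_multc) auto
  qed
  also have "\<dots> = emeasure lborel ?B * emeasure lborel A"
    by (subst nn_integral_cmult) auto
  finally show "emeasure (distr lborel borel U) A = emeasure lborel A"
    using emeasure_lborel_ball_pos[of "0::'a"] by (simp add: ennreal_mult_cancel_left)
qed simp

lemma nn_integral_lborel_orthogonal:
  fixes f :: "'a::euclidean_space \<Rightarrow> ennreal" and U :: "'a \<Rightarrow> 'a"
  assumes "orthogonal_transformation U" and [measurable]: "f \<in> borel_measurable borel"
  shows "(\<integral>\<^sup>+x. f (U x) \<partial>lborel) = (\<integral>\<^sup>+x. f x \<partial>lborel)"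
proof -
  have "linear U" using assms orthogonal_transformation_linear by blast
  then have [measurable]: "U \<in> borel_measurable borel"
    using linear_continuous_on[of U UNIV]
    by (simp add: linear_conv_bounded_linear borel_measurable_continuous_onI)
  show ?thesis
    by (subst (2) lborel_distr_orthogonal[OF assms(1), symmetric]) (simp add: nn_integral_distr)
qed

text \<open>Polar coordinates use this with \<open>c = norm w\<close>: the tail integral cancels the
  factor \<open>norm w ^ d\<close> left over by the radial substitution.\<close>

lemma nn_integral_inverse_power_tail:
  fixes c :: real
  assumes c: "c > 0" and d: "d > 0"
  shows "(\<integral>\<^sup>+s. ennreal (real d * inverse (s ^ Suc d)) * indicator {c..} s \<partial>lborel) = ennreal (inverse (c ^ d))"
proof -
  have "(\<integral>\<^sup>+s. ennreal (real d * inverse (s ^ Suc d)) * indicator {c..} s \<partial>lborel)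
      = ennreal (0 - (- inverse (c ^ d)))"
  proof (rule nn_integral_FTC_atLeast)
    fix x assume x: "c \<le> x"
    then have "x > 0" using c by simp
    then show "((\<lambda>x. - inverse (x ^ d)) has_real_derivative real d * inverse (x ^ Suc d)) (at x)"
      using d by (auto intro!: derivative_eq_intros simp: field_simps power2_eq_square)
        (cases d; simp add: field_simps)
    show "0 \<le> real d * inverse (x ^ Suc d)" using \<open>x > 0\<close> by simp
  next
    have "((\<lambda>x::real. inverse (x ^ d)) \<longlongrightarrow> 0) at_top"
      using d by (intro tendsto_inverse_0_at_top filterlim_pow_at_top filterlim_ident) auto
    then show "((\<lambda>x::real. - inverse (x ^ d)) \<longlongrightarrow> 0) at_top"
      using tendsto_minus by fastforce
  qed auto
  then show ?thesis by simp
qed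

text \<open>Polar coordinates; the unit ball, projected radially, plays the role of the sphere.\<close>
lemma nn_integral_polar:
  fixes k :: "'a::euclidean_space \<Rightarrow> ennreal"
  assumes [measurable]: "k \<in> borel_measurable borel"
  shows "(\<integral>\<^sup>+z. k z \<partial>lborel) =
    (\<integral>\<^sup>+z. indicator (ball 0 1) z *
       (\<integral>\<^sup>+t. ennreal (DIM('a) * t ^ (DIM('a) - 1)) * indicator {0<..} t * k ((t / norm z) *\<^sub>R z) \<partial>lborel) \<partial>lborel)"
    (is "_ = (\<integral>\<^sup>+z. _ * ?I z \<partial>lborel)")
proof -
  let ?d = "DIM('a)" and ?B = "ball (0::'a) 1"
  have [measurable]: "?B \<in> sets borel" by simp
  \<comment> \<open>Substituting \<open>t = norm z * s\<close> straightens the ray: \<open>k\<close>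
    is then evaluated at \<open>s *\<^sub>R z\<close>, without normalising \<open>z\<close>.\<close>
  have sub: "?I z = (\<integral>\<^sup>+s. ennreal (?d * s ^ (?d - 1)) * indicator {0<..} s * (ennreal (norm z ^ ?d) * k (s *\<^sub>R z)) \<partial>lborel)"
    if z: "z \<noteq> 0" for z
  proof -
    have "?I z = ennreal \<bar>norm z\<bar> * (\<integral>\<^sup>+s. ennreal (?d * (0 + norm z * s) ^ (?d - 1)) * indicator {0<..} (0 + norm z * s)
        * k (((0 + norm z * s) / norm z) *\<^sub>R z) \<partial>lborel)"
      using z by (intro nn_integral_real_affine) auto
    also have "\<dots> = (\<integral>\<^sup>+s. ennreal \<bar>norm z\<bar> * (ennreal (?d * (0 + norm z * s) ^ (?d - 1)) * indicator {0<..} (0 + norm z * s)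
        * k (((0 + norm z * s) / norm z) *\<^sub>R z)) \<partial>lborel)"
      by (subst nn_integral_cmult) auto
    also have "\<dots> = (\<integral>\<^sup>+s. ennreal (?d * s ^ (?d - 1)) * indicator {0<..} s * (ennreal (norm z ^ ?d) * k (s *\<^sub>R z)) \<partial>lborel)"
    proof (rule nn_integral_cong)
      fix s :: real
      show "ennreal \<bar>norm z\<bar> * (ennreal (?d * (0 + norm z * s) ^ (?d - 1)) * indicator {0<..} (0 + norm z * s)
        * k (((0 + norm z * s) / norm z) *\<^sub>R z)) = ennreal (?d * s ^ (?d - 1)) * indicator {0<..} s * (ennreal (norm z ^ ?d) * k (s *\<^sub>R z))"
      proof (cases "s > 0")
        case True
        have "ennreal (norm z) * ennreal (?d * (norm z * s) ^ (?d - 1)) = ennreal (norm z * (?d * (norm z * s) ^ (?d - 1)))"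
          using True by (simp add: ennreal_mult)
        also have "norm z * (?d * (norm z * s) ^ (?d - 1)) = (?d * s ^ (?d - 1)) * norm z ^ ?d"
          using DIM_positive[where 'a='a] by (cases ?d) (auto simp: power_mult_distrib)
        also have "ennreal \<dots> = ennreal (?d * s ^ (?d - 1)) * ennreal (norm z ^ ?d)"
          using True by (intro ennreal_mult) auto
        finally show ?thesis using True z by (simp add: mult.assoc[symmetric])
      next
        case False
        then have "\<not> 0 < norm z * s" using z by (simp add: zero_less_mult_iff)
        then show ?thesis using False by simp
      qed
    qed
    finally show ?thesis .
  qed
  have tail: "(\<integral>\<^sup>+s. ennreal (?d * inverse (s ^ Suc ?d)) * indicator {norm w<..} s \<partial>lborel) * ennreal (norm w ^ ?d) = 1"
    if w: "w \<noteq> 0" for w :: 'a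
  proof -
    have "(\<integral>\<^sup>+s. ennreal (?d * inverse (s ^ Suc ?d)) * indicator {norm w<..} s \<partial>lborel)
       = (\<integral>\<^sup>+s. ennreal (?d * inverse (s ^ Suc ?d)) * indicator {norm w..} s \<partial>lborel)"
      using AE_lborel_singleton[of "norm w"]
      by (intro nn_integral_cong_AE) (auto split: split_indicator)
    also have "\<dots> = ennreal (inverse (norm w ^ ?d))"
      using w by (intro nn_integral_inverse_power_tail) auto
    finally show ?thesis using w by (simp flip: ennreal_mult)
  qed
  have "(\<integral>\<^sup>+z. indicator ?B z * ?I z \<partial>lborel) =
     (\<integral>\<^sup>+z. (\<integral>\<^sup>+s. indicator ?B z * (ennreal (?d * s ^ (?d - 1)) * indicator {0<..} s * (ennreal (norm z ^ ?d) * k (s *\<^sub>R z))) \<partial>lborel) \<partial>lborel)"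
    using AE_lborel_singleton[of "0::'a"]
    by (intro nn_integral_cong_AE, elim AE_mp, intro AE_I2 impI, subst sub) (simp_all add: nn_integral_cmult)
  also have "\<dots> = (\<integral>\<^sup>+s. (\<integral>\<^sup>+z. indicator ?B z * (ennreal (?d * s ^ (?d - 1)) * indicator {0<..} s * (ennreal (norm z ^ ?d) * k (s *\<^sub>R z))) \<partial>lborel) \<partial>lborel)"
    by (rule lborel_pair.Fubini') measurable
  \<comment> \<open>For fixed \<open>s\<close> substitute \<open>w = s *\<^sub>R z\<close>. The
    constraint \<open>norm z < 1\<close> turns into \<open>norm w < s\<close>, so that a later
    integration in \<open>s\<close> meets exactly the tail integral of the previous step.\<close>
  also have "\<dots> = (\<integral>\<^sup>+s. (\<integral>\<^sup>+w. ennreal (?d * inverse (s ^ Suc ?d)) * indicator {norm w<..} s * (ennreal (norm w ^ ?d) * k w) \<partial>lborel) \<partial>lborel)"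
  proof (rule nn_integral_cong)
    fix s :: real
    show "(\<integral>\<^sup>+z. indicator ?B z * (ennreal (?d * s ^ (?d - 1)) * indicator {0<..} s * (ennreal (norm z ^ ?d) * k (s *\<^sub>R z))) \<partial>lborel)
       = (\<integral>\<^sup>+w. ennreal (?d * inverse (s ^ Suc ?d)) * indicator {norm w<..} s * (ennreal (norm w ^ ?d) * k w) \<partial>lborel)"
    proof (cases "s > 0")
      case True
      have "(\<integral>\<^sup>+w. ennreal (?d * inverse (s ^ Suc ?d)) * indicator {norm w<..} s * (ennreal (norm w ^ ?d) * k w) \<partial>lborel)
        = ennreal (s ^ ?d) * (\<integral>\<^sup>+w. ennreal (?d * inverse (s ^ Suc ?d)) * indicator {norm (s *\<^sub>R w)<..} s * (ennreal (norm (s *\<^sub>R w) ^ ?d) * k (s *\<^sub>R w)) \<partial>lborel)"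
        using True by (intro nn_integral_lborel_scale) (unfold indicator_def greaterThan_iff, measurable)
      also have "\<dots> = (\<integral>\<^sup>+w. ennreal (s ^ ?d) * (ennreal (?d * inverse (s ^ Suc ?d)) * indicator {norm (s *\<^sub>R w)<..} s * (ennreal (norm (s *\<^sub>R w) ^ ?d) * k (s *\<^sub>R w))) \<partial>lborel)"
        by (rule nn_integral_cmult[symmetric]) (unfold indicator_def greaterThan_iff, measurable)
      also have "\<dots> = (\<integral>\<^sup>+z. indicator ?B z * (ennreal (?d * s ^ (?d - 1)) * indicator {0<..} s * (ennreal (norm z ^ ?d) * k (s *\<^sub>R z))) \<partial>lborel)"
      proof (rule nn_integral_cong)
        fix w :: 'a
        have eq: "ennreal (s ^ ?d) * ennreal (?d * inverse (s ^ Suc ?d)) * ennreal (norm (s *\<^sub>R w) ^ ?d)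
           = ennreal (?d * s ^ (?d - 1)) * ennreal (norm w ^ ?d)"
        proof -
          have "s ^ ?d * (?d * inverse (s ^ Suc ?d)) * norm (s *\<^sub>R w) ^ ?d = (?d * s ^ (?d - 1)) * norm w ^ ?d"
            using True DIM_positive[where 'a='a] by (cases ?d) (auto simp: power_mult_distrib field_simps)
          then show ?thesis using True by (simp flip: ennreal_mult)
        qed
        have "indicator {norm (s *\<^sub>R w)<..} s = (indicator ?B w :: ennreal)"
          using True by (auto simp: indicator_def)
        then show "ennreal (s ^ ?d) * (ennreal (?d * inverse (s ^ Suc ?d)) * indicator {norm (s *\<^sub>R w)<..} s * (ennreal (norm (s *\<^sub>R w) ^ ?d) * k (s *\<^sub>R w)))
          = indicator ?B w * (ennreal (?d * s ^ (?d - 1)) * indicator {0<..} s * (ennreal (norm w ^ ?d) * k (s *\<^sub>R w)))"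
          using arg_cong[OF eq, of "\<lambda>x. x * indicator ?B w * k (s *\<^sub>R w)"] True by (simp add: mult_ac)
      qed
      finally show ?thesis by simp
    next
      case False
      then have "s \<notin> {norm w<..}" for w :: 'a using norm_ge_zero[of w] by (auto simp del: norm_ge_zero)
      then show ?thesis using False by simp
    qed
  qed
  also have "\<dots> = (\<integral>\<^sup>+w. (\<integral>\<^sup>+s. ennreal (?d * inverse (s ^ Suc ?d)) * indicator {norm w<..} s * (ennreal (norm w ^ ?d) * k w) \<partial>lborel) \<partial>lborel)"
    by (rule lborel_pair.Fubini') (unfold indicator_def greaterThan_iff, measurable)
  also have "\<dots> = (\<integral>\<^sup>+w. k w \<partial>lborel)"
  proof (rule nn_integral_cong_AE, rule AE_mp[OF AE_lborel_singleton[of "0::'a"]], intro AE_I2 impI)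
    fix w :: 'a assume "w \<noteq> 0"
    have "(\<integral>\<^sup>+s. ennreal (?d * inverse (s ^ Suc ?d)) * indicator {norm w<..} s * (ennreal (norm w ^ ?d) * k w) \<partial>lborel)
      = (\<integral>\<^sup>+s. ennreal (?d * inverse (s ^ Suc ?d)) * indicator {norm w<..} s \<partial>lborel) * ennreal (norm w ^ ?d) * k w"
      by (subst nn_integral_multc) (auto simp: mult.assoc)
    then show "(\<integral>\<^sup>+s. ennreal (?d * inverse (s ^ Suc ?d)) * indicator {norm w<..} s * (ennreal (norm w ^ ?d) * k w) \<partial>lborel) = k w"
      by (simp only: tail[OF \<open>w \<noteq> 0\<close>] mult_1)
  qed
  finally show ?thesis by simp
qed

section \<open>Geometry of the ball\<close>

lemma herm_add_left: "herm (x + y) z = herm x z + herm y z"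
  by (simp add: herm_def sum.distrib algebra_simps)
lemma herm_diff_left: "herm (x - y) z = herm x z - herm y z"
  by (simp add: herm_def sum_subtractf algebra_simps)
lemma herm_scale_left: "herm (c *s x) z = c * herm x z"
  by (simp add: herm_def sum_distrib_left algebra_simps)
lemma herm_cnj: "cnj (herm x y) = herm y x"
  by (simp add: herm_def algebra_simps)
lemma herm_diff_right: "herm z (x - y) = herm z x - herm z y"
  by (simp add: herm_def sum_subtractf algebra_simps)
lemma herm_scale_right: "herm z (c *s x) = cnj c * herm z x"
  by (simp add: herm_def sum_distrib_left algebra_simps)
lemma herm_zero [simp]: "herm 0 z = 0" "herm z 0 = 0"
  by (simp_all add: herm_def)

lemma inner_eq_Re_herm: "x \<bullet> y = Re (herm x y)"
  by (simp add: herm_def inner_vec_def inner_complex_def)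

lemma herm_self: "herm x x = of_real ((norm x)\<^sup>2)"
proof (rule complex_eqI)
  show "Re (herm x x) = Re (of_real ((norm x)\<^sup>2))"
    by (simp add: inner_eq_Re_herm[symmetric] power2_norm_eq_inner)
  show "Im (herm x x) = Im (of_real ((norm x)\<^sup>2))"
    by (simp add: herm_def mult.commute)
qed

lemma norm_vec_scale: "norm (c *s x) = norm c * norm (x :: complex ^ 'n)"
proof (rule power2_eq_imp_eq)
  have "complex_of_real ((norm (c *s x))\<^sup>2) = of_real ((norm c * norm x)\<^sup>2)"
    by (simp only: herm_self[symmetric] herm_scale_left herm_scale_right)
      (simp add: herm_self complex_norm_square power_mult_distrib del: of_real_power)
  then show "(norm (c *s x))\<^sup>2 = (norm c * norm x)\<^sup>2" by (simp only: of_real_eq_iff)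
qed auto

text \<open>A unimodular factor turns \<open>herm x y\<close> into its modulus, which reduces the
  claim to the Cauchy-Schwarz inequality of the real inner product.\<close>

lemma norm_herm_le: "norm (herm x y) \<le> norm x * norm y"
proof (cases "herm x y = 0")
  case False
  define c where "c = cnj (herm x y) / of_real (norm (herm x y))"
  have c: "norm c = 1" using False by (simp add: c_def norm_divide)
  have "c * herm x y = of_real (norm (herm x y))"
    using False by (simp add: c_def complex_norm_square[symmetric] field_simps power2_eq_square)
  then have "norm (herm x y) = (c *s x) \<bullet> y"
    by (simp add: inner_eq_Re_herm herm_scale_left)
  also have "\<dots> \<le> norm (c *s x) * norm y" by (rule norm_cauchy_schwarz)
  finally show ?thesis by (simp add: norm_vec_scale c)
qed auto

lemma norm_add_sq: "(norm (x + y))\<^sup>2 = (norm x)\<^sup>2 + 2 * Re (herm x y) + (norm (y::complex^'n))\<^sup>2"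
  unfolding inner_eq_Re_herm[symmetric] by (simp add: power2_norm_eq_inner inner_commute algebra_simps)

lemma norm_one_minus_herm_ge:
  assumes "norm x < 1" "norm y < 1"
  shows "norm (1 - herm x y) \<ge> 1 - norm y" "norm (1 - herm x y) \<ge> 1 - norm x" "herm x y \<noteq> 1"
    "norm (1 - herm x y) > 0" "norm (1 - herm x y) \<le> 2"
proof -
  have *: "norm (1 - herm x y) \<ge> 1 - norm (herm x y)"
    using norm_triangle_ineq2[of 1 "herm x y"] by simp
  have "norm x * norm y \<le> norm y" "norm x * norm y \<le> norm x"
    using assms by (simp_all add: mult_left_le_one_le mult_right_le_one_le)
  then show A: "norm (1 - herm x y) \<ge> 1 - norm y" "norm (1 - herm x y) \<ge> 1 - norm x"
    using * norm_herm_le[of x y] by linarith+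
  then show "norm (1 - herm x y) > 0" using assms by linarith
  then show "herm x y \<noteq> 1" by auto
  have "norm (1 - herm x y) \<le> 1 + norm (herm x y)" using norm_triangle_ineq4[of 1 "herm x y"] by simp
  then show "norm (1 - herm x y) \<le> 2"
    using norm_herm_le[of x y] \<open>norm x * norm y \<le> norm x\<close> assms by linarith
qed

section \<open>Ball automorphisms and the pseudohyperbolic distance\<close>

lemma autom_alt:
  fixes a z :: "complex ^ 'n"
  assumes "a \<noteq> 0"
  defines "s \<equiv> complex_of_real (sqrt (1 - (norm a)\<^sup>2))"
  shows "autom a z = (1 / (1 - herm z a)) *s ((1 - (1 - s) * herm z a / herm a a) *s a - s *s z)"
  using assms by (simp add: autom_def projP_def projQ_def vec_eq_iff algebra_simps diff_divide_distrib)

lemma autom_0_left: "autom 0 z = - z"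
  by (simp add: autom_def projP_def projQ_def vec_eq_iff)

lemma autom_0_right: "autom a 0 = a"
  by (simp add: autom_def projP_def projQ_def vec_eq_iff)

text \<open>The polarised identity behind the whole geometry: \<open>w = z\<close> gives the formula
  for the pseudohyperbolic distance, \<open>w = 0\<close> rewrites the test functions, and general
  pairs give invariance under automorphisms.\<close>

lemma one_minus_herm_autom:
  fixes a z w :: "complex ^ 'n"
  assumes "norm a < 1" "norm z < 1" "norm w < 1"
  shows "1 - herm (autom a z) (autom a w)
    = (1 - of_real ((norm a)\<^sup>2)) * (1 - herm z w) / ((1 - herm z a) * (1 - herm a w))"
proof (cases "a = 0")
  case True
  then show ?thesis
    by (simp add: autom_0_left herm_def sum_negf)
next
  case False
  define s where "s = complex_of_real (sqrt (1 - (norm a)\<^sup>2))"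
  define A where "A = complex_of_real ((norm a)\<^sup>2)"
  define \<alpha> \<beta> where "\<alpha> = herm z a" and "\<beta> = herm a w"
  have A: "herm a a = A" "A \<noteq> 0" using False by (simp_all add: A_def herm_self)
  have cs: "cnj s = s" "cnj A = A" by (simp_all add: s_def A_def)
  have "(norm a)\<^sup>2 \<le> 1" using assms by (simp add: power_le_one)
  then have s2: "s\<^sup>2 = 1 - A" unfolding s_def A_def of_real_power[symmetric] by (simp add: of_real_power[symmetric] del: of_real_power)
  have nz: "1 - \<alpha> \<noteq> 0" "1 - \<beta> \<noteq> 0"
    using norm_one_minus_herm_ge(3) assms by (auto simp: \<alpha>_def \<beta>_def)
  have cw: "herm w a = cnj \<beta>" by (simp add: \<beta>_def herm_cnj)
  define ka kb where "ka = 1 - (1 - s) * \<alpha> / A" and "kb = 1 - (1 - s) * \<beta> / A"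
  have kb: "cnj (1 - (1 - s) * cnj \<beta> / A) = kb" by (simp add: kb_def cs)
  have az: "autom a z = (1 / (1 - \<alpha>)) *s (ka *s a - s *s z)"
    unfolding autom_alt[OF False] s_def[symmetric] A \<alpha>_def[symmetric] ka_def ..
  have aw: "autom a w = (1 / (1 - cnj \<beta>)) *s (cnj kb *s a - s *s w)"
    unfolding autom_alt[OF False] s_def[symmetric] A cw kb[symmetric] complex_cnj_cnj ..
  have "herm (ka *s a - s *s z) (cnj kb *s a - s *s w)
    = kb * (ka * A) - s * (ka * \<beta>) - (kb * (s * \<alpha>) - s * (s * herm z w))"
    by (simp add: herm_scale_left herm_scale_right herm_diff_left herm_diff_right cs A
        \<alpha>_def[symmetric] \<beta>_def[symmetric]) (simp add: algebra_simps)
  then have "herm (autom a z) (autom a w) = (1 / (1 - \<alpha>)) * ((1 / (1 - \<beta>)) *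
     (kb * (ka * A) - s * (ka * \<beta>) - (kb * (s * \<alpha>) - s * (s * herm z w))))"
    unfolding az aw herm_scale_left herm_scale_right by simp
  also have "kb * (ka * A) - s * (ka * \<beta>) - (kb * (s * \<alpha>) - s * (s * herm z w))
     = A - \<alpha> - \<beta> + \<alpha> * \<beta> + (1 - A) * herm z w"
  proof -
    \<comment> \<open>All terms linear in \<open>s\<close> cancel, so only
      \<open>s\<^sup>2 = 1 - A\<close> remains and the square root disappears.\<close>
    have "kb * (ka * A) - s * (ka * \<beta>) - (kb * (s * \<alpha>) - s * (s * herm z w))
       = A - \<alpha> - \<beta> + (1 - s\<^sup>2) * (\<alpha> * \<beta>) / A + s\<^sup>2 * herm z w"
      using A(2) unfolding ka_def kb_def by (simp add: field_simps power2_eq_square)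
    then show ?thesis using A(2) s2 by simp
  qed
  finally have *: "herm (autom a z) (autom a w) = (A - \<alpha> - \<beta> + \<alpha> * \<beta> + (1 - A) * herm z w) / ((1 - \<alpha>) * (1 - \<beta>))"
    by simp
  show ?thesis
    unfolding * \<alpha>_def[symmetric] \<beta>_def[symmetric] A_def[symmetric] using nz
    by (simp add: divide_simps) (simp add: algebra_simps)
qed

lemma one_minus_pseudo_hyp_sq:
  assumes "norm a < 1" "norm z < 1"
  shows "1 - (pseudo_hyp a z)\<^sup>2 = (1 - (norm a)\<^sup>2) * (1 - (norm z)\<^sup>2) / (norm (1 - herm z a))\<^sup>2"
proof -
  have *: "(1 - herm z a) * (1 - herm a z) = of_real ((norm (1 - herm z a))\<^sup>2)"
    by (simp only: complex_norm_square) (simp add: herm_cnj)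
  have "complex_of_real (1 - (pseudo_hyp a z)\<^sup>2) = 1 - herm (autom a z) (autom a z)"
    by (simp add: pseudo_hyp_def herm_self)
  also have "\<dots> = of_real ((1 - (norm a)\<^sup>2) * (1 - (norm z)\<^sup>2) / (norm (1 - herm z a))\<^sup>2)"
    by (subst one_minus_herm_autom) (use assms in \<open>simp_all add: * herm_self\<close>)
  finally show ?thesis by (simp only: of_real_eq_iff)
qed

lemma norm_one_minus_herm_commute: "norm (1 - herm z a) = norm (1 - herm a z)"
  using complex_mod_cnj[of "1 - herm z a"] by (simp add: herm_cnj)

lemma pseudo_hyp_nonneg [simp]: "pseudo_hyp a z \<ge> 0"
  by (simp add: pseudo_hyp_def)

lemma pseudo_hyp_commute:
  assumes "norm a < 1" "norm z < 1"
  shows "pseudo_hyp a z = pseudo_hyp z a"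
proof (rule power2_eq_imp_eq)
  have "1 - (pseudo_hyp a z)\<^sup>2 = 1 - (pseudo_hyp z a)\<^sup>2"
    unfolding one_minus_pseudo_hyp_sq[OF assms] one_minus_pseudo_hyp_sq[OF assms(2,1)]
    by (simp only: norm_one_minus_herm_commute[of z a] mult.commute)
  then show "(pseudo_hyp a z)\<^sup>2 = (pseudo_hyp z a)\<^sup>2" by linarith
qed auto

lemma pseudo_hyp_less_1:
  assumes "norm a < 1" "norm z < 1"
  shows "pseudo_hyp a z < 1"
proof -
  have "1 - (pseudo_hyp a z)\<^sup>2 > 0"
    unfolding one_minus_pseudo_hyp_sq[OF assms]
    using assms norm_one_minus_herm_ge(4)[OF assms(2,1)]
    by (intro divide_pos_pos mult_pos_pos) (auto simp: power_less_one_iff abs_square_less_1)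
  then show ?thesis by (simp add: abs_square_less_1)
qed

lemma norm_autom_less_1: "norm a < 1 \<Longrightarrow> norm z < 1 \<Longrightarrow> norm (autom a z) < 1"
  using pseudo_hyp_less_1 by (simp add: pseudo_hyp_def)

text \<open>Invariance is read off the formula for \<open>1 - pseudo_hyp^2\<close>, in which every
  factor involving \<open>a\<close> cancels; the composition of two automorphisms does not have to
  be computed.\<close>

lemma pseudo_hyp_autom:
  assumes "norm a < 1" "norm z < 1" "norm w < 1"
  shows "pseudo_hyp (autom a z) (autom a w) = pseudo_hyp z w"
proof (rule power2_eq_imp_eq)
  note aw = norm_autom_less_1[OF assms(1,2)] norm_autom_less_1[OF assms(1,3)]
  let ?A = "1 - (norm a)\<^sup>2"
  have A: "?A > 0" using assms by (simp add: power_less_one_iff abs_square_less_1)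
  have 1: "1 - (norm (autom a x))\<^sup>2 = ?A * (1 - (norm x)\<^sup>2) / (norm (1 - herm x a))\<^sup>2" if "norm x < 1" for x
    using one_minus_pseudo_hyp_sq[OF assms(1) that] by (simp add: pseudo_hyp_def)
  have "norm (1 - herm (autom a w) (autom a z))
     = ?A * norm (1 - herm w z) / (norm (1 - herm w a) * norm (1 - herm z a))"
  proof -
    have "norm (1 - complex_of_real ((norm a)\<^sup>2)) = norm (complex_of_real ?A)" by simp
    also have "\<dots> = ?A" unfolding norm_of_real using A by (rule abs_of_pos)
    finally show ?thesis
      unfolding one_minus_herm_autom[OF assms(1,3,2)] norm_divide norm_mult
      by (simp only: norm_one_minus_herm_commute[of z a])
  qed
  note n = this
  have alg: "(A * X / b\<^sup>2) * (A * Y / c\<^sup>2) / (A * m / (c * b))\<^sup>2 = X * Y / m\<^sup>2"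
    if "A > 0" "b > 0" "c > 0" for A X Y b c m :: real
    using that by (cases "m = 0") (simp_all add: field_simps power2_eq_square)
  have "1 - (pseudo_hyp (autom a z) (autom a w))\<^sup>2 = 1 - (pseudo_hyp z w)\<^sup>2"
    unfolding one_minus_pseudo_hyp_sq[OF aw] one_minus_pseudo_hyp_sq[OF assms(2,3)] 1[OF assms(2)] 1[OF assms(3)] n
    using A norm_one_minus_herm_ge(4)[OF assms(2,1)] norm_one_minus_herm_ge(4)[OF assms(3,1)]
    by (rule alg)
  then show "(pseudo_hyp (autom a z) (autom a w))\<^sup>2 = (pseudo_hyp z w)\<^sup>2" by linarith
qed auto

lemma one_minus_herm_autom_center:
  assumes "norm a < 1" "norm z < 1"
  shows "1 - herm (autom a z) a = (1 - of_real ((norm a)\<^sup>2)) / (1 - herm z a)"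
  using one_minus_herm_autom[OF assms, of 0] by (simp add: autom_0_right)

text \<open>The subtracted bracket is the Cauchy-Schwarz defect of \<open>x\<close> and
  \<open>y\<close>. Since it is nonnegative, dropping it bounds the distance from above; estimating
  it by \<open>(norm x)^2 * (norm (x - y))^2\<close> bounds the distance from below.\<close>

lemma pseudo_hyp_sq:
  assumes "norm x < 1" "norm y < 1"
  shows "(pseudo_hyp x y)\<^sup>2 * (norm (1 - herm y x))\<^sup>2
     = (norm (x - y))\<^sup>2 - ((norm x)\<^sup>2 * (norm y)\<^sup>2 - (norm (herm y x))\<^sup>2)"
proof -
  have pos: "(norm (1 - herm y x))\<^sup>2 > 0" using norm_one_minus_herm_ge(4)[OF assms(2,1)] by simp
  have "(1 - (pseudo_hyp x y)\<^sup>2) * (norm (1 - herm y x))\<^sup>2 = (1 - (norm x)\<^sup>2) * (1 - (norm y)\<^sup>2)"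
    unfolding one_minus_pseudo_hyp_sq[OF assms] using pos by simp
  then have "(pseudo_hyp x y)\<^sup>2 * (norm (1 - herm y x))\<^sup>2
     = (norm (1 - herm y x))\<^sup>2 - (1 - (norm x)\<^sup>2) * (1 - (norm y)\<^sup>2)"
    by (simp add: left_diff_distrib)
  also have "(norm (1 - herm y x))\<^sup>2 - (1 - (norm x)\<^sup>2) * (1 - (norm y)\<^sup>2)
      = 1 - 2 * Re (herm y x) + (norm (herm y x))\<^sup>2 - (1 - (norm x)\<^sup>2) * (1 - (norm y)\<^sup>2)"
    by (simp add: cmod_power2 power2_diff)
  also have "1 - 2 * Re (herm y x) + (norm (herm y x))\<^sup>2 - (1 - (norm x)\<^sup>2) * (1 - (norm y)\<^sup>2)
      = ((norm x)\<^sup>2 - 2 * Re (herm y x) + (norm y)\<^sup>2) - ((norm x)\<^sup>2 * (norm y)\<^sup>2 - (norm (herm y x))\<^sup>2)"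
    by (simp add: algebra_simps)
  also have "(norm x)\<^sup>2 - 2 * Re (herm y x) + (norm y)\<^sup>2 = (norm (x - y))\<^sup>2"
    unfolding inner_eq_Re_herm[symmetric] by (simp add: power2_norm_eq_inner inner_commute algebra_simps)
  finally show ?thesis .
qed

text \<open>This and the converse bound are applied to images under \<open>autom a\<close> with the
  first point in a fixed ball of radius \<open>s < 1\<close>, where the factor
  \<open>1 - norm x\<close> is harmless.\<close>

lemma pseudo_hyp_le:
  assumes "norm x < 1" "norm y < 1"
  shows "(1 - norm x) * pseudo_hyp x y \<le> norm (x - y)"
proof (rule power2_le_imp_le)
  have "(norm (herm y x))\<^sup>2 \<le> (norm y * norm x)\<^sup>2" by (intro power_mono norm_herm_le) auto
  then have "(pseudo_hyp x y)\<^sup>2 * (norm (1 - herm y x))\<^sup>2 \<le> (norm (x - y))\<^sup>2"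
    unfolding pseudo_hyp_sq[OF assms] by (simp add: power_mult_distrib mult.commute)
  moreover have "(1 - norm x)\<^sup>2 \<le> (norm (1 - herm y x))\<^sup>2"
    using assms norm_one_minus_herm_ge(1)[OF assms(2,1)] by (intro power_mono) auto
  then have "(pseudo_hyp x y)\<^sup>2 * (1 - norm x)\<^sup>2 \<le> (pseudo_hyp x y)\<^sup>2 * (norm (1 - herm y x))\<^sup>2"
    by (intro mult_left_mono) auto
  ultimately show "((1 - norm x) * pseudo_hyp x y)\<^sup>2 \<le> (norm (x - y))\<^sup>2"
    by (simp add: power_mult_distrib mult.commute)
qed auto

lemma pseudo_hyp_ge:
  assumes "norm x < 1" "norm y < 1"
  shows "(1 - norm x) * norm (x - y) \<le> 2 * pseudo_hyp x y"
proof (rule power2_le_imp_le)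
  define h where "h = y - x"
  have y: "y = x + h" by (simp add: h_def)
  have "herm y x = of_real ((norm x)\<^sup>2) + herm h x" by (simp add: y herm_add_left herm_self)
  then have "(norm (herm y x))\<^sup>2 = ((norm x)\<^sup>2)\<^sup>2 + 2 * (norm x)\<^sup>2 * Re (herm h x) + (norm (herm h x))\<^sup>2"
    by (simp add: cmod_power2 power2_sum)
  moreover have "Re (herm x h) = Re (herm h x)" using arg_cong[OF herm_cnj[of x h], of Re] by simp
  then have "(norm y)\<^sup>2 = (norm x)\<^sup>2 + 2 * Re (herm h x) + (norm h)\<^sup>2"
    by (simp add: y norm_add_sq)
  \<comment> \<open>The Cauchy-Schwarz defect of \<open>x\<close> and \<open>y\<close> equals that
    of \<open>x\<close> and \<open>h\<close>, because \<open>y\<close> and \<open>h\<close> differ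
    by a multiple of \<open>x\<close>.\<close>
  ultimately have "(norm x)\<^sup>2 * (norm y)\<^sup>2 - (norm (herm y x))\<^sup>2 = (norm x)\<^sup>2 * (norm h)\<^sup>2 - (norm (herm h x))\<^sup>2"
    by (simp add: power2_eq_square algebra_simps)
  also have "\<dots> \<le> (norm x)\<^sup>2 * (norm h)\<^sup>2" by simp
  finally have "(1 - (norm x)\<^sup>2) * (norm (x - y))\<^sup>2 \<le> (pseudo_hyp x y)\<^sup>2 * (norm (1 - herm y x))\<^sup>2"
    unfolding pseudo_hyp_sq[OF assms] by (simp add: h_def norm_minus_commute algebra_simps)
  also have "\<dots> \<le> (pseudo_hyp x y)\<^sup>2 * 2\<^sup>2"
    using norm_one_minus_herm_ge(5)[OF assms(2,1)] by (intro mult_left_mono power_mono) auto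
  finally have "(1 - (norm x)\<^sup>2) * (norm (x - y))\<^sup>2 \<le> (2 * pseudo_hyp x y)\<^sup>2" by (simp add: power_mult_distrib)
  moreover have "(1 - norm x)\<^sup>2 \<le> 1 - (norm x)\<^sup>2"
  proof -
    have "(norm x)\<^sup>2 \<le> norm x" using assms by (simp add: power2_eq_square mult_left_le_one_le)
    then show ?thesis by (simp add: power2_diff)
  qed
  then have "(1 - norm x)\<^sup>2 * (norm (x - y))\<^sup>2 \<le> (1 - (norm x)\<^sup>2) * (norm (x - y))\<^sup>2"
    by (intro mult_right_mono) auto
  ultimately show "((1 - norm x) * norm (x - y))\<^sup>2 \<le> (2 * pseudo_hyp x y)\<^sup>2"
    by (simp add: power_mult_distrib)
qed auto

text \<open>Insert \<open>norm (1 - herm z a) \<ge> 1 - norm a\<close> into the formula for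
  \<open>1 - pseudo_hyp^2\<close> and cancel one factor \<open>1 - norm a\<close>. The 4 comes from
  bounding \<open>1 - (norm x)^2\<close> by \<open>2 * (1 - norm x)\<close> twice.\<close>

lemma pseudo_hyp_ball_comparable:
  assumes "norm a < 1" "norm z < 1" "pseudo_hyp a z < s" "s < 1"
  shows "1 - norm a \<le> 4 / (1 - s\<^sup>2) * (1 - norm z)"
proof -
  have "0 < s" using assms(3) pseudo_hyp_nonneg[of a z] by linarith
  then have s: "0 < 1 - s\<^sup>2" using assms(4) by (simp add: abs_square_less_1)
  have "(pseudo_hyp a z)\<^sup>2 \<le> s\<^sup>2" using assms by (intro power_mono) auto
  then have "1 - s\<^sup>2 \<le> (1 - (norm a)\<^sup>2) * (1 - (norm z)\<^sup>2) / (norm (1 - herm z a))\<^sup>2"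
    using one_minus_pseudo_hyp_sq[OF assms(1,2)] by linarith
  then have "(1 - s\<^sup>2) * (norm (1 - herm z a))\<^sup>2 \<le> (1 - (norm a)\<^sup>2) * (1 - (norm z)\<^sup>2)"
    using norm_one_minus_herm_ge(4)[OF assms(2,1)] by (simp add: pos_le_divide_eq)
  moreover have "(1 - norm a)\<^sup>2 \<le> (norm (1 - herm z a))\<^sup>2"
    using assms norm_one_minus_herm_ge(1)[OF assms(2,1)] by (intro power_mono) auto
  then have "(1 - s\<^sup>2) * (1 - norm a)\<^sup>2 \<le> (1 - s\<^sup>2) * (norm (1 - herm z a))\<^sup>2"
    using s by (intro mult_left_mono) auto
  moreover have "1 - (norm x)\<^sup>2 \<le> 2 * (1 - norm x)" "0 \<le> 1 - (norm x)\<^sup>2" if "norm x < 1" for x :: "complex^'n"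
  proof -
    have "0 \<le> (1 - norm x)\<^sup>2" by simp
    then show "1 - (norm x)\<^sup>2 \<le> 2 * (1 - norm x)" by (simp add: power2_diff)
    show "0 \<le> 1 - (norm x)\<^sup>2" using that by (simp add: power_le_one)
  qed
  then have "(1 - (norm a)\<^sup>2) * (1 - (norm z)\<^sup>2) \<le> (2 * (1 - norm a)) * (2 * (1 - norm z))"
    using assms by (intro mult_mono) auto
  ultimately have "(1 - s\<^sup>2) * (1 - norm a)\<^sup>2 \<le> (2 * (1 - norm a)) * (2 * (1 - norm z))" by linarith
  then have "(1 - norm a) * ((1 - s\<^sup>2) * (1 - norm a)) \<le> (1 - norm a) * (4 * (1 - norm z))"
    by (simp add: power2_eq_square algebra_simps)
  then have "(1 - s\<^sup>2) * (1 - norm a) \<le> 4 * (1 - norm z)" using assms by (simp add: mult_le_cancel_left_pos)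
  then show ?thesis using s by (simp add: field_simps)
qed

text \<open>A crude substitute for the triangle inequality. Moving \<open>a\<close> to 0 makes
  \<open>pseudo_hyp a y\<close> a Euclidean norm, and the formula for
  \<open>1 - pseudo_hyp^2\<close> bounds it away from 1 by an amount that depends on
  \<open>r\<close> and \<open>s\<close> only.\<close>

lemma pseudo_hyp_enlarge:
  fixes a x y :: "complex ^ 'n"
  assumes "norm a < 1" "norm x < 1" "norm y < 1" "pseudo_hyp a x < s" "pseudo_hyp x y < r" "s < 1" "r < 1"
  shows "pseudo_hyp a y < sqrt (1 - (1 - r\<^sup>2) * (1 - s)\<^sup>2)"
proof -
  let ?x = "autom a x" and ?y = "autom a y"
  have n: "norm ?x < s" "norm ?x < 1" "norm ?y < 1"
    using assms norm_autom_less_1 by (auto simp: pseudo_hyp_def)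
  have "pseudo_hyp ?x ?y < r" using assms by (simp add: pseudo_hyp_autom)
  then have "(pseudo_hyp ?x ?y)\<^sup>2 < r\<^sup>2" by (intro power_strict_mono) auto
  then have "1 - r\<^sup>2 < (1 - (norm ?x)\<^sup>2) * (1 - (norm ?y)\<^sup>2) / (norm (1 - herm ?y ?x))\<^sup>2"
    using one_minus_pseudo_hyp_sq[OF n(2,3)] by linarith
  then have "(1 - r\<^sup>2) * (norm (1 - herm ?y ?x))\<^sup>2 < (1 - (norm ?x)\<^sup>2) * (1 - (norm ?y)\<^sup>2)"
    using norm_one_minus_herm_ge(4)[OF n(3,2)] by (simp add: pos_less_divide_eq)
  also have "\<dots> \<le> 1 * (1 - (norm ?y)\<^sup>2)"
    using n by (intro mult_right_mono) (auto simp: power_le_one)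
  finally have "(1 - r\<^sup>2) * (norm (1 - herm ?y ?x))\<^sup>2 < 1 - (norm ?y)\<^sup>2" by simp
  moreover have "(1 - s)\<^sup>2 \<le> (norm (1 - herm ?y ?x))\<^sup>2"
    using n assms norm_one_minus_herm_ge(1)[OF n(3,2)] by (intro power_mono) auto
  moreover have "0 < r" using assms(5) pseudo_hyp_nonneg[of x y] by linarith
  then have "0 \<le> 1 - r\<^sup>2" using assms(7) by (simp add: power_le_one)
  ultimately have "(norm ?y)\<^sup>2 < 1 - (1 - r\<^sup>2) * (1 - s)\<^sup>2"
    using mult_left_mono[of "(1 - s)\<^sup>2" "(norm (1 - herm ?y ?x))\<^sup>2" "1 - r\<^sup>2"] by linarith
  then show ?thesis
    unfolding pseudo_hyp_def by (rule real_less_rsqrt)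
qed

text \<open>The neighbourhood is nonisotropic: of size \<open>1 - norm z\<close> along
  \<open>z\<close> and of the size of its square root across. With \<open>x = 1 - (norm z)^2\<close>
  the constants give \<open>1 - (norm (z + h))^2 \<ge> 47/64 * x\<close> and
  \<open>norm (1 - herm (z + h) z) \<le> 9/8 * x\<close>. Their quotient \<open>47/81\<close>
  exceeds \<open>1 - (3/4)^2 = 7/16\<close>, which is the origin of the radius 3/4 used in all later
  averages.\<close>

lemma pseudo_hyp_small_polydisc:
  fixes z h :: "complex ^ 'n"
  assumes z: "norm z < 1" and h1: "norm (herm h z) < (1 - norm z) / 8" and h2: "(norm h)\<^sup>2 < (1 - norm z) / 64"
  shows "norm (z + h) < 1" "pseudo_hyp z (z + h) < 3/4"
proof -
  define x where "x = 1 - (norm z)\<^sup>2"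
  have "(norm z)\<^sup>2 \<le> norm z" using z by (simp add: power2_eq_square mult_left_le_one_le)
  then have xd: "1 - norm z \<le> x" by (simp add: x_def)
  then have x: "x > 0" using z by linarith
  have h1': "norm (herm h z) \<le> x / 8" using less_le_trans[OF h1, of "x / 8"] xd by simp
  have h2': "(norm h)\<^sup>2 \<le> x / 64" using less_le_trans[OF h2, of "x / 64"] xd by simp
  have "Re (herm z h) = Re (herm h z)" using arg_cong[OF herm_cnj[of z h], of Re] by simp
  then have re: "Re (herm z h) \<le> x / 8" using h1' complex_Re_le_cmod[of "herm h z"] by linarith
  have B: "1 - (norm (z + h))\<^sup>2 \<ge> 47/64 * x"
    using re h2' unfolding norm_add_sq by (simp add: x_def)
  then have "(norm (z + h))\<^sup>2 < 1" using x by linarith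
  then show n: "norm (z + h) < 1" by (simp add: abs_square_less_1)
  have "1 - herm (z + h) z = of_real x - herm h z" by (simp add: herm_add_left herm_self x_def)
  then have "norm (1 - herm (z + h) z) \<le> x + x / 8"
    using norm_triangle_ineq4[of "of_real x" "herm h z"] h1' x by simp
  then have "(norm (1 - herm (z + h) z))\<^sup>2 \<le> (9/8 * x)\<^sup>2" by (intro power_mono) auto
  moreover have "(norm (1 - herm (z + h) z))\<^sup>2 > 0" using norm_one_minus_herm_ge(4)[OF n z] by simp
  moreover have "1 - (pseudo_hyp z (z + h))\<^sup>2 = x * (1 - (norm (z + h))\<^sup>2) / (norm (1 - herm (z + h) z))\<^sup>2"
    using one_minus_pseudo_hyp_sq[OF z n] by (simp add: x_def)
  ultimately have "1 - (pseudo_hyp z (z + h))\<^sup>2 \<ge> x * (47/64 * x) / (9/8 * x)\<^sup>2"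
    using x B by (simp only:) (intro frac_le mult_left_mono mult_nonneg_nonneg; simp)
  also have "x * (47/64 * x) / (9/8 * x)\<^sup>2 = 47/81" using x by (simp add: power2_eq_square field_simps)
  finally have "(pseudo_hyp z (z + h))\<^sup>2 < (3/4)\<^sup>2" by (simp add: power2_eq_square)
  then show "pseudo_hyp z (z + h) < 3/4" by (rule power2_less_imp_less) simp
qed

section \<open>Holomorphic functions of several variables\<close>

lemma holo_on_const: "holo_on (\<lambda>_. c) S"
  unfolding holo_on_def by (auto intro!: exI[of _ "\<lambda>_. 0"])

lemma holo_on_component: "holo_on (\<lambda>z. z $ j) S"
  unfolding holo_on_def
  by (auto intro!: exI[of _ "\<lambda>z. z $ j"] bounded_linear_imp_has_derivative bounded_linear_vec_nth)

lemma holo_on_add: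
  assumes "holo_on f S" "holo_on g S" shows "holo_on (\<lambda>z. f z + g z) S"
  unfolding holo_on_def
proof
  fix z assume "z \<in> S"
  then obtain L M where "(f has_derivative L) (at z)" "\<And>c w. L (c *s w) = c * L w"
      "(g has_derivative M) (at z)" "\<And>c w. M (c *s w) = c * M w"
    using assms unfolding holo_on_def by meson
  then show "\<exists>L. ((\<lambda>z. f z + g z) has_derivative L) (at z) \<and> (\<forall>c w. L (c *s w) = c * L w)"
    by (intro exI[of _ "\<lambda>w. L w + M w"]) (auto intro!: has_derivative_add simp: algebra_simps)
qed

lemma holo_on_mult:
  assumes "holo_on f S" "holo_on g S" shows "holo_on (\<lambda>z. f z * g z) S"
  unfolding holo_on_def
proof
  fix z assume "z \<in> S"
  then obtain L M where "(f has_derivative L) (at z)" "\<And>c w. L (c *s w) = c * L w"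
      "(g has_derivative M) (at z)" "\<And>c w. M (c *s w) = c * M w"
    using assms unfolding holo_on_def by meson
  then show "\<exists>L. ((\<lambda>z. f z * g z) has_derivative L) (at z) \<and> (\<forall>c w. L (c *s w) = c * L w)"
    by (intro exI[of _ "\<lambda>w. f z * M w + L w * g z"] conjI has_derivative_mult) (auto simp: algebra_simps)
qed

lemma holo_on_inverse:
  assumes "holo_on f S" "\<And>z. z \<in> S \<Longrightarrow> f z \<noteq> 0" shows "holo_on (\<lambda>z. inverse (f z)) S"
  unfolding holo_on_def
proof
  fix z assume "z \<in> S"
  then obtain L where "(f has_derivative L) (at z)" "\<And>c w. L (c *s w) = c * L w"
    using assms unfolding holo_on_def by meson
  then show "\<exists>L. ((\<lambda>z. inverse (f z)) has_derivative L) (at z) \<and> (\<forall>c w. L (c *s w) = c * L w)"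
    using assms(2)[OF \<open>z \<in> S\<close>]
    by (intro exI[of _ "\<lambda>h. - (inverse (f z) * L h * inverse (f z))"] conjI Deriv.has_derivative_inverse)
      (auto simp: algebra_simps)
qed

lemma holo_on_diff:
  assumes "holo_on f S" "holo_on g S" shows "holo_on (\<lambda>z. f z - g z) S"
  using holo_on_add[OF assms(1) holo_on_mult[OF holo_on_const[of "-1"] assms(2)]] by simp

lemma holo_on_divide:
  assumes "holo_on f S" "holo_on g S" "\<And>z. z \<in> S \<Longrightarrow> g z \<noteq> 0" shows "holo_on (\<lambda>z. f z / g z) S"
  unfolding divide_inverse by (intro holo_on_mult holo_on_inverse assms)

lemma holo_on_power:
  assumes "holo_on f S" shows "holo_on (\<lambda>z. f z ^ n) S"
  by (induction n) (auto intro: holo_on_const holo_on_mult assms)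

lemma holo_on_sum:
  assumes "finite I" "\<And>i. i \<in> I \<Longrightarrow> holo_on (f i) S" shows "holo_on (\<lambda>z. \<Sum>i\<in>I. f i z) S"
  using assms by (induction I) (auto intro: holo_on_const holo_on_add)

lemma holo_on_herm: "holo_on (\<lambda>z. herm z a) S"
  unfolding herm_def by (intro holo_on_sum holo_on_mult holo_on_component holo_on_const) simp

lemmas holo_on_intros = holo_on_const holo_on_component holo_on_add holo_on_mult holo_on_diff
  holo_on_divide holo_on_power holo_on_herm

lemma holo_on_continuous: "holo_on f S \<Longrightarrow> continuous_on S f"
  unfolding holo_on_def by (meson continuous_at_imp_continuous_on has_derivative_continuous)

section \<open>Complex lines, phase rotations and unitary maps\<close>

lemma linear_vec_scale_left: "linear (\<lambda>c::complex. c *s (w :: complex ^ 'n))"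
  by (rule linearI) (auto simp: vec_eq_iff algebra_simps)

lemma bounded_linear_vec_scale_left: "bounded_linear (\<lambda>c::complex. c *s (w :: complex ^ 'n))"
  using linear_vec_scale_left linear_conv_bounded_linear by blast

lemma continuous_on_vec_scale [continuous_intros]:
  fixes f :: "'a::topological_space \<Rightarrow> complex" and g :: "'a \<Rightarrow> complex ^ 'n"
  assumes "continuous_on S f" "continuous_on S g"
  shows "continuous_on S (\<lambda>x. f x *s g x)"
  unfolding vector_scalar_mult_def
  by (intro continuous_on_vec_lambda continuous_intros assms)

lemma borel_measurable_vec_scale [measurable]:
  fixes f :: "'a \<Rightarrow> complex" and g :: "'a \<Rightarrow> complex ^ 'n"
  assumes "f \<in> borel_measurable M" "g \<in> borel_measurable M"
  shows "(\<lambda>x. f x *s g x) \<in> borel_measurable M"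
proof -
  have "(\<lambda>x. (fst x :: complex) *s (snd x :: complex ^ 'n)) \<in> borel_measurable borel"
    by (intro borel_measurable_continuous_onI continuous_intros)
  from measurable_compose[OF borel_measurable_Pair[OF assms] this] show ?thesis by simp
qed

text \<open>One-variable theory is applied to functions on the ball through these restrictions to
  complex lines.\<close>

lemma holo_on_slice:
  fixes f :: "complex ^ 'n \<Rightarrow> complex"
  assumes "holo_on f S" "\<And>l. l \<in> T \<Longrightarrow> z + l *s w \<in> S" "open T"
  shows "(\<lambda>l. f (z + l *s w)) holomorphic_on T"
  unfolding holomorphic_on_open[OF assms(3)]
proof
  fix l assume l: "l \<in> T"
  obtain L where L: "(f has_derivative L) (at (z + l *s w))" "\<And>c w. L (c *s w) = c * L w"
    using assms(1) assms(2)[OF l] unfolding holo_on_def by meson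
  have "((\<lambda>l. z + l *s w) has_derivative (\<lambda>c. c *s w)) (at l)"
    by (auto intro!: derivative_eq_intros bounded_linear_imp_has_derivative bounded_linear_vec_scale_left)
  from diff_chain_at[OF this L(1)]
  have "((\<lambda>l. f (z + l *s w)) has_derivative (\<lambda>c. L w * c)) (at l)"
    by (simp add: o_def L(2) mult.commute)
  then show "\<exists>f'. ((\<lambda>l. f (z + l *s w)) has_field_derivative f') (at l)"
    unfolding has_field_derivative_def by blast
qed

lemma orthogonal_transformation_phase:
  assumes "norm c = 1"
  shows "orthogonal_transformation (\<lambda>z :: complex ^ 'n. c *s z)"
  unfolding orthogonal_transformation
proof (intro conjI allI)
  show "linear (\<lambda>z :: complex ^ 'n. c *s z)"
    by (rule linearI) (auto simp: vec_eq_iff algebra_simps)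
qed (simp add: norm_vec_scale assms)

text \<open>Multiplication by a phase preserves Lebesgue measure, so an inequality between circle
  means on every complex line through 0 integrates to an inequality on the whole space.\<close>

lemma nn_integral_circle_average:
  fixes K :: "complex ^ 'n \<Rightarrow> ennreal"
  assumes [measurable]: "K \<in> borel_measurable borel"
  shows "(\<integral>\<^sup>+h. (\<integral>\<^sup>+t. K (cis t *s h) * indicator {0..2*pi} t \<partial>lborel) \<partial>lborel)
    = ennreal (2 * pi) * (\<integral>\<^sup>+h. K h \<partial>lborel)"
proof -
  have [measurable]: "cis \<in> borel_measurable borel"
    by (intro borel_measurable_continuous_onI continuous_intros)
  have "(\<integral>\<^sup>+h. (\<integral>\<^sup>+t. K (cis t *s h) * indicator {0..2*pi} t \<partial>lborel) \<partial>lborel)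
     = (\<integral>\<^sup>+t. (\<integral>\<^sup>+h. K (cis t *s h) * indicator {0..2*pi} t \<partial>lborel) \<partial>lborel)"
    by (rule lborel_pair.Fubini') measurable
  also have "\<dots> = (\<integral>\<^sup>+t. (\<integral>\<^sup>+h. K h \<partial>lborel) * indicator {0..2*pi} t \<partial>lborel)"
  proof (rule nn_integral_cong)
    fix t
    show "(\<integral>\<^sup>+h. K (cis t *s h) * indicator {0..2*pi} t \<partial>lborel) = (\<integral>\<^sup>+h. K h \<partial>lborel) * indicator {0..2*pi} t"
      using nn_integral_lborel_orthogonal[OF orthogonal_transformation_phase[of "cis t"], of K]
      by (subst nn_integral_multc) auto
  qed
  also have "\<dots> = ennreal (2 * pi) * (\<integral>\<^sup>+h. K h \<partial>lborel)"
    by (subst nn_integral_cmult) (auto simp: mult.commute)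
  finally show ?thesis .
qed

lemma prod_Basis_complex_vec:
  fixes f :: "complex ^ 'n \<Rightarrow> 'b::comm_monoid_mult"
  shows "(\<Prod>e\<in>Basis. f e) = (\<Prod>i\<in>UNIV. f (axis i 1) * f (axis i \<i>))"
proof -
  have B: "(Basis :: (complex ^ 'n) set) = (\<lambda>(i, u). axis i u) ` (UNIV \<times> Basis)"
    by (auto simp: Basis_vec_def)
  have inj: "inj_on (\<lambda>(i::'n, u::complex). axis i u) (UNIV \<times> Basis)"
    by (auto simp: inj_on_def axis_eq_axis Basis_complex_def)
  have "(\<Prod>e\<in>Basis. f e) = (\<Prod>x\<in>UNIV \<times> Basis. f (axis (fst x) (snd x)))"
    unfolding B by (subst prod.reindex[OF inj]) (simp add: case_prod_beta)
  also have "\<dots> = (\<Prod>i\<in>UNIV. \<Prod>u\<in>Basis. f (axis i u))"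
    by (simp add: prod.cartesian_product case_prod_beta)
  finally show ?thesis by (simp add: Basis_complex_def)
qed

lemma emeasure_complex_box:
  fixes c :: "complex ^ 'n" and b :: "'n \<Rightarrow> real"
  assumes b: "\<And>i. b i \<ge> 0"
  shows "emeasure lborel {h :: complex ^ 'n. \<forall>i. \<bar>Re (h $ i - c $ i)\<bar> < b i \<and> \<bar>Im (h $ i - c $ i)\<bar> < b i}
    = ennreal (\<Prod>i\<in>UNIV. (2 * b i)\<^sup>2)" (is "emeasure _ ?S = _")
proof -
  define \<beta> :: "complex ^ 'n" where "\<beta> = (\<chi> i. Complex (b i) (b i))"
  have ax: "x \<bullet> axis i 1 = Re (x $ i)" "x \<bullet> axis i \<i> = Im (x $ i)" for x :: "complex ^ 'n" and i
    by (simp_all add: inner_axis inner_complex_def)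
  have Bas: "(\<forall>e\<in>Basis. P e) \<longleftrightarrow> (\<forall>i. P (axis i 1) \<and> P (axis i \<i>))" for P :: "complex ^ 'n \<Rightarrow> bool"
    by (auto simp: Basis_vec_def Basis_complex_def)
  have le: "\<forall>e\<in>Basis. (c - \<beta>) \<bullet> e \<le> (c + \<beta>) \<bullet> e"
    unfolding Bas ax by (simp add: \<beta>_def b)
  have S: "?S = box (c - \<beta>) (c + \<beta>)"
    unfolding box_def Bas ax by (intro Collect_cong all_cong1) (simp add: \<beta>_def abs_less_iff, linarith)
  have "emeasure lborel (box (c - \<beta>) (c + \<beta>)) = ennreal (\<Prod>e\<in>Basis. (c + \<beta> - (c - \<beta>)) \<bullet> e)"
    by (rule emeasure_lborel_box) (use le in auto)
  also have "(\<Prod>e\<in>Basis. (c + \<beta> - (c - \<beta>)) \<bullet> e) = (\<Prod>i\<in>UNIV. (2 * b i)\<^sup>2)"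
    unfolding prod_Basis_complex_vec ax by (simp add: \<beta>_def power2_eq_square)
  finally show ?thesis by (simp only: S)
qed

text \<open>The witness is a Householder reflection.\<close>
lemma unitary_to_axis:
  fixes a :: "complex ^ 'n" and k :: 'n
  shows "\<exists>U c. orthogonal_transformation U \<and> norm c = 1 \<and> (\<forall>z. herm (U z) a = of_real (norm a) * c * z $ k)"
proof (cases "a = 0")
  case True
  then show ?thesis by (intro exI[of _ "\<lambda>x. x"] exI[of _ 1]) auto
next
  case False
  define b where "b = (1 / of_real (norm a)) *s a"
  have b1: "norm b = 1" using False by (simp add: b_def norm_vec_scale norm_divide)
  have ab: "a = of_real (norm a) *s b" using False by (simp add: b_def vec_eq_iff)
  define c where "c = (if b $ k = 0 then 1 else b $ k / of_real (norm (b $ k)))"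
  have c1: "norm c = 1" by (simp add: c_def norm_divide)
  define e where "e = c *s (axis k 1 :: complex ^ 'n)"
  have ze: "herm z e = cnj c * z $ k" for z
    unfolding e_def herm_scale_right by (simp add: herm_def axis_def if_distrib cong: if_cong)
  have cc: "c * cnj c = 1" using c1 by (simp add: complex_norm_square[symmetric])
  have ee: "herm e e = 1" unfolding ze by (simp add: e_def axis_def) (simp add: cc mult.commute)
  have be: "herm b e = of_real (norm (b $ k))"
    unfolding ze c_def by (auto simp: complex_norm_square[symmetric] field_simps power2_eq_square)
  then have eb: "herm e b = of_real (norm (b $ k))" by (metis herm_cnj complex_cnj_complex_of_real)
  define v where "v = b - e"
  define V where "V = 2 - 2 * norm (b $ k)"
  have vv: "herm v v = of_real V"
    by (simp add: v_def herm_diff_left herm_diff_right herm_self[of b] b1 ee be eb V_def)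
  have vb: "herm v b = of_real (V / 2)"
    by (simp add: v_def herm_diff_left herm_self[of b] b1 eb V_def)
  have cza: "herm z a = of_real (norm a) * herm z b" for z
    by (subst ab) (simp add: herm_scale_right)
  show ?thesis
  proof (cases "v = 0")
    case True
    then have "b = e" by (simp add: v_def)
    then show ?thesis
      using c1 cza ze by (intro exI[of _ "\<lambda>x. x"] exI[of _ "cnj c"]) (simp add: mult.assoc)
  next
    case False
    then have V: "V \<noteq> 0" using vv by (auto simp: herm_self)
    define U where "U z = z - (2 * herm z v / of_real V) *s v" for z
    have "linear U"
      unfolding U_def[abs_def]
    proof (rule linearI)
      fix r :: real and x y :: "complex ^ 'n"
      have "r *\<^sub>R x = of_real r *s x" by (simp add: vec_eq_iff scaleR_conv_of_real[where 'a=complex])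
      then have "herm (r *\<^sub>R x) v = of_real r * herm x v" by (simp add: herm_scale_left)
      then show "r *\<^sub>R x - (2 * herm (r *\<^sub>R x) v / of_real V) *s v = r *\<^sub>R (x - (2 * herm x v / of_real V) *s v)"
        by (simp add: vec_eq_iff scaleR_conv_of_real[where 'a=complex] algebra_simps)
      show "x + y - (2 * herm (x + y) v / of_real V) *s v = x - (2 * herm x v / of_real V) *s v + (y - (2 * herm y v / of_real V) *s v)"
        by (simp add: vec_eq_iff herm_add_left add_divide_distrib algebra_simps)
    qed
    moreover have "norm (U z) = norm z" for z
    proof (rule power2_eq_imp_eq)
      have "complex_of_real ((norm (U z))\<^sup>2) = herm (U z) (U z)" by (simp add: herm_self)
      also have "\<dots> = herm z z"
        unfolding U_def herm_diff_left herm_diff_right herm_scale_left herm_scale_right vv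
        using V by (simp add: herm_cnj field_simps)
      finally have "complex_of_real ((norm (U z))\<^sup>2) = of_real ((norm z)\<^sup>2)" by (simp add: herm_self)
      then show "(norm (U z))\<^sup>2 = (norm z)\<^sup>2" by (simp only: of_real_eq_iff)
    qed auto
    ultimately have "orthogonal_transformation U" by (simp add: orthogonal_transformation)
    moreover have "herm (U z) a = of_real (norm a) * cnj c * z $ k" for z
    proof -
      have "herm (U z) b = herm z b - herm z v"
        unfolding U_def herm_diff_left herm_scale_left vb using V by simp
      also have "\<dots> = cnj c * z $ k" by (simp add: v_def herm_diff_right ze)
      finally show ?thesis by (simp add: cza)
    qed
    ultimately show ?thesis using c1 by (intro exI[of _ U] exI[of _ "cnj c"]) simp
  qed
qed

lemma norm_vec_sq: "(norm (h :: complex ^ 'n))\<^sup>2 = (\<Sum>i\<in>UNIV. (norm (h $ i))\<^sup>2)"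
  by (simp add: norm_vec_def L2_set_def sum_nonneg)

section \<open>Pseudohyperbolic balls and mean values\<close>

lemma Bn_iff: "z \<in> Bn \<longleftrightarrow> norm z < 1"
  by (simp add: Bn_def)

lemma Bn_borel_set [measurable]: "(Bn :: (complex ^ 'n) set) \<in> sets borel"
  by (simp add: Bn_def)

lemma borel_measurable_vec_nth_complex [measurable]:
  fixes f :: "'a \<Rightarrow> complex ^ 'n"
  assumes "f \<in> borel_measurable M"
  shows "(\<lambda>x. f x $ i) \<in> borel_measurable M"
  by (rule measurable_compose[OF assms]) (intro borel_measurable_continuous_onI continuous_intros)

lemma borel_measurable_herm [measurable]:
  fixes f g :: "'a \<Rightarrow> complex ^ 'n"
  assumes [measurable]: "f \<in> borel_measurable M" "g \<in> borel_measurable M"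
  shows "(\<lambda>x. herm (f x) (g x)) \<in> borel_measurable M"
proof -
  have [measurable]: "cnj \<in> borel_measurable borel"
    by (intro borel_measurable_continuous_onI continuous_intros)
  show ?thesis unfolding herm_def by measurable
qed

text \<open>The pseudohyperbolic ball, described without reference to the automorphism so that
  membership is jointly measurable in the point and the centre.\<close>
definition pball :: "complex ^ 'n \<Rightarrow> real \<Rightarrow> (complex ^ 'n) set" where
  "pball a s = {w. norm a < 1 \<and> norm w < 1 \<and>
     (1 - s\<^sup>2) * (norm (1 - herm w a))\<^sup>2 < (1 - (norm a)\<^sup>2) * (1 - (norm w)\<^sup>2)}"

lemma pball_iff:
  assumes "norm a < 1" "s > 0"
  shows "w \<in> pball a s \<longleftrightarrow> norm w < 1 \<and> pseudo_hyp a w < s"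
proof (cases "norm w < 1")
  case True
  have pos: "(norm (1 - herm w a))\<^sup>2 > 0" using norm_one_minus_herm_ge(4)[OF True assms(1)] by simp
  have "pseudo_hyp a w < s \<longleftrightarrow> (pseudo_hyp a w)\<^sup>2 < s\<^sup>2"
    using assms(2) by (metis pseudo_hyp_nonneg power2_less_imp_less power_strict_mono less_imp_le zero_less_numeral)
  also have "\<dots> \<longleftrightarrow> 1 - s\<^sup>2 < 1 - (pseudo_hyp a w)\<^sup>2" by linarith
  also have "\<dots> \<longleftrightarrow> (1 - s\<^sup>2) * (norm (1 - herm w a))\<^sup>2 < (1 - (norm a)\<^sup>2) * (1 - (norm w)\<^sup>2)"
    unfolding one_minus_pseudo_hyp_sq[OF assms(1) True] using pos by (simp add: pos_less_divide_eq)
  finally show ?thesis using True assms by (simp add: pball_def)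
qed (simp add: pball_def)

lemma pball_sym: "w \<in> pball a s \<longleftrightarrow> a \<in> pball w s"
  unfolding pball_def by (auto simp: norm_one_minus_herm_commute[of w a] mult.commute)

lemma pball_subset_Bn: "pball a s \<subseteq> Bn"
  by (auto simp: pball_def Bn_iff)

lemma pred_pball [measurable]:
  fixes f g :: "'a \<Rightarrow> complex ^ 'n"
  assumes [measurable]: "f \<in> borel_measurable M" "g \<in> borel_measurable M"
  shows "Measurable.pred M (\<lambda>x. g x \<in> pball (f x) s)"
  unfolding pball_def mem_Collect_eq by measurable

lemma pball_borel [measurable]: "pball (a :: complex ^ 'n) s \<in> sets borel"
  unfolding pball_def by measurable

section \<open>Volumes of nonisotropic polydiscs and tents\<close>

lemma emeasure_orthogonal_preimage:
  fixes U :: "'a::euclidean_space \<Rightarrow> 'a"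
  assumes U: "orthogonal_transformation U" and [measurable]: "A \<in> sets borel"
  shows "emeasure lborel {x. U x \<in> A} = emeasure lborel A"
proof -
  have "linear U" using U orthogonal_transformation_linear by blast
  then have m: "U \<in> borel_measurable borel"
    using linear_continuous_on[of U UNIV]
    by (simp add: linear_conv_bounded_linear borel_measurable_continuous_onI)
  have "emeasure lborel A = emeasure (distr lborel borel U) A"
    by (simp add: lborel_distr_orthogonal[OF U])
  also have "\<dots> = emeasure lborel {x. U x \<in> A}"
    using m by (subst emeasure_distr) (auto simp: vimage_def)
  finally show ?thesis by simp
qed

text \<open>The shape of every box below: one distinguished complex direction and
  \<open>n - 1\<close> equal ones.\<close>

lemma prod_axis_split:
  fixes k :: "'n::finite" and x y :: real
  shows "(\<Prod>i\<in>UNIV. (2 * (if i = k then x else y))\<^sup>2) = (2 * x)\<^sup>2 * ((2 * y)\<^sup>2) ^ (CARD('n) - 1)"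
proof -
  have "(\<Prod>i\<in>UNIV. (2 * (if i = k then x else y))\<^sup>2) = (2 * x)\<^sup>2 * (\<Prod>i\<in>UNIV - {k}. (2 * (if i = k then x else y))\<^sup>2)"
    by (subst prod.remove[of UNIV k]) auto
  also have "(\<Prod>i\<in>UNIV - {k}. (2 * (if i = k then x else y))\<^sup>2) = (\<Prod>i\<in>UNIV - {k}. (2 * y)\<^sup>2)"
    by (intro prod.cong) auto
  finally show ?thesis by (simp add: card_Diff_singleton)
qed

lemma norm_complex_le_box:
  assumes "\<bar>Re w\<bar> < b" "\<bar>Im w\<bar> < b"
  shows "(norm w)\<^sup>2 \<le> 2 * b\<^sup>2" "norm w < 2 * b"
proof -
  have "(Re w)\<^sup>2 \<le> b\<^sup>2" "(Im w)\<^sup>2 \<le> b\<^sup>2"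
    using assms by (auto intro!: power2_le_iff_abs_le[THEN iffD2])
  then show "(norm w)\<^sup>2 \<le> 2 * b\<^sup>2" by (simp add: cmod_power2)
  show "norm w < 2 * b" using cmod_le[of w] assms by linarith
qed

text \<open>A unitary map carries the direction of \<open>z\<close> to a coordinate axis. There a
  box with sides of order \<open>d = 1 - norm z\<close> in that complex direction and of order
  \<open>sqrt d\<close> in the others fits in, and its volume is of order
  \<open>d^2 * d^(n - 1)\<close>. The constants 16 and 256 are those of
  \<open>pseudo_hyp_small_polydisc\<close> tightened to allow \<open>h\<close> to be multiplied by
  scalars of modulus below 2.\<close>

lemma polydisc_volume_lower:
  "\<exists>c>0. \<forall>z\<in>Bn. ennreal (c * (1 - norm z) ^ (CARD('n) + 1)) \<le>
     emeasure lborel {h :: complex ^ 'n. norm (herm h z) < (1 - norm z) / 16 \<and> (norm h)\<^sup>2 < (1 - norm z) / 256}"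
proof -
  define m where "m = CARD('n)"
  have m: "m > 0" by (simp add: m_def)
  \<comment> \<open>With this \<open>e\<close>, real and imaginary parts below \<open>e * d\<close>
    give modulus below \<open>d / 16\<close> in direction \<open>k\<close>, and the \<open>m\<close>
    coordinates together contribute at most \<open>d / (512 * m) < d / 256\<close> to the squared
    norm.\<close>
  define e where "e = 1 / (32 * real m)"
  have e: "e > 0" using m by (simp add: e_def)
  obtain k :: 'n where True by blast
  show ?thesis
  proof (intro exI[of _ "(4 * e\<^sup>2) ^ m"] conjI ballI)
    show "(4 * e\<^sup>2) ^ m > 0" using e by simp
    fix z :: "complex ^ 'n" assume "z \<in> Bn"
    then have z: "norm z < 1" by (simp add: Bn_iff)
    define d where "d = 1 - norm z"
    have d: "0 < d" "d \<le> 1" using z by (auto simp: d_def)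
    let ?D = "{h :: complex ^ 'n. norm (herm h z) < d / 16 \<and> (norm h)\<^sup>2 < d / 256}"
    have [measurable]: "?D \<in> sets borel" by measurable
    define b where "b i = (if i = k then e * d else e * sqrt d)" for i
    obtain U c where U: "orthogonal_transformation U" "norm c = 1"
        "\<And>x. herm (U x) z = of_real (norm z) * c * x $ k"
      using unitary_to_axis[of z k] by blast
    let ?S = "{h :: complex ^ 'n. \<forall>i. \<bar>Re (h $ i - (0 :: complex ^ 'n) $ i)\<bar> < b i \<and> \<bar>Im (h $ i - (0 :: complex ^ 'n) $ i)\<bar> < b i}"
    have "?S \<subseteq> {h. U h \<in> ?D}"
    proof
      fix h assume "h \<in> ?S"
      then have h: "\<bar>Re (h $ i)\<bar> < b i" "\<bar>Im (h $ i)\<bar> < b i" for i by auto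
      have "norm (h $ k) < 2 * (e * d)"
        using norm_complex_le_box(2)[OF h[of k]] by (simp add: b_def)
      also have "\<dots> \<le> d / 16" using m d by (simp add: e_def field_simps)
      finally have "norm (h $ k) < d / 16" .
      moreover have "norm z * norm (h $ k) \<le> norm (h $ k)" using z by (simp add: mult_left_le_one_le)
      ultimately have "norm (herm (U h) z) < d / 16"
        unfolding U(3) norm_mult U(2) by simp
      moreover have "(norm h)\<^sup>2 < d / 256"
      proof -
        have "d * d \<le> d" using d by (simp add: mult_left_le_one_le)
        then have "e\<^sup>2 * (d * d) \<le> e\<^sup>2 * d" by (intro mult_left_mono) auto
        then have bb: "(b i)\<^sup>2 \<le> e\<^sup>2 * d" for i
          using d by (simp add: b_def power_mult_distrib power2_eq_square[of d])
        have "(norm (h $ i))\<^sup>2 \<le> 2 * e\<^sup>2 * d" for i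
          using norm_complex_le_box(1)[OF h[of i]] bb[of i] by linarith
        then have "(norm h)\<^sup>2 \<le> (\<Sum>i\<in>(UNIV :: 'n set). 2 * e\<^sup>2 * d)"
          unfolding norm_vec_sq by (intro sum_mono)
        also have "\<dots> = d / (512 * real m)" using m by (simp add: m_def[symmetric] e_def power2_eq_square field_simps)
        also have "\<dots> < d / 256" using d m by (intro divide_strict_left_mono) auto
        finally show ?thesis .
      qed
      ultimately show "h \<in> {h. U h \<in> ?D}"
        using U(1) by (simp add: orthogonal_transformation)
    qed
    moreover have "{h. U h \<in> ?D} \<in> sets lborel"
    proof -
      have "linear U" using U orthogonal_transformation_linear by blast
      then have [measurable]: "U \<in> borel_measurable borel"
        using linear_continuous_on[of U UNIV]
        by (simp add: linear_conv_bounded_linear borel_measurable_continuous_onI)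
      show ?thesis by measurable
    qed
    ultimately have "emeasure lborel ?S \<le> emeasure lborel {h. U h \<in> ?D}" by (rule emeasure_mono)
    also have "\<dots> = emeasure lborel ?D" by (rule emeasure_orthogonal_preimage) (use U in auto)
    also have "emeasure lborel ?S = ennreal (\<Prod>i\<in>UNIV. (2 * b i)\<^sup>2)"
      using e d by (intro emeasure_complex_box) (auto simp: b_def)
    also have "(\<Prod>i\<in>UNIV. (2 * b i)\<^sup>2) = (4 * e\<^sup>2) ^ m * d ^ (m + 1)"
    proof -
      have "(\<Prod>i\<in>UNIV. (2 * b i)\<^sup>2) = (2 * (e * d))\<^sup>2 * ((2 * (e * sqrt d))\<^sup>2) ^ (m - 1)"
        unfolding b_def m_def by (rule prod_axis_split)
      also have "\<dots> = (4 * e\<^sup>2 * d\<^sup>2) * ((4 * e\<^sup>2) * d) ^ (m - 1)"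
        using d by (simp add: power_mult_distrib mult_ac)
      also have "\<dots> = (4 * e\<^sup>2) ^ m * d ^ (m + 1)"
        using m by (cases m) (auto simp: power_mult_distrib power2_eq_square)
      finally show ?thesis .
    qed
    finally show "ennreal ((4 * e\<^sup>2) ^ m * (1 - norm z) ^ (CARD('n) + 1)) \<le>
       emeasure lborel {h. norm (herm h z) < (1 - norm z) / 16 \<and> (norm h)\<^sup>2 < (1 - norm z) / 256}"
      by (simp add: d_def m_def)
  qed
qed

text \<open>For \<open>\<eta> \<le> 1/2 \<le> norm a\<close>, after a rotation the distinguished
  coordinate lies within \<open>2 * \<eta>\<close> of a fixed point. Its squared modulus is then at
  least \<open>1 - 2 * \<eta>\<close>, which leaves only order \<open>sqrt \<eta>\<close> for the
  others, so the tent fits in a box. For larger \<open>\<eta>\<close> the volume of the ball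
  suffices, and for \<open>norm a < 1/2\<close> and \<open>\<eta> \<le> 1/2\<close> the tent is
  empty. The two terms of \<open>C\<close> belong to the ball and to the box.\<close>

lemma emeasure_tent_le:
  "\<exists>C>0. \<forall>a\<in>Bn. \<forall>\<eta>>0. emeasure lborel {z :: complex ^ 'n. z \<in> Bn \<and> norm (1 - herm z a) < \<eta>}
     \<le> ennreal (C * \<eta> ^ (CARD('n) + 1))"
proof -
  define m where "m = CARD('n)"
  have m: "m > 0" by (simp add: m_def)
  obtain k :: 'n where True by blast
  have "emeasure lborel (Bn :: (complex ^ 'n) set) \<noteq> \<infinity>"
    using emeasure_lborel_ball_pos(2)[of "0 :: complex ^ 'n"] by (simp add: Bn_def)
  then obtain V where V: "V \<ge> 0" "emeasure lborel (Bn :: (complex ^ 'n) set) = ennreal V"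
    by (metis ennreal_cases infinity_ennreal_def)
  define C where "C = V * 2 ^ (m + 1) + 16 ^ m"
  show ?thesis
  proof (intro exI[of _ C] conjI ballI allI impI)
    show "C > 0" using V by (simp add: C_def add_nonneg_pos)
    fix a :: "complex ^ 'n" and \<eta> :: real
    assume "a \<in> Bn" and eta: "\<eta> > 0"
    then have a: "norm a < 1" by (simp add: Bn_iff)
    let ?S = "{z :: complex ^ 'n. z \<in> Bn \<and> norm (1 - herm z a) < \<eta>}"
    have [measurable]: "?S \<in> sets borel" by measurable
    have triv: "emeasure lborel ?S \<le> ennreal (C * \<eta> ^ (m + 1))" if "\<eta> > 1/2"
    proof -
      have "emeasure lborel ?S \<le> emeasure lborel (Bn :: (complex ^ 'n) set)" by (intro emeasure_mono) auto
      also have "\<dots> \<le> ennreal (C * \<eta> ^ (m + 1))" unfolding V(2)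
      proof (rule ennreal_leI)
        have "V * 1 \<le> V * (2 * \<eta>) ^ (m + 1)" using V that by (intro mult_left_mono one_le_power) auto
        also have "\<dots> \<le> C * \<eta> ^ (m + 1)" using eta by (simp add: C_def power_mult_distrib algebra_simps)
        finally show "V \<le> C * \<eta> ^ (m + 1)" by simp
      qed
      finally show ?thesis .
    qed
    have "emeasure lborel ?S \<le> ennreal (C * \<eta> ^ (m + 1))" if small: "\<eta> \<le> 1/2" "norm a \<ge> 1/2"
    proof -
      obtain U c where U: "orthogonal_transformation U" "norm c = 1"
          "\<And>x. herm (U x) a = of_real (norm a) * c * x $ k"
        using unitary_to_axis[of a k] by blast
      \<comment> \<open>The value of the \<open>k\<close>-th coordinate at which
        \<open>herm (U x) a = 1\<close>; it is the centre of the box in that direction.\<close>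
      define w where "w = 1 / (of_real (norm a) * c)"
      define b where "b i = (if i = k then 2 * \<eta> else 2 * sqrt \<eta>)" for i
      define p where "p = (\<chi> i. if i = k then w else 0)"
      let ?T = "{h :: complex ^ 'n. \<forall>i. \<bar>Re (h $ i - p $ i)\<bar> < b i \<and> \<bar>Im (h $ i - p $ i)\<bar> < b i}"
      have sub: "{x. U x \<in> ?S} \<subseteq> ?T"
      proof
        fix x assume "x \<in> {x. U x \<in> ?S}"
        then have x: "norm x < 1" "norm (1 - of_real (norm a) * c * x $ k) < \<eta>"
          using U(1) by (auto simp: Bn_iff U(3) orthogonal_transformation)
        have nz: "of_real (norm a) * c \<noteq> 0" using small U(2) by auto
        have "of_real (norm a) * c * (x $ k - w) = - (1 - of_real (norm a) * c * x $ k)"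
          using nz by (simp add: w_def right_diff_distrib)
        then have "norm a * norm (x $ k - w) < \<eta>" using x(2) U(2)
          by (metis norm_minus_cancel norm_mult norm_of_real abs_norm_cancel mult.right_neutral)
        moreover have "1/2 * norm (x $ k - w) \<le> norm a * norm (x $ k - w)"
          using small by (intro mult_right_mono) auto
        ultimately have xk: "norm (x $ k - w) < 2 * \<eta>" by linarith
        have "1 - \<eta> \<le> norm (of_real (norm a) * c * x $ k)"
          using x(2) norm_triangle_ineq2[of 1 "of_real (norm a) * c * x $ k"] by simp
        also have "\<dots> = norm a * norm (x $ k)" by (simp add: norm_mult U(2))
        also have "\<dots> \<le> norm (x $ k)" using a by (simp add: mult_left_le_one_le)
        finally have "(1 - \<eta>)\<^sup>2 \<le> (norm (x $ k))\<^sup>2" using small by (intro power_mono) auto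
        then have lk: "1 - 2 * \<eta> \<le> (norm (x $ k))\<^sup>2" 
          by (simp add: power2_diff) (use zero_le_power2[of \<eta>] in linarith)
        have xi: "norm (x $ i) < 2 * sqrt \<eta>" if "i \<noteq> k" for i
        proof (rule power2_less_imp_less)
          have "(norm (x $ k))\<^sup>2 + (norm (x $ i))\<^sup>2 = (\<Sum>j\<in>{k, i}. (norm (x $ j))\<^sup>2)" using that by simp
          also have "\<dots> \<le> (norm x)\<^sup>2" unfolding norm_vec_sq by (intro sum_mono2) auto
          also have "\<dots> \<le> 1" using x(1) by (simp add: power_le_one)
          finally have "(norm (x $ i))\<^sup>2 \<le> 2 * \<eta>" using lk by linarith
          also have "\<dots> < (2 * sqrt \<eta>)\<^sup>2" using eta by (simp add: power_mult_distrib)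
          finally show "(norm (x $ i))\<^sup>2 < (2 * sqrt \<eta>)\<^sup>2" .
        qed (use eta in auto)
        have "norm (x $ i - p $ i) < b i" for i using xk xi by (auto simp: p_def b_def)
        then show "x \<in> ?T"
          by (intro CollectI allI conjI le_less_trans[OF abs_Re_le_cmod] le_less_trans[OF abs_Im_le_cmod])
      qed
      have "?T \<in> sets borel"
      proof -
        have "?T = (\<Inter>i. {h. \<bar>Re (h $ i - p $ i)\<bar> < b i \<and> \<bar>Im (h $ i - p $ i)\<bar> < b i})" by auto
        also have "\<dots> \<in> sets borel" by (intro sets.countable_INT'') auto
        finally show ?thesis .
      qed
      then have "emeasure lborel {x. U x \<in> ?S} \<le> emeasure lborel ?T" using sub by (intro emeasure_mono) auto
      also have "\<dots> = ennreal (\<Prod>i\<in>UNIV. (2 * b i)\<^sup>2)"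
        using eta by (intro emeasure_complex_box) (auto simp: b_def)
      also have "(\<Prod>i\<in>UNIV. (2 * b i)\<^sup>2) = (2 * (2 * \<eta>))\<^sup>2 * ((2 * (2 * sqrt \<eta>))\<^sup>2) ^ (m - 1)"
        unfolding b_def m_def by (rule prod_axis_split)
      also have "\<dots> = (16 * \<eta>\<^sup>2) * (16 * \<eta>) ^ (m - 1)" using eta by (simp add: power_mult_distrib)
      also have "\<dots> = 16 ^ m * \<eta> ^ (m + 1)"
        using m by (cases m) (auto simp: power_mult_distrib power2_eq_square)
      also have "ennreal \<dots> \<le> ennreal (C * \<eta> ^ (m + 1))"
        using V eta by (intro ennreal_leI mult_right_mono) (auto simp: C_def)
      finally show ?thesis using emeasure_orthogonal_preimage[OF U(1), of ?S] by simp
    qed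
    moreover have "?S = {}" if "norm a < 1/2" "\<eta> \<le> 1/2"
    proof -
      have False if "z \<in> ?S" for z
        using that norm_one_minus_herm_ge(1)[of z a] a \<open>norm a < 1/2\<close> \<open>\<eta> \<le> 1/2\<close> by (auto simp: Bn_iff)
      then show ?thesis by blast
    qed
    ultimately have "emeasure lborel ?S \<le> ennreal (C * \<eta> ^ (m + 1))" if "\<not> \<eta> > 1/2"
      using that by (cases "norm a < 1/2") (simp_all only: emeasure_empty not_less zero_le)
    with triv show "emeasure lborel ?S \<le> ennreal (C * \<eta> ^ (CARD('n) + 1))"
      unfolding m_def[symmetric] by blast
  qed
qed

section \<open>Sub-mean values and radial means\<close>

lemma measurable_holo_powr [measurable]:
  assumes "holo_on f (Bn :: (complex ^ 'n) set)"
  shows "(\<lambda>w. ennreal (norm (f w) powr p) * indicator Bn w) \<in> borel_measurable borel"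
proof -
  have [measurable]: "(\<lambda>w. indicator Bn w *\<^sub>R f w) \<in> borel_measurable borel"
    using holo_on_continuous[OF assms] by (intro borel_measurable_continuous_on_indicator) auto
  \<comment> \<open>\<open>holo_on\<close> leaves the values outside \<open>Bn\<close> free, so the
    function itself has to be cut off before the power is taken.\<close>
  have "(\<lambda>w. ennreal (norm (f w) powr p) * indicator Bn w)
      = (\<lambda>w. ennreal (norm (indicator Bn w *\<^sub>R f w) powr p))"
    by (auto split: split_indicator)
  also have "\<dots> \<in> borel_measurable borel" by measurable
  finally show ?thesis .
qed

text \<open>The mean is taken over a circular (not round) neighbourhood of the centre, so that only
  rotations of the complex lines through the centre are needed.\<close>
lemma holo_sub_mean_value:
  assumes p: "p > 0"
  shows "\<exists>c>0. \<forall>f. \<forall>z\<in>Bn. holo_on f (Bn :: (complex ^ 'n) set) \<longrightarrow>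
    ennreal (c * (1 - norm z) ^ (CARD('n) + 1)) * ennreal (norm (f z) powr p)
     \<le> (\<integral>\<^sup>+w. ennreal (norm (f w) powr p) * indicator Bn w * indicator (pball z (3/4)) w \<partial>lborel)"
proof -
  obtain c where c: "c > 0" "\<And>z. z \<in> Bn \<Longrightarrow> ennreal (c * (1 - norm z) ^ (CARD('n) + 1)) \<le>
     emeasure lborel {h :: complex ^ 'n. norm (herm h z) < (1 - norm z) / 16 \<and> (norm h)\<^sup>2 < (1 - norm z) / 256}"
    using polydisc_volume_lower by blast
  show ?thesis
  proof (intro exI[of _ c] conjI allI ballI impI)
    fix f :: "complex ^ 'n \<Rightarrow> complex" and z :: "complex ^ 'n"
    assume z': "z \<in> Bn" and f: "holo_on f Bn"
    then have z: "norm z < 1" by (simp add: Bn_iff)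
    define F :: "complex ^ 'n \<Rightarrow> ennreal" where "F w = ennreal (norm (f w) powr p) * indicator Bn w" for w
    have [measurable]: "F \<in> borel_measurable borel"
      unfolding F_def[abs_def] using f by (rule measurable_holo_powr)
    define D where "D = {h :: complex ^ 'n. norm (herm h z) < (1 - norm z) / 16 \<and> (norm h)\<^sup>2 < (1 - norm z) / 256}"
    have [measurable]: "D \<in> sets borel" unfolding D_def by measurable
    have scale: "norm (z + l *s h) < 1" "pseudo_hyp z (z + l *s h) < 3/4" if "h \<in> D" "norm l < 2" for h l
    proof -
      have 1: "norm (herm h z) < (1 - norm z) / 16" and 2: "(norm h)\<^sup>2 < (1 - norm z) / 256"
        using that by (auto simp: D_def)
      have "norm (herm (l *s h) z) \<le> 2 * norm (herm h z)"
        unfolding herm_scale_left norm_mult using that by (intro mult_right_mono) auto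
      then have 3: "norm (herm (l *s h) z) < (1 - norm z) / 8" using 1 by linarith
      have "(norm (l *s h))\<^sup>2 \<le> 2\<^sup>2 * (norm h)\<^sup>2"
        unfolding norm_vec_scale power_mult_distrib using that by (intro mult_right_mono power_mono) auto
      then have 4: "(norm (l *s h))\<^sup>2 < (1 - norm z) / 64" using 2 by simp
      show "norm (z + l *s h) < 1" "pseudo_hyp z (z + l *s h) < 3/4"
        using pseudo_hyp_small_polydisc[OF z 3 4] by auto
    qed
    have circD: "cis t *s h \<in> D \<longleftrightarrow> h \<in> D" for t h
      by (simp add: D_def herm_scale_left norm_mult norm_vec_scale)
    define K where "K h = indicator D h * F (z + h)" for h
    have [measurable]: "K \<in> borel_measurable borel" unfolding K_def[abs_def] by measurable
    have inner: "indicator D h * ennreal (2 * pi * norm (f z) powr p)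
        \<le> (\<integral>\<^sup>+t. K (cis t *s h) * indicator {0..2*pi} t \<partial>lborel)" for h
    proof (cases "h \<in> D")
      case True
      have hol: "(\<lambda>l. f (z + l *s h)) holomorphic_on ball 0 2"
        by (rule holo_on_slice[OF f]) (use scale[OF True] in \<open>auto simp: Bn_iff\<close>)
      have "ennreal (2 * pi * norm (f z) powr p) = ennreal (circle_pmean p (\<lambda>l. f (z + l *s h)) 0)"
        by (simp add: circle_pmean_def)
      also have "\<dots> \<le> ennreal (circle_pmean p (\<lambda>l. f (z + l *s h)) 1)"
        using p by (intro ennreal_leI circle_pmean_mono[OF hol]) auto
      also have "\<dots> = (\<integral>\<^sup>+t. ennreal (norm (f (z + (of_real 1 * cis t) *s h)) powr p) * indicator {0..2*pi} t \<partial>lborel)"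
        using p by (intro nn_integral_circle[symmetric, of 2] holomorphic_on_imp_continuous_on[OF hol]) auto
      also have "\<dots> = (\<integral>\<^sup>+t. K (cis t *s h) * indicator {0..2*pi} t \<partial>lborel)"
        using True scale[OF True, of "cis _"] by (simp add: K_def F_def circD Bn_iff)
      finally show ?thesis using True by simp
    qed simp
    have "ennreal (2 * pi) * (ennreal (c * (1 - norm z) ^ (CARD('n) + 1)) * ennreal (norm (f z) powr p))
       \<le> ennreal (2 * pi) * (emeasure lborel D * ennreal (norm (f z) powr p))"
      using c(2)[OF z'] unfolding D_def by (intro mult_left_mono mult_right_mono) auto
    also have "\<dots> = (\<integral>\<^sup>+h. indicator D h * ennreal (2 * pi * norm (f z) powr p) \<partial>lborel)"
      by (subst nn_integral_multc) (simp_all add: ennreal_mult mult_ac)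
    also have "\<dots> \<le> (\<integral>\<^sup>+h. (\<integral>\<^sup>+t. K (cis t *s h) * indicator {0..2*pi} t \<partial>lborel) \<partial>lborel)"
      by (rule nn_integral_mono, rule inner)
    also have "\<dots> = ennreal (2 * pi) * (\<integral>\<^sup>+h. K h \<partial>lborel)"
      by (rule nn_integral_circle_average) measurable
    finally have "ennreal (c * (1 - norm z) ^ (CARD('n) + 1)) * ennreal (norm (f z) powr p) \<le> (\<integral>\<^sup>+h. K h \<partial>lborel)"
      by (subst (asm) ennreal_mult_le_mult_iff) auto
    also have "\<dots> = (\<integral>\<^sup>+h. K (- z + h) \<partial>lborel)"
      by (rule nn_integral_lborel_shift[symmetric]) measurable
    also have "\<dots> \<le> (\<integral>\<^sup>+w. F w * indicator (pball z (3/4)) w \<partial>lborel)"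
    proof (intro nn_integral_mono)
      fix w
      have "w \<in> pball z (3/4)" if "- z + w \<in> D"
        using scale[OF that, of 1] z by (simp add: pball_iff)
      then show "K (- z + w) \<le> F w * indicator (pball z (3/4)) w"
        unfolding K_def by (cases "- z + w \<in> D") auto
    qed
    finally show "ennreal (c * (1 - norm z) ^ (CARD('n) + 1)) * ennreal (norm (f z) powr p)
     \<le> (\<integral>\<^sup>+w. ennreal (norm (f w) powr p) * indicator Bn w * indicator (pball z (3/4)) w \<partial>lborel)"
      unfolding F_def .
  qed (use c in auto)
qed

text \<open>Each side is a mean over the sphere of the given radius, the ball projected radially
  taking the place of the sphere. Averaging over phases turns it into circle means on complex lines
  through 0, where \<open>circle_pmean_mono\<close> applies.\<close>

lemma radial_mean_mono:
  fixes f :: "complex ^ 'n \<Rightarrow> complex"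
  assumes f: "holo_on f Bn" and p: "p > 0" and t: "0 \<le> t1" "t1 \<le> t2" "t2 < 1"
  defines "F \<equiv> (\<lambda>w. ennreal (norm (f w) powr p) * indicator Bn w)"
  shows "(\<integral>\<^sup>+z. indicator (ball 0 1) z * F ((t1 / norm z) *\<^sub>R z) \<partial>lborel)
    \<le> (\<integral>\<^sup>+z. indicator (ball 0 1) z * F ((t2 / norm z) *\<^sub>R z) \<partial>lborel)"
proof -
  have [measurable]: "F \<in> borel_measurable borel"
    unfolding F_def using f by (rule measurable_holo_powr)
  let ?B = "ball (0 :: complex ^ 'n) 1"
  have [measurable]: "?B \<in> sets borel" by simp
  define K where "K t z = indicator ?B z * F ((t / norm z) *\<^sub>R z)" for t z
  have [measurable]: "K t \<in> borel_measurable borel" for t unfolding K_def[abs_def] by measurable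
  have "(\<integral>\<^sup>+s. K t1 (cis s *s z) * indicator {0..2*pi} s \<partial>lborel) \<le> (\<integral>\<^sup>+s. K t2 (cis s *s z) * indicator {0..2*pi} s \<partial>lborel)" for z
  proof (cases "z = 0 \<or> z \<notin> ?B")
    case True
    then show ?thesis by (auto simp: K_def norm_vec_scale)
  next
    case False
    then have z: "z \<noteq> 0" "norm z < 1" by auto
    define w where "w = (1 / of_real (norm z)) *s z"
    have w: "norm w = 1" using z by (simp add: w_def norm_vec_scale norm_divide)
    have hol: "(\<lambda>l. f (0 + l *s w)) holomorphic_on ball 0 1"
      by (rule holo_on_slice[OF f]) (auto simp: Bn_iff norm_vec_scale w)
    have eq: "(\<integral>\<^sup>+s. K t (cis s *s z) * indicator {0..2*pi} s \<partial>lborel) = ennreal (circle_pmean p (\<lambda>l. f (0 + l *s w)) t)"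
      if "0 \<le> t" "t < 1" for t
    proof -
      have "(t / norm (cis s *s z)) *\<^sub>R (cis s *s z) = 0 + (of_real t * cis s) *s w" for s
        by (simp add: vec_eq_iff w_def norm_vec_scale scaleR_conv_of_real[where 'a=complex])
      moreover have "0 + (of_real t * cis s) *s w \<in> Bn" for s
        using that by (simp add: Bn_iff norm_vec_scale w norm_mult)
      ultimately have "K t (cis s *s z) = ennreal (norm (f (0 + (of_real t * cis s) *s w)) powr p)" for s
        using z by (simp add: K_def F_def norm_vec_scale)
      then show ?thesis
        using nn_integral_circle[OF holomorphic_on_imp_continuous_on[OF hol] that p] by simp
    qed
    have "t1 < 1" "0 \<le> t2" using t by auto
    then show ?thesis
      unfolding eq[OF t(1) \<open>t1 < 1\<close>] eq[OF \<open>0 \<le> t2\<close> t(3)]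
      by (intro ennreal_leI circle_pmean_mono[OF hol] t p)
  qed
  then have "(\<integral>\<^sup>+h. (\<integral>\<^sup>+s. K t1 (cis s *s h) * indicator {0..2*pi} s \<partial>lborel) \<partial>lborel)
    \<le> (\<integral>\<^sup>+h. (\<integral>\<^sup>+s. K t2 (cis s *s h) * indicator {0..2*pi} s \<partial>lborel) \<partial>lborel)"
    by (rule nn_integral_mono)
  then have "ennreal (2 * pi) * (\<integral>\<^sup>+h. K t1 h \<partial>lborel) \<le> ennreal (2 * pi) * (\<integral>\<^sup>+h. K t2 h \<partial>lborel)"
    by (subst (asm) (1 2) nn_integral_circle_average) auto
  then show ?thesis
    unfolding K_def by (subst (asm) ennreal_mult_le_mult_iff) auto
qed

section \<open>Radial weights\<close>

text \<open>Polar coordinates with the radial factor taken out of the spherical mean, so that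
  weights can be compared radius by radius.\<close>

lemma nn_integral_polar_weighted:
  fixes F :: "'a::euclidean_space \<Rightarrow> ennreal" and h :: "real \<Rightarrow> ennreal"
  assumes [measurable]: "F \<in> borel_measurable borel" "h \<in> borel_measurable borel"
  shows "(\<integral>\<^sup>+z. F z * h (norm z) \<partial>lborel) =
    (\<integral>\<^sup>+t. ennreal (DIM('a) * t ^ (DIM('a) - 1)) * indicator {0<..} t * h t *
       (\<integral>\<^sup>+z. indicator (ball 0 1) z * F ((t / norm z) *\<^sub>R z) \<partial>lborel) \<partial>lborel)"
proof -
  have [measurable]: "ball (0::'a) 1 \<in> sets borel" by simp
  let ?g = "\<lambda>t::real. ennreal (DIM('a) * t ^ (DIM('a) - 1)) * indicator {0<..} t"
  have "(\<integral>\<^sup>+z. F z * h (norm z) \<partial>lborel) = (\<integral>\<^sup>+z. indicator (ball 0 1) z *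
     (\<integral>\<^sup>+t. ?g t * (F ((t / norm z) *\<^sub>R z) * h (norm ((t / norm z) *\<^sub>R z))) \<partial>lborel) \<partial>lborel)"
    by (rule nn_integral_polar) measurable
  also have "\<dots> = (\<integral>\<^sup>+z. (\<integral>\<^sup>+t. ?g t * h t * (indicator (ball 0 1) z * F ((t / norm z) *\<^sub>R z)) \<partial>lborel) \<partial>lborel)"
  proof (rule nn_integral_cong_AE, rule AE_mp[OF AE_lborel_singleton[of "0::'a"]], intro AE_I2 impI)
    fix z :: 'a assume z: "z \<noteq> 0"
    have "indicator (ball 0 1) z * (\<integral>\<^sup>+t. ?g t * (F ((t / norm z) *\<^sub>R z) * h (norm ((t / norm z) *\<^sub>R z))) \<partial>lborel)
      = (\<integral>\<^sup>+t. indicator (ball 0 1) z * (?g t * (F ((t / norm z) *\<^sub>R z) * h (norm ((t / norm z) *\<^sub>R z)))) \<partial>lborel)"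
      by (rule nn_integral_cmult[symmetric]) measurable
    also have "\<dots> = (\<integral>\<^sup>+t. ?g t * h t * (indicator (ball 0 1) z * F ((t / norm z) *\<^sub>R z)) \<partial>lborel)"
      using z by (intro nn_integral_cong) (auto split: split_indicator simp: mult_ac)
    finally show "indicator (ball 0 1) z * (\<integral>\<^sup>+t. ?g t * (F ((t / norm z) *\<^sub>R z) * h (norm ((t / norm z) *\<^sub>R z))) \<partial>lborel)
      = (\<integral>\<^sup>+t. ?g t * h t * (indicator (ball 0 1) z * F ((t / norm z) *\<^sub>R z)) \<partial>lborel)" .
  qed
  also have "\<dots> = (\<integral>\<^sup>+t. (\<integral>\<^sup>+z. ?g t * h t * (indicator (ball 0 1) z * F ((t / norm z) *\<^sub>R z)) \<partial>lborel) \<partial>lborel)"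
    by (rule lborel_pair.Fubini') measurable
  also have "\<dots> = (\<integral>\<^sup>+t. ?g t * h t * (\<integral>\<^sup>+z. indicator (ball 0 1) z * F ((t / norm z) *\<^sub>R z) \<partial>lborel) \<partial>lborel)"
    by (rule nn_integral_cong, rule nn_integral_cmult) measurable
  finally show ?thesis .
qed

lemma nn_integral_dV:
  fixes g :: "complex ^ 'n \<Rightarrow> ennreal"
  assumes [measurable]: "(\<lambda>z. g z * indicator Bn z) \<in> borel_measurable borel"
  shows "(\<integral>\<^sup>+z. g z \<partial>dV) = inverse (emeasure lborel (Bn :: (complex ^ 'n) set)) * (\<integral>\<^sup>+z. g z * indicator Bn z \<partial>lborel)"
proof -
  have m: "g \<in> borel_measurable (restrict_space lborel Bn)"
    using assms by (subst borel_measurable_restrict_space_iff_ennreal) (auto simp: mult.commute)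
  have "(\<integral>\<^sup>+z. g z \<partial>dV) = (\<integral>\<^sup>+z. inverse (emeasure lborel (Bn :: (complex ^ 'n) set)) * g z \<partial>restrict_space lborel Bn)"
    unfolding dV_def using m by (subst nn_integral_density) auto
  also have "\<dots> = inverse (emeasure lborel (Bn :: (complex ^ 'n) set)) * (\<integral>\<^sup>+z. g z \<partial>restrict_space lborel Bn)"
    using m by (rule nn_integral_cmult)
  also have "(\<integral>\<^sup>+z. g z \<partial>restrict_space lborel Bn) = (\<integral>\<^sup>+z. g z * indicator Bn z \<partial>lborel)"
    by (rule nn_integral_restrict_space) simp
  finally show ?thesis .
qed

definition Bn_vol :: "'n::finite itself \<Rightarrow> real" where
  "Bn_vol _ = measure lborel (Bn :: (complex ^ 'n) set)"

lemma emeasure_Bn: "emeasure lborel (Bn :: (complex ^ 'n) set) = ennreal (Bn_vol TYPE('n))"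
  and Bn_vol_pos: "Bn_vol TYPE('n::finite) > 0"
proof -
  have 1: "emeasure lborel (Bn :: (complex ^ 'n) set) \<noteq> \<infinity>" "emeasure lborel (Bn :: (complex ^ 'n) set) \<noteq> 0"
    using emeasure_lborel_ball_pos[of "0 :: complex ^ 'n"] by (auto simp: Bn_def)
  then show *: "emeasure lborel (Bn :: (complex ^ 'n) set) = ennreal (Bn_vol TYPE('n))"
    unfolding Bn_vol_def by (intro emeasure_eq_ennreal_measure) auto
  then show "Bn_vol TYPE('n::finite) > 0" using 1 by (metis ennreal_eq_0_iff not_le)
qed

text \<open>The parameter \<open>ty\<close> only fixes the dimension.\<close>
locale D_weight =
  fixes \<omega> :: "real \<Rightarrow> real" and ty :: "'n::finite itself"
  assumes radial: "radial_weight \<omega> TYPE('n)" and D: "D_class \<omega>"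
begin

text \<open>The hypotheses constrain \<open>\<omega>\<close> on \<open>{0..<1}\<close> only;
  extension by 0 gives a nonnegative Borel function on the line, and the tail integral can then run
  over a half-line.\<close>

definition wt :: "real \<Rightarrow> real" where "wt x = (if 0 \<le> x \<and> x < 1 then \<omega> x else 0)"

definition ohat :: "real \<Rightarrow> ennreal" where "ohat t = (\<integral>\<^sup>+s. ennreal (wt s) * indicator {t..} s \<partial>lborel)"

text \<open>\<open>enn2real\<close> sends infinity to 0; for \<open>t \<ge> 0\<close> this case is
  excluded by \<open>ohat_finite\<close>.\<close>

definition tail :: "real \<Rightarrow> real" where "tail t = enn2real (ohat t)"

lemma wt_measurable [measurable]: "wt \<in> borel_measurable borel"
proof -
  have "(\<lambda>x. indicator {0..<1} x *\<^sub>R \<omega> x) \<in> borel_measurable borel"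
    using radial unfolding radial_weight_def
    by (subst borel_measurable_restrict_space_iff[symmetric]) auto
  moreover have "(\<lambda>x. indicator {0..<1} x *\<^sub>R \<omega> x) = wt" by (auto simp: wt_def indicator_def)
  ultimately show ?thesis by simp
qed

lemma wt_nonneg: "wt x \<ge> 0"
  using radial by (auto simp: wt_def radial_weight_def intro: less_imp_le)

lemma wt_pos: "0 \<le> x \<Longrightarrow> x < 1 \<Longrightarrow> wt x > 0"
  using radial by (auto simp: wt_def radial_weight_def)

lemma wt_ge_1 [simp]: "x \<ge> 1 \<Longrightarrow> wt x = 0" by (simp add: wt_def)

lemma wt_norm: "z \<in> Bn \<Longrightarrow> \<omega> (norm z) = wt (norm z)"
  by (simp add: wt_def Bn_iff)

lemma ohat_measurable [measurable]: "ohat \<in> borel_measurable borel"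
proof -
  have "(\<lambda>t. \<integral>\<^sup>+s. ennreal (wt s) * (if t \<le> s then 1 else 0) \<partial>lborel) \<in> borel_measurable borel" by measurable
  moreover have "ohat = (\<lambda>t. \<integral>\<^sup>+s. ennreal (wt s) * (if t \<le> s then 1 else 0) \<partial>lborel)"
    unfolding ohat_def by (intro ext nn_integral_cong) (auto split: split_indicator)
  ultimately show ?thesis by simp
qed

lemma omega_hat_eq: "0 \<le> r \<Longrightarrow> omega_hat \<omega> r = ohat r"
  unfolding omega_hat_def ohat_def by (intro nn_integral_cong) (auto simp: wt_def split: split_indicator)

lemma ohat_antimono: "r \<le> s \<Longrightarrow> ohat s \<le> ohat r"
  unfolding ohat_def by (intro nn_integral_mono) (auto split: split_indicator)

text \<open>Integrability over the ball controls the radial weight only away from the origin, where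
  the polar density \<open>t ^ (d - 1)\<close> is bounded below. Radius 0 is reached afterwards by
  one application of the doubling condition.\<close>

lemma ohat_half_finite: "ohat (1/2) < \<infinity>"
proof -
  let ?d = "DIM(complex ^ 'n)"
  have fin: "(\<integral>\<^sup>+z. ennreal (\<omega> (norm z)) \<partial>(dV :: (complex ^ 'n) measure)) < \<infinity>"
    using radial by (simp add: radial_weight_def)
  have eq: "(\<lambda>z :: complex ^ 'n. ennreal (\<omega> (norm z)) * indicator Bn z) = (\<lambda>z. indicator Bn z * ennreal (wt (norm z)))"
    by (auto simp: wt_norm split: split_indicator)
  have "(\<integral>\<^sup>+z. ennreal (\<omega> (norm z)) \<partial>(dV :: (complex ^ 'n) measure))
     = inverse (ennreal (Bn_vol TYPE('n))) * (\<integral>\<^sup>+z. indicator (Bn :: (complex ^ 'n) set) z * ennreal (wt (norm z)) \<partial>lborel)"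
    unfolding eq[symmetric] emeasure_Bn[symmetric] by (rule nn_integral_dV) (unfold eq, measurable)
  with fin have fin1: "(\<integral>\<^sup>+z. indicator (Bn :: (complex ^ 'n) set) z * ennreal (wt (norm z)) \<partial>lborel) < \<infinity>"
    using Bn_vol_pos[where 'n='n] by (auto simp: ennreal_mult_less_top ennreal_inverse_eq_0_iff less_top[symmetric] top_unique)
  let ?N = "\<lambda>t. \<integral>\<^sup>+z. indicator (ball 0 1) z * indicator Bn ((t / norm z) *\<^sub>R (z :: complex ^ 'n)) \<partial>lborel"
  have "ennreal ((1/2) ^ (?d - 1) * Bn_vol TYPE('n)) * ohat (1/2)
     = (\<integral>\<^sup>+t. ennreal ((1/2) ^ (?d - 1) * Bn_vol TYPE('n)) * (ennreal (wt t) * indicator {1/2..} t) \<partial>lborel)"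
    unfolding ohat_def by (rule nn_integral_cmult[symmetric]) measurable
  also have "\<dots> \<le> (\<integral>\<^sup>+t. ennreal (?d * t ^ (?d - 1)) * indicator {0<..} t * ennreal (wt t) * ?N t \<partial>lborel)"
  proof (rule nn_integral_mono)
    fix t :: real
    show "ennreal ((1/2) ^ (?d - 1) * Bn_vol TYPE('n)) * (ennreal (wt t) * indicator {1/2..} t)
      \<le> ennreal (?d * t ^ (?d - 1)) * indicator {0<..} t * ennreal (wt t) * ?N t"
    proof (cases "1/2 \<le> t \<and> t < 1")
      case True
      have "indicator (ball 0 1) z * indicator Bn ((t / norm z) *\<^sub>R z) = (indicator Bn z :: ennreal)" for z :: "complex ^ 'n"
        using True by (cases "z = 0") (auto simp: Bn_iff split: split_indicator)
      then have N: "?N t = ennreal (Bn_vol TYPE('n))" by (simp add: emeasure_Bn)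
      have "(1/2) ^ (?d - 1) \<le> t ^ (?d - 1)" using True by (intro power_mono) auto
      also have "1 * t ^ (?d - 1) \<le> ?d * t ^ (?d - 1)"
      proof (rule mult_right_mono)
        show "1 \<le> real ?d" using DIM_positive[where 'a="complex ^ 'n"] by linarith
      qed (use True in auto)
      then have "t ^ (?d - 1) \<le> ?d * t ^ (?d - 1)" by simp
      finally have "(1/2) ^ (?d - 1) \<le> ?d * t ^ (?d - 1)" .
      then have "ennreal ((1/2) ^ (?d - 1)) * ennreal (Bn_vol TYPE('n)) * ennreal (wt t) \<le> ennreal (?d * t ^ (?d - 1)) * ennreal (Bn_vol TYPE('n)) * ennreal (wt t)"
        by (intro mult_right_mono ennreal_leI) auto
      then show ?thesis unfolding N
        using True Bn_vol_pos[where 'n='n] by (simp add: ennreal_mult mult_ac)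
    qed (auto simp: not_le split: split_indicator)
  qed
  also have "\<dots> = (\<integral>\<^sup>+z. indicator (Bn :: (complex ^ 'n) set) z * ennreal (wt (norm z)) \<partial>lborel)"
    by (rule nn_integral_polar_weighted[symmetric]) measurable
  finally have "ennreal ((1/2) ^ (?d - 1) * Bn_vol TYPE('n)) * ohat (1/2) < \<infinity>" using fin1 by (rule le_less_trans)
  then show ?thesis using Bn_vol_pos[where 'n='n]
    by (auto simp: ennreal_mult_less_top zero_less_mult_iff)
qed

lemma ohat_finite: "0 \<le> r \<Longrightarrow> ohat r < \<infinity>"
proof -
  assume "0 \<le> r"
  obtain C where "C \<ge> 1" "\<And>r. r \<in> {0..<1} \<Longrightarrow> omega_hat \<omega> r \<le> ennreal C * omega_hat \<omega> ((1 + r) / 2)"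
    using D unfolding D_class_def D_hat_def by blast
  from this(2)[of 0] have "ohat 0 \<le> ennreal C * ohat (1/2)" by (simp add: omega_hat_eq)
  also have "\<dots> < \<infinity>" using ohat_half_finite by (simp add: ennreal_mult_less_top)
  finally show ?thesis using ohat_antimono[OF \<open>0 \<le> r\<close>] by (meson le_less_trans)
qed

lemma ohat_eq: "0 \<le> r \<Longrightarrow> ohat r = ennreal (tail r)"
  unfolding tail_def using ohat_finite[of r] by simp

lemma tail_nonneg [simp]: "tail r \<ge> 0" by (simp add: tail_def)

lemma tail_pos: "0 \<le> r \<Longrightarrow> r < 1 \<Longrightarrow> tail r > 0"
proof (rule ccontr)
  assume r: "0 \<le> r" "r < 1" and "\<not> tail r > 0"
  then have "tail r = 0" using tail_nonneg[of r] by linarith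
  then have "(\<integral>\<^sup>+s. ennreal (wt s) * indicator {r..} s \<partial>lborel) = 0" using ohat_eq[OF r(1)] by (simp add: ohat_def)
  then have "AE s in lborel. ennreal (wt s) * indicator {r..} s = 0"
    by (subst (asm) nn_integral_0_iff_AE) auto
  then have "AE s in lborel. s \<notin> {r<..<1}"
  proof eventually_elim
    case (elim s)
    then show ?case using wt_pos[of s] r by (auto simp: ennreal_eq_0_iff)
  qed
  then have "emeasure lborel {r<..<1} = 0"
    by (subst (asm) AE_iff_measurable[of "{r<..<1}"]) auto
  then show False using r by simp
qed

lemma tail_antimono: "0 \<le> r \<Longrightarrow> r \<le> s \<Longrightarrow> tail s \<le> tail r"
  using ohat_antimono[of r s] by (simp add: ohat_eq)

text \<open>One application of \<open>D_hat\<close> halves the distance to the boundary. Rounding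
  its constant up to a power of 2 makes the loss after \<open>k\<close> halvings the
  \<open>M\<close>-th power of the distance ratio, and a large kernel exponent can absorb
  it.\<close>

lemma tail_doubling:
  obtains M :: nat where "\<And>k r s. 0 \<le> r \<Longrightarrow> r < 1 \<Longrightarrow> 0 \<le> s \<Longrightarrow> s < 1 \<Longrightarrow> 1 - r \<le> 2 ^ k * (1 - s) \<Longrightarrow> tail r \<le> 2 ^ (M * k) * tail s"
proof -
  obtain C where C: "C \<ge> 1" "\<And>r. r \<in> {0..<1} \<Longrightarrow> omega_hat \<omega> r \<le> ennreal C * omega_hat \<omega> ((1 + r) / 2)"
    using D unfolding D_class_def D_hat_def by blast
  obtain M :: nat where M: "C < 2 ^ M" using real_arch_pow[of 2 C] by auto
  have step: "tail r \<le> 2 ^ M * tail ((1 + r) / 2)" if "0 \<le> r" "r < 1" for r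
  proof -
    have "ennreal (tail r) \<le> ennreal (C * tail ((1 + r) / 2))"
      using C(2)[of r] C(1) that by (simp add: omega_hat_eq ohat_eq ennreal_mult)
    then have "tail r \<le> C * tail ((1 + r) / 2)" using C by simp
    also have "\<dots> \<le> 2 ^ M * tail ((1 + r) / 2)" using M by (intro mult_right_mono) auto
    finally show ?thesis .
  qed
  have iter: "tail r \<le> 2 ^ (M * k) * tail (1 - (1 - r) / 2 ^ k)" if "0 \<le> r" "r < 1" for r k
  proof (induction k)
    case (Suc k)
    let ?r = "1 - (1 - r) / 2 ^ k"
    define y where "y = (1 - r) / 2 ^ k"
    have "y \<le> (1 - r) / 1" unfolding y_def using that by (intro divide_left_mono) auto
    moreover have "y > 0" unfolding y_def using that by simp
    ultimately have "0 \<le> 1 - y" "1 - y < 1" using that(1) by simp_all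
    note r = this[unfolded y_def]
    have e: "(1 + ?r) / 2 = 1 - (1 - r) / 2 ^ Suc k" by (simp add: field_simps)
    have "2 ^ (M * k) * tail ?r \<le> 2 ^ (M * k) * (2 ^ M * tail (1 - (1 - r) / 2 ^ Suc k))"
      by (intro mult_left_mono step[OF r, unfolded e]) simp
    also have "\<dots> = 2 ^ (M * Suc k) * tail (1 - (1 - r) / 2 ^ Suc k)"
      by (simp add: power_add)
    finally show ?case using Suc.IH by linarith
  qed simp
  show thesis
  proof (rule that[of M])
    fix k r s assume rs: "0 \<le> r" "r < 1" "0 \<le> s" "s < (1::real)" "1 - r \<le> 2 ^ k * (1 - s)"
    have "s \<le> 1 - (1 - r) / 2 ^ k" using rs by (simp add: field_simps)
    then have "tail (1 - (1 - r) / 2 ^ k) \<le> tail s" using rs by (intro tail_antimono)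
    then have "2 ^ (M * k) * tail (1 - (1 - r) / 2 ^ k) \<le> 2 ^ (M * k) * tail s" by (intro mult_left_mono) auto
    with iter[OF rs(1,2), of k] show "tail r \<le> 2 ^ (M * k) * tail s" by linarith
  qed
qed

text \<open>The condition \<open>D_check\<close> bounds the tail by the mass of a shell, which is then moved outwards by the
  monotonicity of the radial means.\<close>
lemma holo_integral_smooth_weight:
  fixes p :: real
  assumes p: "p > 0"
  shows "\<exists>C\<ge>0. \<forall>f. holo_on f (Bn :: (complex ^ 'n) set) \<longrightarrow>
    (\<integral>\<^sup>+z. ennreal (norm (f z) powr p) * indicator Bn z * ennreal (tail (norm z) / (1 - norm z)) \<partial>lborel)
    \<le> ennreal C * (\<integral>\<^sup>+z. ennreal (norm (f z) powr p) * indicator Bn z * ennreal (wt (norm z)) \<partial>lborel)"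
proof -
  obtain C K where CK: "C > 1" "K > 1" "\<And>r. r \<in> {0..<1} \<Longrightarrow> omega_hat \<omega> r \<ge> ennreal C * omega_hat \<omega> (1 - (1 - r) / K)"
    using D unfolding D_class_def D_check_def by blast
  \<comment> \<open>From \<open>tail t = x + tail ?t\<close> and
    \<open>C * tail ?t \<le> tail t\<close>, where \<open>x\<close> is the mass of the shell, one
    solves \<open>tail t \<le> C / (C - 1) * x\<close>.\<close>
  define C' where "C' = C / (C - 1)"
  have C': "C' > 0" using CK by (simp add: C'_def)
  let ?d = "DIM(complex ^ 'n)"
  define g where "g t = ennreal (?d * t ^ (?d - 1)) * indicator {0<..} t" for t :: real
  have [measurable]: "g \<in> borel_measurable borel" unfolding g_def[abs_def] by measurable
  define h where "h t = ohat t * ennreal (1 / (1 - t)) * indicator {0..<1} t" for t :: real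
  have [measurable]: "h \<in> borel_measurable borel" unfolding h_def[abs_def] by measurable
  \<comment> \<open>\<open>Q t s\<close> places \<open>s\<close> in the shell between
    \<open>t\<close> and \<open>1 - (1 - t) / K\<close>; \<open>R\<close> below attaches the factor
    \<open>1 / (1 - t)\<close> of the smooth weight.\<close>
  define Q where "Q t s \<longleftrightarrow> 0 < t \<and> t \<le> s \<and> s < 1 - (1 - t) / K \<and> t < 1" for t s :: real
  have [measurable]: "Measurable.pred M (\<lambda>x. Q (a x) (b x))"
    if [measurable]: "a \<in> borel_measurable M" "b \<in> borel_measurable M" for a b and M :: "'m measure"
    unfolding Q_def by measurable
  define R where "R t s = (if Q t s then ennreal (1 / (1 - t)) else 0)" for t s
  have [measurable]: "(\<lambda>x. R (a x) (b x)) \<in> borel_measurable M"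
    if [measurable]: "a \<in> borel_measurable M" "b \<in> borel_measurable M" for a b and M :: "'m measure"
    unfolding R_def Q_def by measurable
  have hle: "h t \<le> ennreal C' * (\<integral>\<^sup>+s. ennreal (wt s) * R t s \<partial>lborel)" if t: "0 < t" "t < 1" for t
  proof -
    let ?t = "1 - (1 - t) / K"
    have "(1 - t) / K < (1 - t) / 1" "(1 - t) / K > 0"
      using t CK(2) by (intro divide_strict_left_mono divide_pos_pos; simp)+
    then have tt: "t < ?t" "?t < 1" by simp_all
    let ?A = "\<integral>\<^sup>+s. ennreal (wt s) * (if Q t s then 1 else 0) \<partial>lborel"
    have split: "ohat t = ?A + ohat ?t"
      unfolding ohat_def
      by (subst nn_integral_add[symmetric]) (use t tt in \<open>auto intro!: nn_integral_cong simp: Q_def split: split_indicator\<close>)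
    then have "?A \<le> ohat t" by simp
    then have fin: "?A < \<infinity>" using ohat_finite[of t] t by (meson le_less_trans less_imp_le)
    define x where "x = enn2real ?A"
    have x: "?A = ennreal x" "x \<ge> 0" using fin by (auto simp: x_def)
    have "tail t = x + tail ?t" using split t tt by (simp add: x ohat_eq flip: ennreal_plus)
    moreover have "C * tail ?t \<le> tail t"
      using CK(3)[of t] t tt CK(1) by (simp add: omega_hat_eq ohat_eq flip: ennreal_mult)
    ultimately have "(C - 1) * tail t \<le> C * x" by (simp add: algebra_simps)
    then have "tail t \<le> C' * x" using CK(1) by (simp add: C'_def field_simps)
    then have "ohat t \<le> ennreal C' * ?A" using t C' x by (simp add: ohat_eq flip: ennreal_mult)
    then have "h t \<le> ennreal C' * ?A * ennreal (1 / (1 - t))" using t by (simp add: h_def mult_right_mono)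
    also have "\<dots> = ennreal C' * (\<integral>\<^sup>+s. ennreal (wt s) * (if Q t s then 1 else 0) * ennreal (1 / (1 - t)) \<partial>lborel)"
      by (subst nn_integral_multc) (auto simp: mult.assoc)
    also have "(\<integral>\<^sup>+s. ennreal (wt s) * (if Q t s then 1 else 0) * ennreal (1 / (1 - t)) \<partial>lborel) = (\<integral>\<^sup>+s. ennreal (wt s) * R t s \<partial>lborel)"
      by (intro nn_integral_cong) (simp add: R_def)
    finally show ?thesis .
  qed
  \<comment> \<open>For fixed \<open>s\<close> the admissible \<open>t\<close> lie in an interval of
    length \<open>(K - 1) * (1 - s)\<close>, on which \<open>1 / (1 - t) \<le> 1 / (1 - s)\<close>.
    After Tonelli the smooth weight therefore costs only a constant.\<close>
  have Rint: "(\<integral>\<^sup>+t. R t s \<partial>lborel) \<le> ennreal (K - 1)" if s: "0 < s" "s < 1" for s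
  proof -
    have "1 * (1 - s) \<le> K * (1 - s)" using CK(2) s by (intro mult_right_mono) auto
    then have Ks: "1 - K * (1 - s) \<le> s" by (simp add: algebra_simps)
    have "(\<integral>\<^sup>+t. R t s \<partial>lborel) \<le> (\<integral>\<^sup>+t. ennreal (1 / (1 - s)) * indicator {1 - K * (1 - s)..s} t \<partial>lborel)"
    proof (rule nn_integral_mono)
      fix t
      show "R t s \<le> ennreal (1 / (1 - s)) * indicator {1 - K * (1 - s)..s} t"
      proof (cases "Q t s")
        case True
        then have "t \<le> s" "(1 - t) / K \<le> 1 - s" by (auto simp: Q_def)
        then have "t \<in> {1 - K * (1 - s)..s}" using CK(2) by (simp add: pos_divide_le_eq mult.commute)
        moreover have "1 / (1 - t) \<le> 1 / (1 - s)" using True s by (intro divide_left_mono) (auto simp: Q_def)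
        ultimately show ?thesis using True by (simp add: R_def ennreal_leI)
      qed (simp add: R_def)
    qed
    also have "\<dots> = ennreal (1 / (1 - s)) * ennreal (s - (1 - K * (1 - s)))"
      by (simp add: nn_integral_cmult emeasure_lborel_Icc[OF Ks])
    also have "\<dots> = ennreal (1 / (1 - s) * (s - (1 - K * (1 - s))))"
      using s Ks by (intro ennreal_mult[symmetric]) auto
    also have "1 / (1 - s) * (s - (1 - K * (1 - s))) = K - 1" using s by (simp add: field_simps)
    finally show ?thesis .
  qed
  show ?thesis
  proof (intro exI[of _ "C' * (K - 1)"] conjI allI impI)
    show "0 \<le> C' * (K - 1)" using C' CK by simp
    fix f assume f: "holo_on f (Bn :: (complex ^ 'n) set)"
    define F where "F w = ennreal (norm (f w) powr p) * indicator Bn w" for w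
    have [measurable]: "F \<in> borel_measurable borel"
      unfolding F_def[abs_def] using f by (rule measurable_holo_powr)
    define N where "N t = (\<integral>\<^sup>+z. indicator (ball 0 1) z * F ((t / norm z) *\<^sub>R z) \<partial>lborel)" for t
    have [measurable]: "ball (0 :: complex ^ 'n) 1 \<in> sets borel" by simp
    have [measurable]: "N \<in> borel_measurable borel" unfolding N_def[abs_def] by measurable
    have Nmono: "N t \<le> N s" if "0 \<le> t" "t \<le> s" "s < 1" for s t
      unfolding N_def F_def by (rule radial_mean_mono[OF f p that])
    have "(\<integral>\<^sup>+z. F z * ennreal (tail (norm z) / (1 - norm z)) \<partial>lborel) = (\<integral>\<^sup>+z. F z * h (norm z) \<partial>lborel)"
    proof (rule nn_integral_cong)
      fix z
      show "F z * ennreal (tail (norm z) / (1 - norm z)) = F z * h (norm z)"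
        by (cases "z \<in> Bn") (auto simp: F_def h_def ohat_eq Bn_iff simp flip: ennreal_mult)
    qed
    also have "\<dots> = (\<integral>\<^sup>+t. g t * h t * N t \<partial>lborel)"
      unfolding g_def N_def by (rule nn_integral_polar_weighted) measurable
    also have "\<dots> \<le> (\<integral>\<^sup>+t. (\<integral>\<^sup>+s. ennreal C' * (g s * N s * (ennreal (wt s) * R t s)) \<partial>lborel) \<partial>lborel)"
    proof (rule nn_integral_mono)
      fix t :: real
      show "g t * h t * N t \<le> (\<integral>\<^sup>+s. ennreal C' * (g s * N s * (ennreal (wt s) * R t s)) \<partial>lborel)"
      proof (cases "0 < t \<and> t < 1")
        case True
        have "g t * h t * N t = g t * N t * h t" by (simp add: mult_ac)
        also have "\<dots> \<le> g t * N t * (ennreal C' * (\<integral>\<^sup>+s. ennreal (wt s) * R t s \<partial>lborel))"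
          using True by (intro mult_left_mono hle) auto
        also have "\<dots> = (\<integral>\<^sup>+s. ennreal C' * (g t * N t * (ennreal (wt s) * R t s)) \<partial>lborel)"
          by (simp add: nn_integral_cmult mult_ac)
        also have "\<dots> \<le> (\<integral>\<^sup>+s. ennreal C' * (g s * N s * (ennreal (wt s) * R t s)) \<partial>lborel)"
        proof (rule nn_integral_mono)
          fix s :: real
          show "ennreal C' * (g t * N t * (ennreal (wt s) * R t s)) \<le> ennreal C' * (g s * N s * (ennreal (wt s) * R t s))"
          proof (cases "Q t s \<and> s < 1")
            case True
            then have ts: "0 < t" "t \<le> s" "s < 1" by (auto simp: Q_def)
            have "real ?d * t ^ (?d - 1) \<le> ?d * s ^ (?d - 1)"
              using ts by (intro mult_left_mono power_mono) auto
            then have "g t \<le> g s" unfolding g_def using ts by (auto intro!: ennreal_leI)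
            then show ?thesis using Nmono[of t s] ts by (intro mult_left_mono mult_right_mono mult_mono) auto
          next
            case False
            then have "ennreal (wt s) * R t s = 0" by (auto simp: R_def)
            then show ?thesis by (simp only: mult_zero_right order_refl)
          qed
        qed
        finally show ?thesis .
      next
        case False
        then have "g t * h t = 0" by (auto simp: g_def h_def split: split_indicator)
        then show ?thesis by (simp only: mult_zero_left zero_le)
      qed
    qed
    also have "\<dots> = (\<integral>\<^sup>+s. (\<integral>\<^sup>+t. ennreal C' * (g s * N s * (ennreal (wt s) * R t s)) \<partial>lborel) \<partial>lborel)"
      by (rule lborel_pair.Fubini') measurable
    also have "\<dots> \<le> (\<integral>\<^sup>+s. ennreal (C' * (K - 1)) * (g s * ennreal (wt s) * N s) \<partial>lborel)"
    proof (rule nn_integral_mono)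
      fix s :: real
      show "(\<integral>\<^sup>+t. ennreal C' * (g s * N s * (ennreal (wt s) * R t s)) \<partial>lborel) \<le> ennreal (C' * (K - 1)) * (g s * ennreal (wt s) * N s)"
      proof (cases "0 < s \<and> s < 1")
        case True
        have "(\<integral>\<^sup>+t. ennreal C' * (g s * N s * (ennreal (wt s) * R t s)) \<partial>lborel)
          = ennreal C' * (g s * N s * ennreal (wt s)) * (\<integral>\<^sup>+t. R t s \<partial>lborel)"
          by (subst nn_integral_cmult[symmetric]) (auto simp: mult_ac)
        also have "\<dots> \<le> ennreal C' * (g s * N s * ennreal (wt s)) * ennreal (K - 1)"
          using True by (intro mult_left_mono Rint) auto
        also have "\<dots> = ennreal (C' * (K - 1)) * (g s * ennreal (wt s) * N s)"
          using C' CK by (simp add: ennreal_mult mult_ac)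
        finally show ?thesis .
      next
        case False
        then have "g s = 0 \<or> wt s = 0" by (auto simp: g_def split: split_indicator)
        then show ?thesis by auto
      qed
    qed
    also have "\<dots> = ennreal (C' * (K - 1)) * (\<integral>\<^sup>+s. g s * ennreal (wt s) * N s \<partial>lborel)"
      by (rule nn_integral_cmult) measurable
    also have "(\<integral>\<^sup>+s. g s * ennreal (wt s) * N s \<partial>lborel) = (\<integral>\<^sup>+z. F z * ennreal (wt (norm z)) \<partial>lborel)"
      unfolding g_def N_def by (rule nn_integral_polar_weighted[symmetric]) measurable
    finally show "(\<integral>\<^sup>+z. ennreal (norm (f z) powr p) * indicator Bn z * ennreal (tail (norm z) / (1 - norm z)) \<partial>lborel)
      \<le> ennreal (C' * (K - 1)) * (\<integral>\<^sup>+z. ennreal (norm (f z) powr p) * indicator Bn z * ennreal (wt (norm z)) \<partial>lborel)"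
      unfolding F_def .
  qed
qed

end

section \<open>Tents and kernel estimates\<close>

lemma norm_herm_le_1: "norm x \<le> 1 \<Longrightarrow> norm y \<le> 1 \<Longrightarrow> norm (herm x y) \<le> 1"
  using norm_herm_le[of x y] mult_le_one[of "norm x" "norm y"] by simp

lemma herm_scaleR_left: "herm (r *\<^sub>R x) y = of_real r * herm x y"
proof -
  have "r *\<^sub>R x = of_real r *s x" by (simp add: vec_eq_iff scaleR_conv_of_real[where 'a=complex])
  then show ?thesis by (simp add: herm_scale_left)
qed

text \<open>Volume of a cone over a nonisotropic cap: the cone restricted to a shell of width \<open>\<eta>\<close> is
  contained in a tent, and the shell carries at least the fraction \<open>\<eta>\<close> of the cone.\<close>
lemma emeasure_cone_le:
  "\<exists>C>0. \<forall>a\<in>Bn. \<forall>\<eta>>0. emeasure lborel {z :: complex ^ 'n. z \<in> Bn \<and> norm (1 - herm ((1 / norm z) *\<^sub>R z) a) < 2 * \<eta>}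
     \<le> ennreal (C * \<eta> ^ CARD('n))"
proof -
  obtain C where C: "C > 0" "\<And>a \<eta>. a \<in> Bn \<Longrightarrow> \<eta> > 0 \<Longrightarrow>
     emeasure lborel {z :: complex ^ 'n. z \<in> Bn \<and> norm (1 - herm z a) < \<eta>} \<le> ennreal (C * \<eta> ^ (CARD('n) + 1))"
    using emeasure_tent_le by blast
  define m where "m = CARD('n)"
  \<comment> \<open>The first term serves \<open>\<eta> \<ge> 1\<close>. In the second, a cone of
    opening \<open>2 * \<eta>\<close> cut to a shell of width \<open>\<eta>\<close> lies in a tent
    of size \<open>3 * \<eta>\<close>.\<close>
  define C' where "C' = Bn_vol TYPE('n) + C * 3 ^ (m + 1)"
  let ?d = "DIM(complex ^ 'n)"
  show ?thesis
  proof (intro exI[of _ C'] conjI ballI allI impI)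
    show "C' > 0" using Bn_vol_pos[where 'n='n] C by (simp add: C'_def add_pos_pos)
    fix a :: "complex ^ 'n" and \<eta> :: real
    assume a: "a \<in> Bn" and eta: "\<eta> > 0"
    define A where "A = {z :: complex ^ 'n. z \<in> Bn \<and> norm (1 - herm ((1 / norm z) *\<^sub>R z) a) < 2 * \<eta>}"
    have [measurable]: "A \<in> sets borel" unfolding A_def by measurable
    have "emeasure lborel A \<le> ennreal (C' * \<eta> ^ m)"
    proof (cases "\<eta> \<ge> 1")
      case True
      have "emeasure lborel A \<le> emeasure lborel (Bn :: (complex ^ 'n) set)"
        by (intro emeasure_mono) (auto simp: A_def)
      also have "\<dots> \<le> ennreal (C' * \<eta> ^ m)" unfolding emeasure_Bn
      proof (rule ennreal_leI)
        have "Bn_vol TYPE('n) * 1 \<le> C' * \<eta> ^ m"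
          using True C Bn_vol_pos[where 'n='n] by (intro mult_mono one_le_power) (auto simp: C'_def)
        then show "Bn_vol TYPE('n) \<le> C' * \<eta> ^ m" by simp
      qed
      finally show ?thesis .
    next
      case False
      define S where "S = {z :: complex ^ 'n. z \<in> Bn \<and> norm (1 - herm z a) < 3 * \<eta>}"
      have [measurable]: "S \<in> sets borel" unfolding S_def by measurable
      define h :: "real \<Rightarrow> ennreal" where "h t = indicator {1 - \<eta><..<1} t" for t
      have [measurable]: "h \<in> borel_measurable borel" unfolding h_def[abs_def] by measurable
      have shell: "ennreal \<eta> \<le> (\<integral>\<^sup>+t. ennreal (?d * t ^ (?d - 1)) * indicator {1 - \<eta>..1} t \<partial>lborel)"
      proof -
        have "(\<integral>\<^sup>+t. ennreal (?d * t ^ (?d - 1)) * indicator {1 - \<eta>..1} t \<partial>lborel) = ennreal (1 ^ ?d - (1 - \<eta>) ^ ?d)"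
          using eta False by (intro nn_integral_FTC_Icc) (auto intro!: derivative_eq_intros)
        moreover have "(1 - \<eta>) ^ ?d \<le> (1 - \<eta>) ^ 1"
          using eta False DIM_positive[where 'a="complex ^ 'n"] by (intro power_decreasing) auto
        ultimately show ?thesis by (simp add: ennreal_leI)
      qed
      have "ennreal \<eta> * emeasure lborel A \<le> (\<integral>\<^sup>+t. ennreal (?d * t ^ (?d - 1)) * indicator {1 - \<eta>..1} t \<partial>lborel) * emeasure lborel A"
        by (intro mult_right_mono shell) auto
      also have "\<dots> = (\<integral>\<^sup>+t. ennreal (?d * t ^ (?d - 1)) * indicator {1 - \<eta>..1} t * emeasure lborel A \<partial>lborel)"
        by (rule nn_integral_multc[symmetric]) measurable
      also have "\<dots> = (\<integral>\<^sup>+t. ennreal (?d * t ^ (?d - 1)) * indicator {0<..} t * h t *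
          (\<integral>\<^sup>+z. indicator (ball 0 1) z * indicator A ((t / norm z) *\<^sub>R z) \<partial>lborel) \<partial>lborel)"
      proof (rule nn_integral_cong_AE)
        have ae: "AE t in lborel. t \<noteq> 1 \<and> t \<noteq> 1 - \<eta>"
          using AE_lborel_singleton[of 1] AE_lborel_singleton[of "1 - \<eta>"] by eventually_elim auto
        show "AE t in lborel. ennreal (?d * t ^ (?d - 1)) * indicator {1 - \<eta>..1} t * emeasure lborel A
          = ennreal (?d * t ^ (?d - 1)) * indicator {0<..} t * h t *
          (\<integral>\<^sup>+z. indicator (ball 0 1) z * indicator A ((t / norm z) *\<^sub>R z) \<partial>lborel)"
          using ae
        proof eventually_elim
          case (elim t)
          show ?case
          proof (cases "1 - \<eta> < t \<and> t < 1")
            case True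
            then have t: "t > 0" using False by linarith
            have "(\<integral>\<^sup>+z. indicator (ball 0 1) z * indicator A ((t / norm z) *\<^sub>R z) \<partial>lborel) = (\<integral>\<^sup>+z. indicator A z \<partial>lborel)"
            proof (rule nn_integral_cong)
              fix z :: "complex ^ 'n"
              show "indicator (ball 0 1) z * indicator A ((t / norm z) *\<^sub>R z) = (indicator A z :: ennreal)"
                using True t by (cases "z = 0") (auto simp: A_def Bn_iff split: split_indicator)
            qed
            then have "(\<integral>\<^sup>+z. indicator (ball 0 1) z * indicator A ((t / norm z) *\<^sub>R z) \<partial>lborel) = emeasure lborel A" by simp
            then show ?thesis using True t by (simp add: h_def)
          next
            case False
            then have "t \<notin> {1 - \<eta>..1}" using elim by auto
            then show ?thesis by (auto simp: h_def split: split_indicator)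
          qed
        qed
      qed
      also have "\<dots> = (\<integral>\<^sup>+z. indicator A z * h (norm z) \<partial>lborel)"
        by (rule nn_integral_polar_weighted[symmetric]) measurable
      also have "\<dots> \<le> (\<integral>\<^sup>+z. indicator S z \<partial>lborel)"
      proof (rule nn_integral_mono)
        fix z :: "complex ^ 'n"
        have "z \<in> S" if z: "z \<in> A" "1 - \<eta> < norm z"
        proof -
          have z1: "norm z < 1" using z by (simp add: A_def Bn_iff)
          have z0: "norm z > 0" using z(2) False by linarith
          let ?u = "(1 / norm z) *\<^sub>R z"
          have "z = norm z *\<^sub>R ?u" using z0 by simp
          then have "herm z a = of_real (norm z) * herm ?u a" by (metis herm_scaleR_left)
          then have "1 - herm z a = (1 - herm ?u a) + of_real (1 - norm z) * herm ?u a" by (simp add: algebra_simps)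
          then have "norm (1 - herm z a) \<le> norm (1 - herm ?u a) + norm (of_real (1 - norm z) * herm ?u a)"
            by (metis norm_triangle_ineq)
          moreover have "norm (of_real (1 - norm z) * herm ?u a) \<le> (1 - norm z) * 1"
            unfolding norm_mult norm_of_real using z1 z0 a
            by (intro mult_mono norm_herm_le_1) (auto simp: Bn_iff)
          then have "norm (of_real (1 - norm z) * herm ?u a) \<le> 1 - norm z" by (simp only: mult_1_right)
          moreover have "norm (1 - herm ?u a) < 2 * \<eta>" using z(1) by (simp add: A_def)
          moreover have "x < 3 * \<eta>" if "x \<le> y + w" "w \<le> 1 - n" "y < 2 * \<eta>" "1 - \<eta> < n" for x y w n :: real
            using that by linarith
          ultimately have "norm (1 - herm z a) < 3 * \<eta>" using z(2) by blast
          then show "z \<in> S" using z by (simp add: S_def A_def)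
        qed
        then show "indicator A z * h (norm z) \<le> indicator S z"
          by (auto simp: h_def split: split_indicator)
      qed
      also have "\<dots> = emeasure lborel S" by simp
      also have "\<dots> \<le> ennreal (C * (3 * \<eta>) ^ (m + 1))" unfolding S_def m_def using a eta by (intro C) auto
      also have "C * (3 * \<eta>) ^ (m + 1) = \<eta> * (C * 3 ^ (m + 1) * \<eta> ^ m)" by (simp add: power_mult_distrib)
      also have "ennreal \<dots> = ennreal \<eta> * ennreal (C * 3 ^ (m + 1) * \<eta> ^ m)" using eta C by (intro ennreal_mult) auto
      finally have "emeasure lborel A \<le> ennreal (C * 3 ^ (m + 1) * \<eta> ^ m)"
        using eta by (subst (asm) ennreal_mult_le_mult_iff) auto
      also have "\<dots> \<le> ennreal (C' * \<eta> ^ m)"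
        using eta Bn_vol_pos[where 'n='n] by (intro ennreal_leI mult_right_mono) (auto simp: C'_def)
      finally show ?thesis .
    qed
    then show "emeasure lborel {z :: complex ^ 'n. z \<in> Bn \<and> norm (1 - herm ((1 / norm z) *\<^sub>R z) a) < 2 * \<eta>}
     \<le> ennreal (C' * \<eta> ^ CARD('n))" unfolding A_def m_def .
  qed
qed

lemma dyadic_bracket:
  fixes x d :: real
  assumes "0 < d" "d \<le> x"
  obtains k :: nat where "2 ^ k * d \<le> x" "x < 2 ^ (k + 1) * d"
proof -
  have ex: "\<exists>k::nat. x < 2 ^ (k + 1) * d"
  proof -
    obtain k :: nat where "x / d < 2 ^ k" using real_arch_pow[of 2 "x / d"] by auto
    then have "x < 2 ^ k * d" using assms by (simp add: divide_less_eq)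
    also have "\<dots> \<le> 2 ^ (k + 1) * d" using assms by simp
    finally show ?thesis by blast
  qed
  define k where "k = (LEAST k::nat. x < 2 ^ (k + 1) * d)"
  have 1: "x < 2 ^ (k + 1) * d" unfolding k_def by (rule LeastI_ex[OF ex])
  have "2 ^ k * d \<le> x"
  proof (cases k)
    case (Suc j)
    then have "\<not> x < 2 ^ (j + 1) * d" unfolding k_def by (intro not_less_Least) simp
    then show ?thesis using Suc by simp
  qed (use assms in simp)
  with 1 show thesis by (rule that[rotated])
qed

context D_weight
begin

text \<open>Up to a constant, a bound for the weighted mass of a tent at \<open>a\<close> of size
  comparable to \<open>1 - norm a\<close>, by \<open>tent_weight_le\<close> and doubling; it
  therefore normalises the test functions.\<close>

definition W :: "complex ^ 'n \<Rightarrow> real" where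
  "W a = (1 - norm a) ^ CARD('n) * tail (norm a)"

lemma W_pos: "a \<in> Bn \<Longrightarrow> W a > 0"
  using tail_pos[of "norm a"] by (simp add: W_def Bn_iff)

text \<open>A point of the tent at radius \<open>t\<close> satisfies \<open>1 - t < \<eta>\<close>,
  and its direction lies in a cone of opening \<open>2 * \<eta>\<close>. In polar coordinates the
  two conditions separate into a cone volume of order \<open>\<eta> ^ n\<close> and the radial mass
  beyond \<open>1 - \<eta>\<close>. The \<open>max\<close> covers \<open>\<eta> > 1\<close>.\<close>

lemma tent_weight_le:
  "\<exists>C>0. \<forall>a\<in>Bn. \<forall>\<eta>>0. (\<integral>\<^sup>+z. indicator {z :: complex ^ 'n. z \<in> Bn \<and> norm (1 - herm z a) < \<eta>} z * ennreal (wt (norm z)) \<partial>lborel)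
     \<le> ennreal (C * \<eta> ^ CARD('n) * tail (max 0 (1 - \<eta>)))"
proof -
  obtain C where C: "C > 0" "\<And>a \<eta>. a \<in> Bn \<Longrightarrow> \<eta> > 0 \<Longrightarrow>
     emeasure lborel {z :: complex ^ 'n. z \<in> Bn \<and> norm (1 - herm ((1 / norm z) *\<^sub>R z) a) < 2 * \<eta>}
     \<le> ennreal (C * \<eta> ^ CARD('n))"
    using emeasure_cone_le by blast
  let ?d = "DIM(complex ^ 'n)"
  show ?thesis
  proof (intro exI[of _ "?d * C"] conjI ballI allI impI)
    show "?d * C > 0" using C DIM_positive[where 'a="complex ^ 'n"] by simp
    fix a :: "complex ^ 'n" and \<eta> :: real
    assume a: "a \<in> Bn" and eta: "\<eta> > 0"
    define A where "A = {z :: complex ^ 'n. z \<in> Bn \<and> norm (1 - herm ((1 / norm z) *\<^sub>R z) a) < 2 * \<eta>}"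
    have [measurable]: "A \<in> sets borel" unfolding A_def by measurable
    define S where "S = {z :: complex ^ 'n. z \<in> Bn \<and> norm (1 - herm z a) < \<eta>}"
    have [measurable]: "S \<in> sets borel" unfolding S_def by measurable
    let ?r = "max 0 (1 - \<eta>)"
    have "(\<integral>\<^sup>+z. indicator S z * ennreal (wt (norm z)) \<partial>lborel)
      = (\<integral>\<^sup>+t. ennreal (?d * t ^ (?d - 1)) * indicator {0<..} t * ennreal (wt t) *
          (\<integral>\<^sup>+z. indicator (ball 0 1) z * indicator S ((t / norm z) *\<^sub>R z) \<partial>lborel) \<partial>lborel)"
      by (rule nn_integral_polar_weighted) measurable
    also have "\<dots> \<le> (\<integral>\<^sup>+t. ennreal ?d * emeasure lborel A * (ennreal (wt t) * indicator {?r..} t) \<partial>lborel)"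
    proof (rule nn_integral_mono)
      fix t :: real
      let ?N = "\<integral>\<^sup>+z. indicator (ball 0 1) z * indicator S ((t / norm z) *\<^sub>R z) \<partial>lborel"
      show "ennreal (?d * t ^ (?d - 1)) * indicator {0<..} t * ennreal (wt t) * ?N
        \<le> ennreal ?d * emeasure lborel A * (ennreal (wt t) * indicator {?r..} t)"
      proof (cases "0 < t \<and> t < 1")
        case True
        have impl: "z \<in> A \<and> t \<ge> 1 - \<eta>" if z: "z \<in> ball 0 1" "(t / norm z) *\<^sub>R z \<in> S" "z \<noteq> 0" for z :: "complex ^ 'n"
        proof -
          let ?u = "(1 / norm z) *\<^sub>R z"
          have h: "herm ((t / norm z) *\<^sub>R z) a = of_real t * herm ?u a"
            by (simp add: herm_scaleR_left)
          have n: "norm ((t / norm z) *\<^sub>R z) = t" using z True by simp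
          have lt: "norm (1 - of_real t * herm ?u a) < \<eta>" using z(2) by (simp add: S_def h)
          have "1 - t \<le> norm (1 - of_real t * herm ?u a)"
            using norm_one_minus_herm_ge(2)[of "(t / norm z) *\<^sub>R z" a] True a n by (simp add: h Bn_iff)
          then have t: "1 - t < \<eta>" using lt by linarith
          have "1 - herm ?u a = (1 - of_real t * herm ?u a) - of_real (1 - t) * herm ?u a" by (simp add: algebra_simps)
          then have "norm (1 - herm ?u a) \<le> norm (1 - of_real t * herm ?u a) + norm (of_real (1 - t) * herm ?u a)"
            by (metis norm_triangle_ineq4)
          moreover have "norm (of_real (1 - t) * herm ?u a) \<le> (1 - t) * 1"
            unfolding norm_mult norm_of_real using True z a
            by (intro mult_mono norm_herm_le_1) (auto simp: Bn_iff)
          then have "norm (of_real (1 - t) * herm ?u a) \<le> 1 - t" by (simp only: mult_1_right)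
          moreover have "x < 2 * \<eta>" if "x \<le> y + w" "w \<le> 1 - t" "y < \<eta>" for x y w :: real
            using that t by linarith
          ultimately have "norm (1 - herm ?u a) < 2 * \<eta>" using lt by blast
          then show ?thesis using z t by (simp add: A_def Bn_iff)
        qed
        have "?N \<le> (\<integral>\<^sup>+z. indicator A z * indicator {?r..} t \<partial>lborel)"
        proof (rule nn_integral_mono_AE, rule AE_mp[OF AE_lborel_singleton[of "0 :: complex ^ 'n"]], intro AE_I2 impI)
          fix z :: "complex ^ 'n" assume "z \<noteq> 0"
          then show "indicator (ball 0 1) z * indicator S ((t / norm z) *\<^sub>R z) \<le> (indicator A z * indicator {?r..} t :: ennreal)"
            using impl[of z] True by (auto split: split_indicator)
        qed
        also have "\<dots> = emeasure lborel A * indicator {?r..} t" by (simp add: nn_integral_multc)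
        finally have N: "?N \<le> emeasure lborel A * indicator {?r..} t" .
        have "real ?d * t ^ (?d - 1) \<le> real ?d * 1"
          using True by (intro mult_left_mono power_le_one) auto
        then have "ennreal (?d * t ^ (?d - 1)) \<le> ennreal ?d" by (intro ennreal_leI) simp
        then have "ennreal (?d * t ^ (?d - 1)) * ennreal (wt t) * ?N \<le> ennreal ?d * ennreal (wt t) * (emeasure lborel A * indicator {?r..} t)"
          using N by (intro mult_mono) auto
        then show ?thesis using True by (simp add: mult_ac)
      qed (auto simp: not_less split: split_indicator)
    qed
    also have "\<dots> = ennreal ?d * emeasure lborel A * ohat ?r"
      unfolding ohat_def by (rule nn_integral_cmult) measurable
    also have "\<dots> \<le> ennreal ?d * ennreal (C * \<eta> ^ CARD('n)) * ohat ?r"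
      unfolding A_def using a eta by (intro mult_right_mono mult_left_mono C) auto
    also have "\<dots> = ennreal (?d * C * \<eta> ^ CARD('n) * tail ?r)"
      using C eta by (simp add: ohat_eq ennreal_mult mult.assoc)
    finally show "(\<integral>\<^sup>+z. indicator {z :: complex ^ 'n. z \<in> Bn \<and> norm (1 - herm z a) < \<eta>} z * ennreal (wt (norm z)) \<partial>lborel)
     \<le> ennreal (?d * C * \<eta> ^ CARD('n) * tail (max 0 (1 - \<eta>)))"
      unfolding S_def .
  qed
qed

text \<open>Cut the ball into shells where \<open>norm (1 - herm z a)\<close> is of order
  \<open>2 ^ k * d\<close> with \<open>d = 1 - norm a\<close>. By doubling, the tent around the
  \<open>k\<close>-th shell has mass at most a multiple of \<open>2 ^ (k * (n + M)) * W a\<close>,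
  while the kernel contributes at most \<open>1 / 2 ^ (k * N)\<close>. With
  \<open>N = n + M + 1\<close> a geometric series remains. The lower bound on \<open>W\<close> has
  exponent \<open>N - 1 = n + M\<close>, and this gap of one power is what later makes the test
  functions vanish at the boundary.\<close>

lemma kernel_integral_le:
  obtains N :: nat where "\<And>\<Gamma> :: real. \<Gamma> \<ge> real N \<Longrightarrow> \<exists>C>0. \<forall>a\<in>Bn.
    (\<integral>\<^sup>+z. ennreal (((1 - norm a) / norm (1 - herm z a)) powr \<Gamma>) * indicator Bn z * ennreal (wt (norm z)) \<partial>lborel) \<le> ennreal (C * W a)"
    "\<And>a. a \<in> Bn \<Longrightarrow> W a \<ge> ((1 - norm a) / 2) ^ (N - 1) * tail 0" "N \<ge> 1"
proof -
  obtain M where M: "\<And>k r s. 0 \<le> r \<Longrightarrow> r < 1 \<Longrightarrow> 0 \<le> s \<Longrightarrow> s < 1 \<Longrightarrow> 1 - r \<le> 2 ^ k * (1 - s) \<Longrightarrow> tail r \<le> 2 ^ (M * k) * tail s"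
    using tail_doubling by blast
  obtain C where C: "C > 0" "\<And>a \<eta>. a \<in> Bn \<Longrightarrow> \<eta> > 0 \<Longrightarrow>
     (\<integral>\<^sup>+z. indicator {z :: complex ^ 'n. z \<in> Bn \<and> norm (1 - herm z a) < \<eta>} z * ennreal (wt (norm z)) \<partial>lborel)
     \<le> ennreal (C * \<eta> ^ CARD('n) * tail (max 0 (1 - \<eta>)))"
    using tent_weight_le by blast
  define m where "m = CARD('n)"
  define N where "N = m + M + 1"
  show thesis
  proof (rule that[of N])
    fix \<Gamma> :: real assume G: "\<Gamma> \<ge> real N"
    show "\<exists>C>0. \<forall>a\<in>Bn. (\<integral>\<^sup>+z. ennreal (((1 - norm a) / norm (1 - herm z a)) powr \<Gamma>) * indicator (Bn :: (complex ^ 'n) set) z * ennreal (wt (norm z)) \<partial>lborel) \<le> ennreal (C * W a)"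
    proof (intro exI[of _ "C * 2 ^ (m + M) * 2"] conjI ballI)
      show "C * 2 ^ (m + M) * 2 > 0" using C by simp
      fix a :: "complex ^ 'n" assume a: "a \<in> Bn"
      define d where "d = 1 - norm a"
      have d: "0 < d" "d \<le> 1" using a by (auto simp: d_def Bn_iff)
      define S where "S k = {z :: complex ^ 'n. z \<in> Bn \<and> norm (1 - herm z a) < 2 ^ (k + 1) * d}" for k :: nat
      have [measurable]: "S k \<in> sets borel" for k unfolding S_def by measurable
      have "(\<integral>\<^sup>+z. ennreal ((d / norm (1 - herm z a)) powr \<Gamma>) * indicator Bn z * ennreal (wt (norm z)) \<partial>lborel)
        \<le> (\<integral>\<^sup>+z. (\<Sum>k. ennreal ((1 / 2 ^ k) ^ N) * (indicator (S k) z * ennreal (wt (norm z)))) \<partial>lborel)"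
      proof (rule nn_integral_mono)
        fix z :: "complex ^ 'n"
        show "ennreal ((d / norm (1 - herm z a)) powr \<Gamma>) * indicator Bn z * ennreal (wt (norm z))
          \<le> (\<Sum>k. ennreal ((1 / 2 ^ k) ^ N) * (indicator (S k) z * ennreal (wt (norm z))))"
        proof (cases "z \<in> Bn")
          case True
          let ?x = "norm (1 - herm z a)"
          have x: "d \<le> ?x" using True a norm_one_minus_herm_ge(1)[of z a] by (simp add: d_def Bn_iff)
          obtain k where k: "2 ^ k * d \<le> ?x" "?x < 2 ^ (k + 1) * d" using dyadic_bracket[OF d(1) x] .
          have "?x > 0" using x d by linarith
          then have q: "0 < d / ?x" "d / ?x \<le> 1" using d x by (auto simp: divide_le_eq_1)
          have "(d / ?x) powr \<Gamma> \<le> (d / ?x) powr (real N)" using q G by (intro powr_mono') auto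
          also have "\<dots> = (d / ?x) ^ N" using q by (simp add: powr_realpow)
          also have "\<dots> \<le> (1 / 2 ^ k) ^ N"
            using q k(1) \<open>?x > 0\<close> by (intro power_mono) (auto simp: field_simps)
          finally have "(d / ?x) powr \<Gamma> \<le> (1 / 2 ^ k) ^ N" .
          moreover have "z \<in> S k" using True k(2) by (simp add: S_def)
          ultimately have "ennreal ((d / ?x) powr \<Gamma>) * indicator Bn z * ennreal (wt (norm z))
            \<le> ennreal ((1 / 2 ^ k) ^ N) * (indicator (S k) z * ennreal (wt (norm z)))"
            using True by (auto intro!: mult_right_mono ennreal_leI)
          also have "\<dots> = (\<Sum>j\<in>{k}. ennreal ((1 / 2 ^ j) ^ N) * (indicator (S j) z * ennreal (wt (norm z))))" by simp
          also have "\<dots> \<le> (\<Sum>j. ennreal ((1 / 2 ^ j) ^ N) * (indicator (S j) z * ennreal (wt (norm z))))"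
            by (intro sum_le_suminf) auto
          finally show ?thesis .
        qed simp
      qed
      also have "\<dots> = (\<Sum>k. \<integral>\<^sup>+z. ennreal ((1 / 2 ^ k) ^ N) * (indicator (S k) z * ennreal (wt (norm z))) \<partial>lborel)"
        by (rule nn_integral_suminf) measurable
      also have "\<dots> \<le> (\<Sum>k. ennreal (C * 2 ^ (m + M) * W a * (1/2) ^ k))"
      proof (intro suminf_le)
        fix k :: nat
        let ?e = "2 ^ (k + 1) * d"
        have e: "?e > 0" using d by simp
        have r: "0 \<le> max 0 (1 - ?e)" "max 0 (1 - ?e) < 1" using e by auto
        have t: "tail (max 0 (1 - ?e)) \<le> 2 ^ (M * (k + 1)) * tail (norm a)"
        proof (rule M[OF r])
          show "1 - max 0 (1 - ?e) \<le> 2 ^ (k + 1) * (1 - norm a)" unfolding d_def[symmetric] by simp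
        qed (use a in \<open>auto simp: Bn_iff\<close>)
        have "(\<integral>\<^sup>+z. ennreal ((1 / 2 ^ k) ^ N) * (indicator (S k) z * ennreal (wt (norm z))) \<partial>lborel)
          = ennreal ((1 / 2 ^ k) ^ N) * (\<integral>\<^sup>+z. indicator (S k) z * ennreal (wt (norm z)) \<partial>lborel)"
          by (rule nn_integral_cmult) measurable
        also have "\<dots> \<le> ennreal ((1 / 2 ^ k) ^ N) * ennreal (C * ?e ^ m * tail (max 0 (1 - ?e)))"
          unfolding S_def m_def using a e by (intro mult_left_mono C) auto
        also have "\<dots> = ennreal ((1 / 2 ^ k) ^ N * (C * ?e ^ m * tail (max 0 (1 - ?e))))"
          using C e by (intro ennreal_mult[symmetric]) auto
        also have "\<dots> \<le> ennreal ((1 / 2 ^ k) ^ N * (C * ?e ^ m * (2 ^ (M * (k + 1)) * tail (norm a))))"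
          using C e by (intro ennreal_leI mult_left_mono t) auto
        also have "(1 / 2 ^ k) ^ N * (C * ?e ^ m * (2 ^ (M * (k + 1)) * tail (norm a))) = C * 2 ^ (m + M) * W a * (1/2) ^ k"
        proof -
          have p: "((2::real) * 2 ^ k) ^ m = 2 ^ m * (2 ^ k) ^ m" "(2::real) ^ (M * (k + 1)) = 2 ^ M * (2 ^ k) ^ M"
            "(1 / 2 ^ k) ^ N = (1/2) ^ k / ((2::real) ^ k) ^ (m + M)" for k :: nat
            by (simp_all add: power_mult_distrib power_add power_mult[symmetric] mult.commute N_def power_one_over field_simps)
          show ?thesis unfolding p W_def d_def[symmetric] m_def[symmetric] power_mult_distrib
            by (simp add: power_add power_mult_distrib)
        qed
        finally show "(\<integral>\<^sup>+z. ennreal ((1 / 2 ^ k) ^ N) * (indicator (S k) z * ennreal (wt (norm z))) \<partial>lborel) \<le> ennreal (C * 2 ^ (m + M) * W a * (1/2) ^ k)" .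
      qed auto
      also have "\<dots> = ennreal (C * 2 ^ (m + M) * 2 * W a)"
      proof (rule suminf_ennreal_eq)
        show "0 \<le> C * 2 ^ (m + M) * W a * (1/2) ^ k" for k using C W_pos[OF a] by simp
        show "(\<lambda>k. C * 2 ^ (m + M) * W a * (1/2) ^ k) sums (C * 2 ^ (m + M) * 2 * W a)"
          using sums_mult[OF geometric_sums[of "1/2 :: real"], of "C * 2 ^ (m + M) * W a"] by (simp add: mult_ac)
      qed
      finally show "(\<integral>\<^sup>+z. ennreal (((1 - norm a) / norm (1 - herm z a)) powr \<Gamma>) * indicator Bn z * ennreal (wt (norm z)) \<partial>lborel) \<le> ennreal (C * 2 ^ (m + M) * 2 * W a)"
        unfolding d_def .
    qed
  next
    fix a :: "complex ^ 'n" assume "a \<in> Bn"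
    then have a: "norm a < 1" by (simp add: Bn_iff)
    define d where "d = 1 - norm a"
    have d: "0 < d" "d \<le> 1" using a by (auto simp: d_def)
    obtain k where k: "2 ^ k * d \<le> 1" "1 < 2 ^ (k + 1) * d" using dyadic_bracket[OF d] .
    have "tail 0 \<le> 2 ^ (M * (k + 1)) * tail (norm a)"
      using k a by (intro M) (auto simp: d_def)
    also have "(2::real) ^ (M * (k + 1)) = (2 ^ (k + 1)) ^ M" by (subst mult.commute) (rule power_mult)
    also have "(2 ^ (k + 1)) ^ M * tail (norm a) \<le> (2 / d) ^ M * tail (norm a)"
      using k(1) d by (intro mult_right_mono power_mono) (auto simp: field_simps)
    finally have "tail 0 \<le> (2 / d) ^ M * tail (norm a)" .
    then have "(d / 2) ^ M * tail 0 \<le> (d / 2) ^ M * ((2 / d) ^ M * tail (norm a))" using d by (intro mult_left_mono) auto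
    also have "\<dots> = tail (norm a)" using d by (simp add: mult.assoc[symmetric] power_mult_distrib[symmetric])
    finally have t: "(d / 2) ^ M * tail 0 \<le> tail (norm a)" .
    have "(d / 2) ^ (N - 1) * tail 0 = (d / 2) ^ m * ((d / 2) ^ M * tail 0)" by (simp add: N_def power_add)
    also have "\<dots> \<le> d ^ m * tail (norm a)" using d t by (intro mult_mono power_mono) auto
    finally show "W a \<ge> ((1 - norm a) / 2) ^ (N - 1) * tail 0" by (simp add: W_def d_def m_def)
  qed (simp add: N_def)
qed

end

section \<open>Carleson embedding\<close>

text \<open>\<open>4 / (1 - (3/4)^2) = 64/7\<close> is rounded up to \<open>2 ^ 4\<close>, so that
  \<open>tail_doubling\<close> applies with \<open>k = 4\<close>.\<close>

lemma pball_norm_comparable: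
  fixes z w :: "complex ^ 'n"
  assumes "w \<in> pball z (3/4)"
  shows "1 - norm w \<le> 2 ^ 4 * (1 - norm z)" "1 - norm z \<le> 2 ^ 4 * (1 - norm w)"
proof -
  have n: "norm z < 1" "norm w < 1" using assms by (auto simp: pball_def)
  have 1: "pseudo_hyp z w < 3/4" using assms n by (simp add: pball_iff)
  then have 2: "pseudo_hyp w z < 3/4" using pseudo_hyp_commute[OF n] by simp
  have "4 / (1 - (3/4)\<^sup>2) \<le> (2::real) ^ 4" by (simp add: power2_eq_square)
  then have *: "4 / (1 - (3/4)\<^sup>2) * (1 - norm x) \<le> 2 ^ 4 * (1 - norm x)" if "norm x < 1" for x :: "complex ^ 'n"
    using that by (intro mult_right_mono) auto
  show "1 - norm w \<le> 2 ^ 4 * (1 - norm z)" "1 - norm z \<le> 2 ^ 4 * (1 - norm w)"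
    using order_trans[OF pseudo_hyp_ball_comparable[OF n(2,1) 2] *[OF n(1)]]
      order_trans[OF pseudo_hyp_ball_comparable[OF n 1] *[OF n(2)]] by auto
qed

context D_weight
begin

lemma tail_measurable [measurable]: "tail \<in> borel_measurable borel"
  unfolding tail_def[abs_def] by measurable

lemma W_measurable [measurable]: "W \<in> borel_measurable borel"
  unfolding W_def[abs_def] by measurable

text \<open>The \<open>p\<close>-th power of the norm without the factor \<open>1 / Bn_vol\<close>
  and without \<open>enn2real\<close>, so that finiteness stays visible.\<close>

definition J :: "real \<Rightarrow> (complex ^ 'n \<Rightarrow> complex) \<Rightarrow> ennreal" where
  "J p f = (\<integral>\<^sup>+z. ennreal (norm (f z) powr p) * indicator Bn z * ennreal (wt (norm z)) \<partial>lborel)"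

lemma nn_integral_Apw:
  assumes "holo_on f (Bn :: (complex ^ 'n) set)"
  shows "(\<integral>\<^sup>+z. ennreal (norm (f z) powr p * \<omega> (norm z)) \<partial>dV) = ennreal (1 / Bn_vol TYPE('n)) * J p f"
proof -
  have eq: "(\<lambda>z. ennreal (norm (f z) powr p * \<omega> (norm z)) * indicator Bn z)
     = (\<lambda>z. ennreal (norm (f z) powr p) * indicator Bn z * ennreal (wt (norm z)))"
    using wt_nonneg by (auto simp: wt_norm ennreal_mult split: split_indicator)
  have "(\<integral>\<^sup>+z. ennreal (norm (f z) powr p * \<omega> (norm z)) \<partial>dV) = inverse (ennreal (Bn_vol TYPE('n))) * J p f"
    unfolding J_def eq[symmetric] emeasure_Bn[symmetric]
    by (rule nn_integral_dV) (unfold eq, use measurable_holo_powr[OF assms] in measurable)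
  then show ?thesis using Bn_vol_pos[where 'n='n] by (simp add: inverse_ennreal inverse_eq_divide)
qed

lemma Apw_iff: "f \<in> Apw p \<omega> \<longleftrightarrow> holo_on f (Bn :: (complex ^ 'n) set) \<and> J p f < \<infinity>"
  using Bn_vol_pos[where 'n='n]
  by (auto simp: Apw_def nn_integral_Apw ennreal_mult_less_top ennreal_eq_0_iff)

lemma Apw_normp_eq:
  assumes "holo_on f (Bn :: (complex ^ 'n) set)"
  shows "Apw_normp p \<omega> f = enn2real (J p f) / Bn_vol TYPE('n)"
  using Bn_vol_pos[where 'n='n] by (simp add: Apw_normp_def nn_integral_Apw[OF assms] enn2real_mult)

lemma W_comparable:
  "\<exists>c>0. \<forall>z w. w \<in> pball z (3/4) \<longrightarrow> W z \<ge> c * W w \<and>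
      tail (norm z) / (1 - norm z) * c \<le> tail (norm w) / (1 - norm w)"
proof -
  obtain M where M: "\<And>k r s. 0 \<le> r \<Longrightarrow> r < 1 \<Longrightarrow> 0 \<le> s \<Longrightarrow> s < 1 \<Longrightarrow> 1 - r \<le> 2 ^ k * (1 - s) \<Longrightarrow> tail r \<le> 2 ^ (M * k) * tail s"
    using tail_doubling by blast
  define m where "m = CARD('n)"
  define A where "A = (2::real) ^ (M * 4)"
  have A: "A > 0" by (simp add: A_def)
  \<comment> \<open>\<open>A\<close> is the loss of the tail over four halvings. In
    \<open>W\<close>, \<open>16 ^ m\<close> pays for the power of the distance to the boundary; in
    the smooth weight a single 16 pays for the division by that distance.\<close>
  define c where "c = 1 / (16 ^ (m + 1) * A)"
  have c: "c > 0" using A by (simp add: c_def)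
  show ?thesis
  proof (intro exI[of _ c] conjI c allI impI)
    fix z w :: "complex ^ 'n" assume zw: "w \<in> pball z (3/4)"
    then have n: "norm z < 1" "norm w < 1" by (auto simp: pball_def)
    define x y where "x = 1 - norm z" and "y = 1 - norm w"
    have xy: "0 < x" "0 < y" "y \<le> 16 * x" "x \<le> 16 * y"
      using n pball_norm_comparable[OF zw] by (auto simp: x_def y_def)
    have t1: "tail (norm w) \<le> A * tail (norm z)" and t2: "tail (norm z) \<le> A * tail (norm w)"
      unfolding A_def using n pball_norm_comparable[OF zw] by (auto intro!: M)
    have "c * W w = c * (y ^ m * tail (norm w))" by (simp add: W_def y_def m_def)
    also have "\<dots> \<le> c * ((16 * x) ^ m * (A * tail (norm z)))"
      using c xy t1 by (intro mult_left_mono mult_mono power_mono) auto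
    also have "\<dots> = x ^ m * tail (norm z) / 16" using A by (simp add: c_def power_mult_distrib)
    also have "\<dots> = W z / 16" by (simp add: W_def x_def m_def)
    also have "\<dots> \<le> W z" using W_pos[of z] n by (simp add: Bn_iff)
    finally show "W z \<ge> c * W w" .
    have "tail (norm z) / x * c \<le> (A * tail (norm w)) / (y / 16) * c"
      using c xy t2 A by (intro mult_right_mono frac_le) auto
    also have "\<dots> = tail (norm w) / y * (1 / 16 ^ m)"
      using A xy by (simp add: c_def field_simps)
    also have "\<dots> \<le> tail (norm w) / y * 1" using xy by (intro mult_left_mono) auto
    finally show "tail (norm z) / (1 - norm z) * c \<le> tail (norm w) / (1 - norm w)"
      unfolding x_def y_def by simp
  qed
qed

text \<open>Multiply the sub-mean value inequality by \<open>tail (norm z) / (1 - norm z)\<close>: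
  the factor \<open>(1 - norm z) ^ (n + 1)\<close> on the left becomes \<open>W z\<close>, and on
  the right the multiplier moves under the integral because it is comparable throughout the
  ball.\<close>

lemma holo_pointwise_le:
  assumes p: "p > 0"
  shows "\<exists>K>0. \<forall>f. \<forall>z\<in>Bn. holo_on f Bn \<longrightarrow> ennreal (W z * norm (f z) powr p) \<le> ennreal K *
    (\<integral>\<^sup>+w. ennreal (norm (f w) powr p) * indicator Bn w * ennreal (tail (norm w) / (1 - norm w)) * indicator (pball z (3/4)) w \<partial>lborel)"
proof -
  from W_comparable obtain c where c0: "c > 0" and cc: "\<forall>z w. w \<in> pball z (3/4) \<longrightarrow> W z \<ge> c * W w \<and>
      tail (norm z) / (1 - norm z) * c \<le> tail (norm w) / (1 - norm w)" by (elim exE conjE)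
  note c = c0 cc[rule_format, THEN conjunct2]
  obtain b where b: "b > 0" "\<And>f z. z \<in> Bn \<Longrightarrow> holo_on f (Bn :: (complex ^ 'n) set) \<Longrightarrow>
    ennreal (b * (1 - norm z) ^ (CARD('n) + 1)) * ennreal (norm (f z) powr p)
     \<le> (\<integral>\<^sup>+w. ennreal (norm (f w) powr p) * indicator Bn w * indicator (pball z (3/4)) w \<partial>lborel)"
    using holo_sub_mean_value[OF p] by blast
  show ?thesis
  proof (intro exI[of _ "1 / (b * c)"] conjI allI ballI impI)
    show "1 / (b * c) > 0" using b c by simp
    fix f :: "complex ^ 'n \<Rightarrow> complex" and z :: "complex ^ 'n" assume z: "z \<in> Bn" and f: "holo_on f Bn"
    have zn: "norm z < 1" using z by (simp add: Bn_iff)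
    define F :: "complex ^ 'n \<Rightarrow> ennreal" where "F w = ennreal (norm (f w) powr p) * indicator Bn w" for w
    have [measurable]: "F \<in> borel_measurable borel"
      unfolding F_def[abs_def] using f by (rule measurable_holo_powr)
    let ?k = "tail (norm z) / (1 - norm z) * c"
    have k: "?k \<ge> 0" using zn c(1) by simp
    have eq: "W z * norm (f z) powr p = 1 / (b * c) * (?k * (b * (1 - norm z) ^ (CARD('n) + 1) * norm (f z) powr p))"
      using b c zn by (simp add: W_def field_simps)
    have "ennreal (W z * norm (f z) powr p) = ennreal (1 / (b * c)) * (ennreal ?k * (ennreal (b * (1 - norm z) ^ (CARD('n) + 1)) * ennreal (norm (f z) powr p)))"
      unfolding eq using b c k zn by (subst ennreal_mult, simp, simp, subst ennreal_mult, simp, simp, subst ennreal_mult) auto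
    also have "\<dots> \<le> ennreal (1 / (b * c)) * (ennreal ?k * (\<integral>\<^sup>+w. F w * indicator (pball z (3/4)) w \<partial>lborel))"
      unfolding F_def using z f by (intro mult_left_mono b) auto
    also have "ennreal ?k * (\<integral>\<^sup>+w. F w * indicator (pball z (3/4)) w \<partial>lborel) = (\<integral>\<^sup>+w. ennreal ?k * (F w * indicator (pball z (3/4)) w) \<partial>lborel)"
      by (rule nn_integral_cmult[symmetric]) measurable
    also have "\<dots> \<le> (\<integral>\<^sup>+w. F w * ennreal (tail (norm w) / (1 - norm w)) * indicator (pball z (3/4)) w \<partial>lborel)"
    proof (rule nn_integral_mono)
      fix w
      show "ennreal ?k * (F w * indicator (pball z (3/4)) w) \<le> F w * ennreal (tail (norm w) / (1 - norm w)) * indicator (pball z (3/4)) w"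
        using mult_left_mono[OF ennreal_leI[OF c(2)[of w z]], of "F w"]
        by (cases "w \<in> pball z (3/4)") (auto simp: mult_ac)
    qed
    finally show "ennreal (W z * norm (f z) powr p) \<le> ennreal (1 / (b * c)) *
     (\<integral>\<^sup>+w. ennreal (norm (f w) powr p) * indicator Bn w * ennreal (tail (norm w) / (1 - norm w)) * indicator (pball z (3/4)) w \<partial>lborel)"
      unfolding F_def by (simp add: mult_left_mono)
  qed
qed

text \<open>Raise the pointwise bound to the power \<open>t = q / p \<ge> 1\<close>. One factor of
  the local integral \<open>E z\<close> is kept for Tonelli, and its power \<open>t - 1\<close> is
  bounded by that of the total integral \<open>j\<close>. After the exchange, the inner integral
  over the ball about \<open>w\<close> is controlled by the hypothesis and the comparability of
  \<open>W\<close>. The constant is uniform in \<open>\<nu>\<close>, \<open>M\<close> and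
  \<open>f\<close>, so the estimate can later be applied to a measure cut down near the
  boundary.\<close>

lemma carleson_embedding:
  assumes p: "p > 0" and pq: "p \<le> q"
  shows "\<exists>C\<ge>0. \<forall>\<nu> M f. sets \<nu> = sets borel \<longrightarrow> sigma_finite_measure \<nu> \<longrightarrow> M \<ge> 0 \<longrightarrow>
    (\<forall>a\<in>Bn. emeasure \<nu> (pball a (3/4)) \<le> ennreal (M * W a powr (q / p))) \<longrightarrow>
    holo_on f Bn \<longrightarrow> J p f < \<infinity> \<longrightarrow>
    (\<integral>\<^sup>+z. ennreal (norm (f z) powr q) * indicator Bn z \<partial>\<nu>) \<le> ennreal (C * M * enn2real (J p f) powr (q / p))"
proof -
  define t where "t = q / p"
  have t: "t \<ge> 1" using p pq by (simp add: t_def)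
  from W_comparable obtain c where c0: "c > 0" and cc: "\<forall>z w. w \<in> pball z (3/4) \<longrightarrow> W z \<ge> c * W w \<and>
      tail (norm z) / (1 - norm z) * c \<le> tail (norm w) / (1 - norm w)" by (elim exE conjE)
  note c = c0 cc[rule_format, THEN conjunct1]
  obtain K where K: "K > 0" "\<And>f z. z \<in> Bn \<Longrightarrow> holo_on f Bn \<Longrightarrow> ennreal (W z * norm (f z) powr p) \<le> ennreal K *
    (\<integral>\<^sup>+w. ennreal (norm (f w) powr p) * indicator Bn w * ennreal (tail (norm w) / (1 - norm w)) * indicator (pball z (3/4)) w \<partial>lborel)"
    using holo_pointwise_le[OF p] by blast
  obtain C1 where C1: "C1 \<ge> 0" "\<And>f. holo_on f (Bn :: (complex ^ 'n) set) \<Longrightarrow>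
    (\<integral>\<^sup>+z. ennreal (norm (f z) powr p) * indicator Bn z * ennreal (tail (norm z) / (1 - norm z)) \<partial>lborel) \<le> ennreal C1 * J p f"
    using holo_integral_smooth_weight[OF p] unfolding J_def by blast
  define C where "C = K powr t * (1 / c) powr t * C1 powr t"
  show ?thesis
  proof (intro exI[of _ C] conjI allI impI)
    show "C \<ge> 0" by (simp add: C_def)
    fix \<nu> :: "(complex ^ 'n) measure" and M :: real and f
    assume sets[measurable_cong]: "sets \<nu> = sets borel" and "sigma_finite_measure \<nu>" and M: "M \<ge> 0"
      and nu: "\<forall>a\<in>Bn. emeasure \<nu> (pball a (3/4)) \<le> ennreal (M * W a powr (q / p))"
      and f: "holo_on f Bn" and fin: "J p f < \<infinity>"
    interpret \<nu>: sigma_finite_measure \<nu> by fact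
    interpret P: pair_sigma_finite \<nu> lborel ..
    define F :: "complex ^ 'n \<Rightarrow> ennreal" where "F w = ennreal (norm (f w) powr p) * indicator Bn w * ennreal (tail (norm w) / (1 - norm w))" for w
    have [measurable]: "F \<in> borel_measurable borel"
      unfolding F_def[abs_def] using measurable_holo_powr[OF f] by measurable
    define E where "E z = (\<integral>\<^sup>+w. F w * indicator (pball z (3/4)) w \<partial>lborel)" for z
    have [measurable]: "E \<in> borel_measurable borel" unfolding E_def[abs_def] by measurable
    define j where "j = enn2real (\<integral>\<^sup>+w. F w \<partial>lborel)"
    have "(\<integral>\<^sup>+w. F w \<partial>lborel) \<le> ennreal C1 * J p f" unfolding F_def by (rule C1(2)[OF f])
    also have "\<dots> = ennreal (C1 * enn2real (J p f))" using C1(1) fin by (simp add: ennreal_mult)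
    finally have Fle: "(\<integral>\<^sup>+w. F w \<partial>lborel) \<le> ennreal (C1 * enn2real (J p f))" .
    then have Fj: "(\<integral>\<^sup>+w. F w \<partial>lborel) = ennreal j" unfolding j_def
      by (simp add: le_less_trans[OF _ ennreal_less_top])
    have j: "j \<ge> 0" "j \<le> C1 * enn2real (J p f)" using Fle C1(1) unfolding Fj by (auto simp: j_def)
    have EF: "E z \<le> ennreal j" for z
      unfolding E_def Fj[symmetric] by (rule nn_integral_mono) (auto split: split_indicator)
    define D where "D = K powr t * j powr (t - 1)"
    have D0: "D \<ge> 0" by (simp add: D_def)
    have pw: "ennreal (norm (f z) powr q) * indicator Bn z \<le> ennreal D * (ennreal (1 / W z powr t) * indicator Bn z * E z)" for z
    proof (cases "z \<in> Bn")
      case True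
      define e where "e = enn2real (E z)"
      have e: "E z = ennreal e" "e \<ge> 0" "e \<le> j"
      proof -
        have "E z < top" using EF[of z] by (rule le_less_trans) simp
        then show 1: "E z = ennreal e" by (simp add: e_def)
        show "e \<ge> 0" by (simp add: e_def)
        then show "e \<le> j" using EF[of z] j unfolding 1 by simp
      qed
      note W = W_pos[OF True]
      have "ennreal (W z * norm (f z) powr p) \<le> ennreal (K * e)"
        using K(2)[OF True f] K(1) e by (simp add: E_def F_def ennreal_mult)
      then have "W z * norm (f z) powr p \<le> K * e" using K(1) e by simp
      then have le: "norm (f z) powr p \<le> K * e / W z" using W by (simp add: field_simps)
      have "norm (f z) powr q = (norm (f z) powr p) powr t" using p by (simp add: powr_powr t_def)
      also have "\<dots> \<le> (K * e / W z) powr t" using le t by (intro powr_mono2) auto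
      also have "\<dots> = K powr t * e powr t / W z powr t" using K(1) e W by (simp add: powr_divide powr_mult)
      also have "e powr t = e powr (t - 1) * e"
        using e by (cases "e = 0") (auto simp: powr_diff)
      also have "K powr t * (e powr (t - 1) * e) / W z powr t \<le> K powr t * (j powr (t - 1) * e) / W z powr t"
        using e t by (intro divide_right_mono mult_left_mono mult_right_mono powr_mono2) auto
      also have "\<dots> = D * (1 / W z powr t * e)" by (simp add: D_def)
      finally have "ennreal (norm (f z) powr q) \<le> ennreal (D * (1 / W z powr t * e))" by (rule ennreal_leI)
      also have "\<dots> = ennreal D * (ennreal (1 / W z powr t) * ennreal e)"
        using D0 e by (subst ennreal_mult, simp, simp, subst ennreal_mult) auto
      finally show ?thesis using True e by simp
    qed simp
    have inner: "(\<integral>\<^sup>+z. ennreal (1 / W z powr t) * indicator Bn z * indicator (pball z (3/4)) w \<partial>\<nu>) \<le> ennreal ((1 / c) powr t * M)"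
      if w: "w \<in> Bn" for w
    proof -
      have "(\<integral>\<^sup>+z. ennreal (1 / W z powr t) * indicator Bn z * indicator (pball z (3/4)) w \<partial>\<nu>)
        \<le> (\<integral>\<^sup>+z. ennreal ((1 / (c * W w)) powr t) * indicator (pball w (3/4)) z \<partial>\<nu>)"
      proof (rule nn_integral_mono)
        fix z
        show "ennreal (1 / W z powr t) * indicator Bn z * indicator (pball z (3/4)) w \<le> ennreal ((1 / (c * W w)) powr t) * indicator (pball w (3/4)) z"
        proof (cases "w \<in> pball z (3/4)")
          case True
          then have z: "z \<in> pball w (3/4)" by (simp add: pball_sym)
          then have "z \<in> Bn" using pball_subset_Bn by blast
          have cw: "0 < c * W w" using c(1) W_pos[OF w] by simp
          have "1 / W z powr t = (1 / W z) powr t" using W_pos[OF \<open>z \<in> Bn\<close>] by (simp add: powr_divide)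
          also have "\<dots> \<le> (1 / (c * W w)) powr t"
            using c(2)[OF True] cw t by (intro powr_mono2 divide_left_mono) (auto simp: W_pos[OF \<open>z \<in> Bn\<close>] less_imp_le intro!: mult_pos_pos)
          finally show ?thesis using z True \<open>z \<in> Bn\<close> by (simp add: ennreal_leI)
        qed simp
      qed
      also have "\<dots> = ennreal ((1 / (c * W w)) powr t) * emeasure \<nu> (pball w (3/4))"
        by (rule nn_integral_cmult_indicator) (simp add: sets)
      also have "\<dots> \<le> ennreal ((1 / (c * W w)) powr t) * ennreal (M * W w powr t)"
        using nu w by (intro mult_left_mono) (auto simp: t_def)
      also have "\<dots> = ennreal ((1 / (c * W w)) powr t * (M * W w powr t))"
        using M by (intro ennreal_mult[symmetric]) auto
      also have "(1 / (c * W w)) powr t * (M * W w powr t) = (1 / c) powr t * M"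
        using c(1) W_pos[OF w] by (simp add: powr_divide powr_mult)
      finally show ?thesis .
    qed
    have "(\<integral>\<^sup>+z. ennreal (norm (f z) powr q) * indicator Bn z \<partial>\<nu>)
      \<le> (\<integral>\<^sup>+z. ennreal D * (ennreal (1 / W z powr t) * indicator Bn z * E z) \<partial>\<nu>)"
      by (rule nn_integral_mono) (rule pw)
    also have "\<dots> = ennreal D * (\<integral>\<^sup>+z. ennreal (1 / W z powr t) * indicator Bn z * E z \<partial>\<nu>)"
      by (rule nn_integral_cmult) measurable
    also have "(\<integral>\<^sup>+z. ennreal (1 / W z powr t) * indicator Bn z * E z \<partial>\<nu>)
      = (\<integral>\<^sup>+z. (\<integral>\<^sup>+w. ennreal (1 / W z powr t) * indicator Bn z * (F w * indicator (pball z (3/4)) w) \<partial>lborel) \<partial>\<nu>)"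
      unfolding E_def by (rule nn_integral_cong, rule nn_integral_cmult[symmetric]) measurable
    also have "\<dots> = (\<integral>\<^sup>+w. (\<integral>\<^sup>+z. ennreal (1 / W z powr t) * indicator Bn z * (F w * indicator (pball z (3/4)) w) \<partial>\<nu>) \<partial>lborel)"
      by (rule P.Fubini'[symmetric]) measurable
    also have "\<dots> \<le> (\<integral>\<^sup>+w. F w * ennreal ((1 / c) powr t * M) \<partial>lborel)"
    proof (rule nn_integral_mono)
      fix w
      show "(\<integral>\<^sup>+z. ennreal (1 / W z powr t) * indicator Bn z * (F w * indicator (pball z (3/4)) w) \<partial>\<nu>) \<le> F w * ennreal ((1 / c) powr t * M)"
      proof (cases "w \<in> Bn")
        case True
        have "(\<integral>\<^sup>+z. ennreal (1 / W z powr t) * indicator Bn z * (F w * indicator (pball z (3/4)) w) \<partial>\<nu>)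
          = F w * (\<integral>\<^sup>+z. ennreal (1 / W z powr t) * indicator Bn z * indicator (pball z (3/4)) w \<partial>\<nu>)"
          by (subst nn_integral_cmult[symmetric]) (auto simp: mult_ac)
        also have "\<dots> \<le> F w * ennreal ((1 / c) powr t * M)" by (intro mult_left_mono inner True) simp
        finally show ?thesis .
      next
        case False
        then have "F w = 0" by (simp add: F_def)
        then show ?thesis by simp
      qed
    qed
    also have "\<dots> = ennreal (j * ((1 / c) powr t * M))"
      using j M by (subst nn_integral_multc) (auto simp: Fj ennreal_mult)
    finally have "(\<integral>\<^sup>+z. ennreal (norm (f z) powr q) * indicator Bn z \<partial>\<nu>) \<le> ennreal D * ennreal (j * ((1 / c) powr t * M))"
      by (simp add: mult_left_mono)
    also have "\<dots> = ennreal (D * (j * ((1 / c) powr t * M)))" using D0 j M by (intro ennreal_mult[symmetric]) auto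
    also have "\<dots> \<le> ennreal (C * M * enn2real (J p f) powr (q / p))"
    proof (rule ennreal_leI)
      have "j powr (t - 1) * j = j powr t" using j by (cases "j = 0") (auto simp: powr_diff)
      then have "D * (j * ((1 / c) powr t * M)) = K powr t * (1 / c) powr t * M * j powr t"
        by (simp add: D_def mult_ac)
      also have "\<dots> \<le> K powr t * (1 / c) powr t * M * (C1 * enn2real (J p f)) powr t"
        using j M t by (intro mult_left_mono powr_mono2) auto
      also have "\<dots> = C * M * enn2real (J p f) powr (q / p)"
        using C1(1) by (simp add: C_def t_def powr_mult mult_ac)
      finally show "D * (j * ((1 / c) powr t * M)) \<le> C * M * enn2real (J p f) powr (q / p)" .
    qed
    finally show "(\<integral>\<^sup>+z. ennreal (norm (f z) powr q) * indicator Bn z \<partial>\<nu>) \<le> ennreal (C * M * enn2real (J p f) powr (q / p))" .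
  qed
qed

end

section \<open>Test functions\<close>

text \<open>Comparison with the largest term, which gives one constant for \<open>q < 1\<close> and
  \<open>q \<ge> 1\<close> alike.\<close>

lemma powr_sum_le:
  fixes x :: "'i \<Rightarrow> real"
  assumes "finite I" "I \<noteq> {}" "\<And>i. i \<in> I \<Longrightarrow> x i \<ge> 0" "q > 0"
  shows "(\<Sum>i\<in>I. x i) powr q \<le> real (card I) powr q * (\<Sum>i\<in>I. x i powr q)"
proof -
  define m where "m = Max (x ` I)"
  have "m \<in> x ` I" unfolding m_def using assms by (intro Max_in) auto
  then obtain k where k: "k \<in> I" "m = x k" by auto
  have le: "x i \<le> m" if "i \<in> I" for i unfolding m_def using assms that by (intro Max_ge) auto
  have "(\<Sum>i\<in>I. x i) \<le> real (card I) * m" using sum_bounded_above[of I x m] le by simp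
  then have "(\<Sum>i\<in>I. x i) powr q \<le> (real (card I) * m) powr q"
    using assms by (intro powr_mono2 sum_nonneg) auto
  also have "\<dots> = real (card I) powr q * x k powr q" using k assms by (simp add: powr_mult)
  also have "\<dots> \<le> real (card I) powr q * (\<Sum>i\<in>I. x i powr q)"
    using assms k by (intro mult_left_mono member_le_sum) auto
  finally show ?thesis .
qed

lemma powr_add_le:
  fixes x y :: real
  assumes "x \<ge> 0" "y \<ge> 0" "q > 0"
  shows "(x + y) powr q \<le> 2 powr q * (x powr q + y powr q)"
proof -
  have "(\<Sum>b\<in>UNIV. if b then x else y) powr q \<le> real (card (UNIV :: bool set)) powr q * (\<Sum>b\<in>UNIV. (if b then x else y) powr q)"
    by (rule powr_sum_le) (use assms in auto)
  then show ?thesis by (simp add: UNIV_bool add.commute)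
qed

lemma norm_vec_le_sum: "norm (x :: complex ^ 'n) \<le> (\<Sum>i\<in>UNIV. norm (x $ i))"
  unfolding norm_vec_def by (rule L2_set_le_sum) simp

lemma holo_on_autom:
  fixes a :: "complex ^ 'n"
  assumes a: "norm a < 1"
  shows "holo_on (\<lambda>z. autom a z $ j) Bn"
proof (cases "a = 0")
  case True
  have "holo_on (\<lambda>z :: complex ^ 'n. 0 - z $ j) Bn" by (intro holo_on_intros)
  then show ?thesis using True by (simp add: autom_0_left)
next
  case False
  define s where "s = complex_of_real (sqrt (1 - (norm a)\<^sup>2))"
  have "holo_on (\<lambda>z. 1 / (1 - herm z a) * ((1 - (1 - s) * herm z a / herm a a) * a $ j - s * z $ j)) Bn"
    using a norm_one_minus_herm_ge(3)[of _ a] False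
    by (intro holo_on_intros) (auto simp: Bn_iff herm_self)
  then show ?thesis
    unfolding autom_alt[OF False] s_def[symmetric]
    by (simp only: vector_smult_component vector_minus_component)
qed

lemma norm_vec_nth_le_1: "norm x < 1 \<Longrightarrow> norm ((x :: complex ^ 'n) $ j) \<le> 1"
  using Finite_Cartesian_Product.norm_nth_le[of x j] by linarith

text \<open>The bases in question are \<open>1 - herm X a\<close>, of modulus up to 2; halving them
  brings the estimate for the unit disc into play.\<close>

lemma norm_power_diff_le_2:
  fixes x y :: complex
  assumes "norm x \<le> 2" "norm y \<le> 2"
  shows "norm (x ^ k - y ^ k) \<le> 2 ^ k * real k * norm (x - y)"
proof -
  have "norm ((x / 2) ^ k - (y / 2) ^ k) \<le> real k * norm (x / 2 - y / 2)"
    using assms by (intro norm_power_diff) (auto simp: norm_divide)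
  also have "norm (x / 2 - y / 2) = norm (x - y) / 2"
    by (simp add: diff_divide_distrib[symmetric] norm_divide)
  finally have "norm ((x ^ k - y ^ k) / 2 ^ k) \<le> real k * (norm (x - y) / 2)"
    by (simp add: power_divide diff_divide_distrib)
  then have "norm (x ^ k - y ^ k) \<le> 2 ^ k * (real k * (norm (x - y) / 2))"
    by (simp add: norm_divide norm_power field_simps)
  also have "\<dots> \<le> 2 ^ k * real k * norm (x - y)" by (simp add: mult_left_mono)
  finally show ?thesis .
qed

text \<open>Measurability is read off the closed formula for \<open>1 - pseudo_hyp^2\<close>, since
  \<open>autom\<close> itself is defined by cases on its centre.\<close>

lemma borel_measurable_pseudo_hyp:
  fixes f g :: "'a \<Rightarrow> complex ^ 'n"
  assumes [measurable]: "f \<in> borel_measurable M" "g \<in> borel_measurable M"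
    and "\<And>x. x \<in> space M \<Longrightarrow> norm (f x) < 1 \<and> norm (g x) < 1"
  shows "(\<lambda>x. pseudo_hyp (f x) (g x)) \<in> borel_measurable M"
proof -
  have "pseudo_hyp (f x) (g x) = sqrt (1 - (1 - (norm (f x))\<^sup>2) * (1 - (norm (g x))\<^sup>2) / (norm (1 - herm (g x) (f x)))\<^sup>2)"
    if "x \<in> space M" for x
  proof (rule real_sqrt_unique[symmetric])
    show "(pseudo_hyp (f x) (g x))\<^sup>2 = 1 - (1 - (norm (f x))\<^sup>2) * (1 - (norm (g x))\<^sup>2) / (norm (1 - herm (g x) (f x)))\<^sup>2"
      using one_minus_pseudo_hyp_sq[of "f x" "g x"] assms(3)[OF that] by linarith
  qed simp
  then show ?thesis by (subst measurable_cong) (assumption, measurable)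
qed

context D_weight
begin

text \<open>Up to the constant this is \<open>(1 - herm (autom a z) a) ^ \<gamma>\<close>, see
  \<open>tfun_autom\<close>. An integer exponent avoids branches of the power.\<close>

definition tfun :: "real \<Rightarrow> nat \<Rightarrow> complex ^ 'n \<Rightarrow> complex ^ 'n \<Rightarrow> complex" where
  "tfun p \<gamma> a z = of_real (W a powr (- 1 / p)) * ((1 - of_real ((norm a)\<^sup>2)) / (1 - herm z a)) ^ \<gamma>"

text \<open>The index type \<open>'n option\<close> gathers the plain test function and its products
  with the \<open>n\<close> components of the automorphism, so that one finite sum runs over all of
  them.\<close>

definition tests :: "real \<Rightarrow> nat \<Rightarrow> complex ^ 'n \<Rightarrow> 'n option \<Rightarrow> complex ^ 'n \<Rightarrow> complex" where
  "tests p \<gamma> a i z = (case i of None \<Rightarrow> tfun p \<gamma> a z | Some j \<Rightarrow> tfun p \<gamma> a z * autom a z $ j)"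

lemma holo_tests:
  assumes "a \<in> Bn" shows "holo_on (tests p \<gamma> a i) Bn"
proof -
  have "holo_on (tfun p \<gamma> a) Bn"
    unfolding tfun_def[abs_def] using assms norm_one_minus_herm_ge(3)[of _ a]
    by (intro holo_on_intros) (auto simp: Bn_iff)
  then show ?thesis
    using assms by (cases i) (auto simp: tests_def[abs_def] Bn_iff intro: holo_on_mult holo_on_autom)
qed

lemma tfun_autom:
  assumes "a \<in> Bn" "z \<in> Bn"
  shows "tfun p \<gamma> a z = of_real (W a powr (- 1 / p)) * (1 - herm (autom a z) a) ^ \<gamma>"
  using assms by (simp add: tfun_def one_minus_herm_autom_center Bn_iff)

lemma norm_tests_le: "a \<in> Bn \<Longrightarrow> z \<in> Bn \<Longrightarrow> norm (tests p \<gamma> a i z) \<le> norm (tfun p \<gamma> a z)"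
  by (cases i) (auto simp: tests_def norm_mult Bn_iff mult_right_le_one_le norm_vec_nth_le_1 norm_autom_less_1)

lemma norm_tfun_powr_le:
  assumes "a \<in> Bn" "z \<in> Bn" "p > 0"
  shows "norm (tfun p \<gamma> a z) powr p \<le> 2 powr (real \<gamma> * p) / W a * ((1 - norm a) / norm (1 - herm z a)) powr (real \<gamma> * p)"
proof -
  have n: "norm a < 1" "norm z < 1" using assms by (auto simp: Bn_iff)
  note W = W_pos[OF assms(1)]
  have x: "norm (1 - herm z a) > 0" using norm_one_minus_herm_ge(4)[OF n(2,1)] .
  have "(norm a)\<^sup>2 \<le> 1" using n by (simp add: power_le_one)
  then have "norm (1 - complex_of_real ((norm a)\<^sup>2)) = 1 - (norm a)\<^sup>2"
    by (metis abs_of_nonneg diff_ge_0_iff_ge norm_of_real of_real_1 of_real_diff)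
  also have "\<dots> \<le> 2 * (1 - norm a)"
  proof -
    have "0 \<le> (1 - norm a)\<^sup>2" by simp
    then show ?thesis by (simp add: power2_diff)
  qed
  finally have le: "norm (1 - complex_of_real ((norm a)\<^sup>2)) \<le> 2 * (1 - norm a)" .
  define y where "y = norm (1 - complex_of_real ((norm a)\<^sup>2)) / norm (1 - herm z a)"
  have y: "0 \<le> y" "y \<le> 2 * ((1 - norm a) / norm (1 - herm z a))"
    using le x by (auto simp: y_def divide_right_mono)
  have "norm (tfun p \<gamma> a z) powr p = (W a powr (- 1 / p)) powr p * (y ^ \<gamma>) powr p"
    using y by (simp add: tfun_def norm_mult norm_power norm_divide y_def powr_mult)
  also have "(W a powr (- 1 / p)) powr p = 1 / W a" 
    unfolding powr_powr using assms(3) W by (simp add: powr_minus_divide)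
  also have "(y ^ \<gamma>) powr p = y powr (real \<gamma> * p)"
  proof -
    have "(norm a)\<^sup>2 < 1" using n by (simp add: abs_square_less_1)
    then have "(norm a)\<^sup>2 \<noteq> 1" by linarith
    then have "1 - complex_of_real ((norm a)\<^sup>2) \<noteq> 0" by (metis eq_iff_diff_eq_0 of_real_1 of_real_eq_iff)
    then have "y > 0" using x by (simp add: y_def)
    then show ?thesis by (simp add: powr_powr powr_realpow[symmetric])
  qed
  also have "y powr (real \<gamma> * p) \<le> (2 * ((1 - norm a) / norm (1 - herm z a))) powr (real \<gamma> * p)"
    using y assms(3) by (intro powr_mono2) auto
  also have "\<dots> = 2 powr (real \<gamma> * p) * ((1 - norm a) / norm (1 - herm z a)) powr (real \<gamma> * p)"
    by (rule powr_mult)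
  finally show ?thesis using W by (simp add: divide_right_mono)
qed

text \<open>With \<open>\<gamma> * p \<ge> N\<close> the kernel integral is of order
  \<open>W a\<close>, which the normalisation cancels. At a fixed \<open>z\<close> the kernel has
  numerator at most \<open>(1 - norm a) ^ N\<close>, while \<open>W a\<close> is at least a multiple
  of \<open>(1 - norm a) ^ (N - 1)\<close>; one factor \<open>1 - norm a\<close> survives and gives
  decay at the boundary.\<close>

lemma tests_bounded:
  assumes p: "p > 0"
  obtains \<gamma> B where "\<And>a i. a \<in> Bn \<Longrightarrow> J p (tests p \<gamma> a i) \<le> ennreal B"
    "\<And>z. z \<in> Bn \<Longrightarrow> \<exists>K. \<forall>a\<in>Bn. \<forall>i. norm (tests p \<gamma> a i z) powr p \<le> K * (1 - norm a)"
proof -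
  obtain N :: nat where N: "\<And>\<Gamma> :: real. \<Gamma> \<ge> real N \<Longrightarrow> \<exists>C>0. \<forall>a\<in>Bn.
    (\<integral>\<^sup>+z. ennreal (((1 - norm a) / norm (1 - herm z a)) powr \<Gamma>) * indicator (Bn :: (complex ^ 'n) set) z * ennreal (wt (norm z)) \<partial>lborel) \<le> ennreal (C * W a)"
    "\<And>a. a \<in> Bn \<Longrightarrow> W a \<ge> ((1 - norm a) / 2) ^ (N - 1) * tail 0" "N \<ge> 1"
    by (rule kernel_integral_le) blast
  obtain \<gamma> :: nat where "real N / p < real \<gamma>" using reals_Archimedean2 by blast
  then have G: "real \<gamma> * p \<ge> real N" using p by (simp add: field_simps)
  let ?G = "real \<gamma> * p"
  obtain C where C: "C > 0" "\<And>a. a \<in> Bn \<Longrightarrow>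
    (\<integral>\<^sup>+z. ennreal (((1 - norm a) / norm (1 - herm z a)) powr ?G) * indicator (Bn :: (complex ^ 'n) set) z * ennreal (wt (norm z)) \<partial>lborel) \<le> ennreal (C * W a)"
    using N(1)[OF G] by blast
  show thesis
  proof (rule that[of \<gamma> "2 powr ?G * C"])
    fix a :: "complex ^ 'n" and i assume a: "a \<in> Bn"
    note W = W_pos[OF a]
    have "J p (tests p \<gamma> a i) \<le> (\<integral>\<^sup>+z. ennreal (2 powr ?G / W a) * (ennreal (((1 - norm a) / norm (1 - herm z a)) powr ?G) * indicator Bn z * ennreal (wt (norm z))) \<partial>lborel)"
      unfolding J_def
    proof (rule nn_integral_mono)
      fix z :: "complex ^ 'n"
      show "ennreal (norm (tests p \<gamma> a i z) powr p) * indicator Bn z * ennreal (wt (norm z))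
        \<le> ennreal (2 powr ?G / W a) * (ennreal (((1 - norm a) / norm (1 - herm z a)) powr ?G) * indicator Bn z * ennreal (wt (norm z)))"
      proof (cases "z \<in> Bn")
        case True
        have "norm (tests p \<gamma> a i z) powr p \<le> norm (tfun p \<gamma> a z) powr p"
          using norm_tests_le[OF a True] p by (intro powr_mono2) auto
        also have "\<dots> \<le> 2 powr ?G / W a * ((1 - norm a) / norm (1 - herm z a)) powr ?G"
          by (rule norm_tfun_powr_le[OF a True p])
        finally have "ennreal (norm (tests p \<gamma> a i z) powr p) \<le> ennreal (2 powr ?G / W a * ((1 - norm a) / norm (1 - herm z a)) powr ?G)"
          by (rule ennreal_leI)
        also have "\<dots> = ennreal (2 powr ?G / W a) * ennreal (((1 - norm a) / norm (1 - herm z a)) powr ?G)"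
          using W by (intro ennreal_mult) auto
        finally show ?thesis using True by (simp add: mult.assoc[symmetric] mult_right_mono)
      qed simp
    qed
    also have "\<dots> = ennreal (2 powr ?G / W a) * (\<integral>\<^sup>+z. ennreal (((1 - norm a) / norm (1 - herm z a)) powr ?G) * indicator Bn z * ennreal (wt (norm z)) \<partial>lborel)"
      by (rule nn_integral_cmult) measurable
    also have "\<dots> \<le> ennreal (2 powr ?G / W a) * ennreal (C * W a)" by (intro mult_left_mono C a) simp
    also have "\<dots> = ennreal (2 powr ?G * C)" using W C by (simp flip: ennreal_mult)
    finally show "J p (tests p \<gamma> a i) \<le> ennreal (2 powr ?G * C)" .
  next
    fix z :: "complex ^ 'n" assume z: "z \<in> Bn"
    then have zn: "norm z < 1" by (simp add: Bn_iff)
    define K where "K = 2 powr ?G * 2 ^ (N - 1) / tail 0 / (1 - norm z) powr ?G"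
    have t0: "tail 0 > 0" by (rule tail_pos) auto
    show "\<exists>K. \<forall>a\<in>Bn. \<forall>i. norm (tests p \<gamma> a i z) powr p \<le> K * (1 - norm a)"
    proof (intro exI[of _ K] ballI allI)
      fix a :: "complex ^ 'n" and i assume a: "a \<in> Bn"
      define d where "d = 1 - norm a"
      have d: "0 < d" "d \<le> 1" using a by (auto simp: d_def Bn_iff)
      note W = W_pos[OF a]
      have lo: "0 < (d / 2) ^ (N - 1) * tail 0" using d t0 by simp
      have "norm (tests p \<gamma> a i z) powr p \<le> norm (tfun p \<gamma> a z) powr p"
        using norm_tests_le[OF a z] p by (intro powr_mono2) auto
      also have "\<dots> \<le> 2 powr ?G / W a * (d / norm (1 - herm z a)) powr ?G"
        unfolding d_def by (rule norm_tfun_powr_le[OF a z p])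
      also have "\<dots> \<le> 2 powr ?G / ((d / 2) ^ (N - 1) * tail 0) * (d / (1 - norm z)) powr ?G"
      proof (intro mult_mono divide_left_mono powr_mono2)
        show "(d / 2) ^ (N - 1) * tail 0 \<le> W a" using N(2)[OF a] by (simp add: d_def)
        show "1 - norm z \<le> norm (1 - herm z a)" using norm_one_minus_herm_ge(2)[of z a] a zn by (simp add: Bn_iff)
      qed (use lo W d zn p norm_one_minus_herm_ge(4)[of z a] a in \<open>auto simp: Bn_iff\<close>)
      also have "(d / (1 - norm z)) powr ?G = d powr ?G / (1 - norm z) powr ?G"
        by (rule powr_divide)
      also have "2 powr ?G / ((d / 2) ^ (N - 1) * tail 0) * (d powr ?G / (1 - norm z) powr ?G) = K * (d powr ?G / d ^ (N - 1))"
        using d t0 by (simp add: K_def power_divide)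
      also have "\<dots> \<le> K * d"
      proof (rule mult_left_mono)
        have "d powr ?G \<le> d powr (real N)" using d G by (intro powr_mono') auto
        also have "\<dots> = d ^ N" using d by (simp add: powr_realpow)
        also have "\<dots> = d ^ (N - 1) * d" using N(3) by (cases N) auto
        finally show "d powr ?G / d ^ (N - 1) \<le> d" using d by (simp add: divide_le_eq mult.commute)
        show "K \<ge> 0" using t0 by (simp add: K_def)
      qed
      finally show "norm (tests p \<gamma> a i z) powr p \<le> K * (1 - norm a)" by (simp add: d_def)
    qed
  qed
qed

text \<open>By \<open>tfun_autom\<close> the claim concerns \<open>X = autom a z\<close>, which
  stays in the ball of radius \<open>s\<close>, so \<open>1 - herm X a\<close> is bounded away from
  0 uniformly in \<open>a\<close>.\<close>

lemma norm_tfun_ge: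
  assumes a: "a \<in> Bn" and s: "0 < s" "s < 1" and z: "z \<in> pball a s"
  shows "norm (tfun p \<gamma> a z) \<ge> W a powr (- 1 / p) * (1 - s) ^ \<gamma>"
proof -
  have zn: "z \<in> Bn" using z pball_subset_Bn by blast
  have "norm (autom a z) < s" using z a s by (simp add: pball_iff Bn_iff pseudo_hyp_def)
  moreover have "1 - norm (autom a z) \<le> norm (1 - herm (autom a z) a)"
    using a zn by (intro norm_one_minus_herm_ge(2)) (auto simp: Bn_iff norm_autom_less_1)
  ultimately have "1 - s \<le> norm (1 - herm (autom a z) a)" by linarith
  then have "(1 - s) ^ \<gamma> \<le> norm (1 - herm (autom a z) a) ^ \<gamma>" using s by (intro power_mono) auto
  then show ?thesis unfolding tfun_autom[OF a zn] by (simp add: norm_mult norm_power mult_left_mono)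
qed

text \<open>In the coordinates \<open>X = autom a z\<close> and \<open>Y = autom a w\<close> the
  power is Lipschitz, and \<open>norm (X - Y)\<close> is bounded by the pseudohyperbolic distance as
  soon as \<open>X\<close> stays away from the sphere. The second point ranges over the whole
  ball.\<close>

lemma norm_tfun_diff_le:
  assumes a: "a \<in> Bn" and s: "0 < s" "s < 1" and z: "z \<in> pball a s" and w: "w \<in> Bn"
  shows "norm (tfun p \<gamma> a z - tfun p \<gamma> a w) \<le> W a powr (- 1 / p) * (2 ^ \<gamma> * real \<gamma> * (2 / (1 - s)) * pseudo_hyp z w)"
proof -
  have zn: "z \<in> Bn" using z pball_subset_Bn by blast
  have n: "norm a < 1" "norm z < 1" "norm w < 1" using a zn w by (auto simp: Bn_iff)
  define X Y where "X = autom a z" and "Y = autom a w"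
  have XY: "norm X < 1" "norm Y < 1" using n by (auto simp: X_def Y_def norm_autom_less_1)
  have Xs: "norm X < s" using z n s by (simp add: pball_iff pseudo_hyp_def X_def)
  have "(1 - norm X) * norm (X - Y) \<le> 2 * pseudo_hyp z w"
    using pseudo_hyp_ge[OF XY] n by (simp add: X_def Y_def pseudo_hyp_autom)
  moreover have "(1 - s) * norm (X - Y) \<le> (1 - norm X) * norm (X - Y)"
    using Xs by (intro mult_right_mono) auto
  ultimately have "norm (X - Y) * (1 - s) \<le> 2 * pseudo_hyp z w" by (simp add: mult.commute)
  then have d: "norm (X - Y) \<le> 2 / (1 - s) * pseudo_hyp z w" using s by (simp add: field_simps)
  have "norm ((1 - herm X a) ^ \<gamma> - (1 - herm Y a) ^ \<gamma>) \<le> 2 ^ \<gamma> * real \<gamma> * norm ((1 - herm X a) - (1 - herm Y a))"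
    using n XY by (intro norm_power_diff_le_2 norm_one_minus_herm_ge(5))
  also have "(1 - herm X a) - (1 - herm Y a) = herm (Y - X) a" by (simp add: herm_diff_left)
  also have "norm (herm (Y - X) a) \<le> 2 / (1 - s) * pseudo_hyp z w"
  proof -
    have "norm (herm (Y - X) a) \<le> norm (Y - X) * norm a" by (rule norm_herm_le)
    also have "\<dots> \<le> norm (X - Y)" using n by (simp add: mult_right_le_one_le norm_minus_commute)
    finally show ?thesis using d by linarith
  qed
  finally have le: "norm ((1 - herm X a) ^ \<gamma> - (1 - herm Y a) ^ \<gamma>) \<le> 2 ^ \<gamma> * real \<gamma> * (2 / (1 - s) * pseudo_hyp z w)"
    by (simp add: mult_left_mono)
  have "norm (tfun p \<gamma> a z - tfun p \<gamma> a w) = W a powr (- 1 / p) * norm ((1 - herm X a) ^ \<gamma> - (1 - herm Y a) ^ \<gamma>)"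
    unfolding tfun_autom[OF a zn] tfun_autom[OF a w] X_def Y_def right_diff_distrib[symmetric] by (simp add: norm_mult)
  also have "\<dots> \<le> W a powr (- 1 / p) * (2 ^ \<gamma> * real \<gamma> * (2 / (1 - s) * pseudo_hyp z w))"
    by (intro mult_left_mono le) auto
  finally show ?thesis by (simp add: mult.assoc)
qed

end

section \<open>Compactness tools\<close>

text \<open>Schwarz's lemma for the rescaled increment. Dividing by \<open>2 * L + 1\<close> instead
  of \<open>2 * L\<close> gives the strict bound that the lemma requires and also covers
  \<open>L = 0\<close>.\<close>

lemma Schwarz_increment:
  fixes g :: "complex \<Rightarrow> complex"
  assumes hol: "g holomorphic_on ball 0 e" and e: "e > 0" and L: "\<And>l. l \<in> ball 0 e \<Longrightarrow> norm (g l) \<le> L"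
    and x: "norm x < e"
  shows "norm (g x - g 0) \<le> (2 * L + 1) * (norm x / e)"
proof -
  have "0 \<le> norm (g 0)" by simp
  also have "\<dots> \<le> L" using L[of 0] e by simp
  finally have L0: "L \<ge> 0" .
  define G where "G l = (g (of_real e * l) - g 0) / of_real (2 * L + 1)" for l
  have in_ball: "of_real e * l \<in> ball 0 e" if "norm l < 1" for l :: complex
    using that e by (simp add: norm_mult)
  have "(g \<circ> (\<lambda>l. of_real e * l)) holomorphic_on ball 0 1"
    by (rule holomorphic_on_compose_gen[OF _ hol]) (use in_ball in \<open>auto intro!: holomorphic_intros\<close>)
  then have holG: "G holomorphic_on ball 0 1"
    unfolding G_def using L0 by (intro holomorphic_intros) (auto simp: o_def simp del: of_real_add)
  have no: "norm (G l) < 1" if "norm l < 1" for l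
  proof -
    have "norm (g (of_real e * l) - g 0) \<le> L + L"
      using L[OF in_ball[OF that]] L[of 0] e by (intro order_trans[OF norm_triangle_ineq4] add_mono) auto
    then show ?thesis using L0 by (simp add: G_def norm_divide del: of_real_add)
  qed
  have "norm (x / of_real e) < 1" using x e by (simp add: norm_divide)
  then have "norm (G (x / of_real e)) \<le> norm (x / of_real e)"
    using Schwarz_Lemma(1)[OF holG _ no, of "x / of_real e"] by (simp add: G_def)
  then show ?thesis using L0 e by (simp add: G_def norm_divide field_simps del: of_real_add)
qed

text \<open>Apply the increment bound on the complex line through \<open>z\<close> and
  \<open>w\<close>. Radius \<open>(1 - norm z) / 2\<close> keeps that disc inside the ball of radius
  \<open>(1 + norm z) / 2\<close>, where \<open>L\<close> bounds the function.\<close>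

lemma holo_equicontinuous:
  fixes f :: "complex ^ 'n \<Rightarrow> complex"
  assumes f: "holo_on f Bn" and z: "norm z < 1" and L: "\<And>w. norm w \<le> (1 + norm z) / 2 \<Longrightarrow> norm (f w) \<le> L"
    and w: "norm (w - z) < (1 - norm z) / 2"
  shows "norm (f w - f z) \<le> (2 * L + 1) * (norm (w - z) / ((1 - norm z) / 2))"
proof (cases "w = z")
  case True
  have "0 \<le> norm (f z)" by simp
  also have "\<dots> \<le> L" using z by (intro L) simp
  finally show ?thesis using True by simp
next
  case False
  define e where "e = (1 - norm z) / 2"
  have e: "e > 0" using z by (simp add: e_def)
  define h where "h = (1 / of_real (norm (w - z))) *s (w - z)"
  have h: "norm h = 1" unfolding h_def norm_vec_scale using False by (simp add: norm_divide)
  have bd: "norm (z + l *s h) \<le> (1 + norm z) / 2" if "l \<in> ball 0 e" for l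
  proof -
    have "norm (z + l *s h) \<le> norm z + norm l" using norm_triangle_ineq[of z "l *s h"] by (simp add: norm_vec_scale h)
    also have "\<dots> \<le> norm z + e" using that by simp
    also have "\<dots> = (1 + norm z) / 2" by (simp add: e_def field_simps)
    finally show ?thesis .
  qed
  have lt: "(1 + norm z) / 2 < 1" using z by simp
  have hol: "(\<lambda>l. f (z + l *s h)) holomorphic_on ball 0 e"
    by (rule holo_on_slice[OF f]) (use le_less_trans[OF bd lt] in \<open>auto simp: Bn_iff\<close>)
  have "norm (f (z + of_real (norm (w - z)) *s h) - f (z + 0 *s h)) \<le> (2 * L + 1) * (norm (of_real (norm (w - z)) :: complex) / e)"
    using w by (intro Schwarz_increment[OF hol e] L bd) (auto simp: e_def)
  moreover have "z + of_real (norm (w - z)) *s h = w" 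
    unfolding h_def using False by (simp add: vec_eq_iff)
  moreover have "z + 0 *s h = z" by (simp add: vec_eq_iff)
  ultimately show ?thesis by (simp add: e_def)
qed

text \<open>The part of Montel's theorem that the later Fatou and dominated convergence arguments
  use: a diagonal subsequence converges on a countable dense set, and equicontinuity carries the
  Cauchy property to every point.\<close>

lemma holo_pointwise_subseq:
  fixes fs :: "nat \<Rightarrow> complex ^ 'n \<Rightarrow> complex"
  assumes fs: "\<And>k. holo_on (fs k) Bn"
    and bdd: "\<And>r. r < 1 \<Longrightarrow> \<exists>L. \<forall>k z. norm z \<le> r \<longrightarrow> norm (fs k z) \<le> L"
  obtains s where "strict_mono (s :: nat \<Rightarrow> nat)" "\<forall>z\<in>Bn. convergent (\<lambda>j. fs (s j) z)"
proof -
  obtain D :: "(complex ^ 'n) set" where D: "countable D" "\<And>X. open X \<Longrightarrow> X \<noteq> {} \<Longrightarrow> \<exists>d\<in>D. d \<in> X"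
    using countable_dense_exists by blast
  define S where "S = D \<inter> Bn"
  have "\<exists>L. \<forall>k. norm (fs k x) \<le> L" if "x \<in> Bn" for x
    using bdd[of "norm x"] that by (auto simp: Bn_iff)
  then obtain L0 where L0: "\<And>x k. x \<in> Bn \<Longrightarrow> norm (fs k x) \<le> L0 x" by metis
  \<comment> \<open>The diagonal argument is applied with one bound for all points, so each value is
    first divided by its own bound; the added 1 keeps the divisor positive.\<close>
  define B where "B x = \<bar>L0 x\<bar> + 1" for x
  have B: "B x > 0" "x \<in> Bn \<Longrightarrow> norm (fs k x) \<le> B x" for x k
    using L0[of x k] by (auto simp: B_def)
  have cS: "countable S" using D(1) by (simp add: S_def)
  have bS: "norm (fs k x / of_real (B x)) \<le> 1" if "x \<in> S" for k x
    using B(1)[of x] B(2)[of x k] that by (simp add: S_def norm_divide)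
  obtain s :: "nat \<Rightarrow> nat" where s: "strict_mono s" and lim: "\<And>x. x \<in> S \<Longrightarrow> \<exists>l. (\<lambda>j. fs (s j) x / of_real (B x)) \<longlonglongrightarrow> l"
    using function_convergent_subsequence[OF cS, of "\<lambda>k x. fs k x / of_real (B x)" 1, OF bS] by blast
  have convS: "Cauchy (\<lambda>j. fs (s j) x)" if x: "x \<in> S" for x
  proof -
    obtain l where "(\<lambda>j. fs (s j) x / of_real (B x)) \<longlonglongrightarrow> l" using lim[OF x] by blast
    then have "(\<lambda>j. fs (s j) x / of_real (B x) * of_real (B x)) \<longlonglongrightarrow> l * of_real (B x)" by (intro tendsto_intros)
    moreover have "B x \<noteq> 0" using B(1)[of x] by simp
    ultimately have "(\<lambda>j. fs (s j) x) \<longlonglongrightarrow> l * of_real (B x)" by simp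
    then show ?thesis by (rule LIMSEQ_imp_Cauchy)
  qed
  have "Cauchy (\<lambda>j. fs (s j) z)" if "z \<in> Bn" for z
  proof (rule metric_CauchyI)
    fix \<epsilon> :: real assume eps: "\<epsilon> > 0"
    have z: "norm z < 1" using that by (simp add: Bn_iff)
    then obtain L where L: "\<And>k w. norm w \<le> (1 + norm z) / 2 \<Longrightarrow> norm (fs k w) \<le> L"
      using bdd[of "(1 + norm z) / 2"] by auto
    have "0 \<le> norm (fs 0 z)" by simp
    also have "\<dots> \<le> L" using z by (intro L) simp
    finally have L0: "L \<ge> 0" .
    define e where "e = (1 - norm z) / 2"
    have e: "e > 0" using z by (simp add: e_def)
    \<comment> \<open>Chosen so that the equicontinuity bound
      \<open>(2 * L + 1) * (norm (x - z) / e)\<close> is at most a quarter of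
      \<open>\<epsilon>\<close>.\<close>
    define \<delta> where "\<delta> = min e (\<epsilon> / 4 * e / (2 * L + 1))"
    have \<delta>: "\<delta> > 0" using e eps L0 by (simp add: \<delta>_def)
    obtain x where x: "x \<in> D" "x \<in> ball z \<delta>" using D(2)[of "ball z \<delta>"] \<delta> by auto
    have xz: "norm (x - z) < \<delta>" using x(2) by (simp add: dist_norm norm_minus_commute)
    then have xe: "norm (x - z) < (1 - norm z) / 2" by (simp add: \<delta>_def e_def)
    have "norm x \<le> norm z + norm (x - z)" using norm_triangle_ineq[of z "x - z"] by simp
    also have "\<dots> < norm z + (1 - norm z) / 2" using xe by simp
    also have "\<dots> \<le> 1" using z by (simp add: field_simps)
    finally have "x \<in> S" using x(1) by (simp add: S_def Bn_iff)
    from metric_CauchyD[OF convS[OF this], of "\<epsilon> / 4"] eps obtain M where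
      M: "\<And>m n. m \<ge> M \<Longrightarrow> n \<ge> M \<Longrightarrow> dist (fs (s m) x) (fs (s n) x) < \<epsilon> / 4" by auto
    have gen: "c * ((\<epsilon> / 4 * e / c) / e) = \<epsilon> / 4" if "c > 0" for c
      using that e by (simp add: field_simps)
    have near: "dist (fs k z) (fs k x) \<le> \<epsilon> / 4" for k
    proof -
      have "dist (fs k z) (fs k x) = norm (fs k x - fs k z)" by (simp add: dist_norm norm_minus_commute)
      also have "\<dots> \<le> (2 * L + 1) * (norm (x - z) / e)"
        unfolding e_def by (rule holo_equicontinuous[OF fs z L xe])
      also have "\<dots> \<le> (2 * L + 1) * ((\<epsilon> / 4 * e / (2 * L + 1)) / e)"
        using L0 e xz by (intro mult_left_mono divide_right_mono) (auto simp: \<delta>_def)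
      also have "\<dots> = \<epsilon> / 4" by (rule gen) (use L0 in simp)
      finally show ?thesis .
    qed
    show "\<exists>M. \<forall>m\<ge>M. \<forall>n\<ge>M. dist (fs (s m) z) (fs (s n) z) < \<epsilon>"
    proof (intro exI[of _ M] allI impI)
      fix m n assume "m \<ge> M" "n \<ge> M"
      have "dist (fs (s m) z) (fs (s n) z) \<le> dist (fs (s m) z) (fs (s m) x) + dist (fs (s m) x) (fs (s n) x) + dist (fs (s n) x) (fs (s n) z)"
        by metric
      also have "\<dots> < \<epsilon>"
        using near[of "s m"] near[of "s n"] M[OF \<open>m \<ge> M\<close> \<open>n \<ge> M\<close>] eps dist_commute[of "fs (s n) x" "fs (s n) z"] by linarith
      finally show "dist (fs (s m) z) (fs (s n) z) < \<epsilon>" .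
    qed
  qed
  then have "convergent (\<lambda>j. fs (s j) z)" if "z \<in> Bn" for z
    using that by (simp add: Cauchy_convergent_iff)
  then have "\<forall>z\<in>Bn. convergent (\<lambda>j. fs (s j) z)" by blast
  with s show thesis by (rule that)
qed

section \<open>Consequences of compactness of an operator\<close>

lemma nn_integral_powr_add_le:
  fixes f g :: "'a \<Rightarrow> complex"
  assumes [measurable]: "f \<in> borel_measurable M" "g \<in> borel_measurable M" and q: "q > 0"
  shows "(\<integral>\<^sup>+z. ennreal (norm (f z + g z) powr q) \<partial>M)
    \<le> ennreal (2 powr q) * ((\<integral>\<^sup>+z. ennreal (norm (f z) powr q) \<partial>M) + (\<integral>\<^sup>+z. ennreal (norm (g z) powr q) \<partial>M))"
proof -
  have "(\<integral>\<^sup>+z. ennreal (norm (f z + g z) powr q) \<partial>M)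
    \<le> (\<integral>\<^sup>+z. ennreal (2 powr q) * (ennreal (norm (f z) powr q) + ennreal (norm (g z) powr q)) \<partial>M)"
  proof (rule nn_integral_mono)
    fix z
    have "norm (f z + g z) powr q \<le> (norm (f z) + norm (g z)) powr q"
      using q by (intro powr_mono2 norm_triangle_ineq) auto
    \<comment> \<open>This quasi-triangle inequality stands in for Minkowski's inequality, which
      fails for \<open>q < 1\<close>.\<close>
    also have "\<dots> \<le> 2 powr q * (norm (f z) powr q + norm (g z) powr q)"
      by (rule powr_add_le) (use q in auto)
    finally show "ennreal (norm (f z + g z) powr q) \<le> ennreal (2 powr q) * (ennreal (norm (f z) powr q) + ennreal (norm (g z) powr q))"
      by (simp add: ennreal_leI flip: ennreal_plus ennreal_mult)
  qed
  also have "\<dots> = ennreal (2 powr q) * (\<integral>\<^sup>+z. ennreal (norm (f z) powr q) + ennreal (norm (g z) powr q) \<partial>M)"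
    by (rule nn_integral_cmult) measurable
  also have "(\<integral>\<^sup>+z. ennreal (norm (f z) powr q) + ennreal (norm (g z) powr q) \<partial>M)
    = (\<integral>\<^sup>+z. ennreal (norm (f z) powr q) \<partial>M) + (\<integral>\<^sup>+z. ennreal (norm (g z) powr q) \<partial>M)"
    by (rule nn_integral_add) measurable
  finally show ?thesis .
qed

lemma Lq_diff_finite:
  assumes "f \<in> Lq q M" "g \<in> Lq q M" "q > 0"
  shows "(\<integral>\<^sup>+z. ennreal (norm (f z - g z) powr q) \<partial>M) < \<infinity>"
proof -
  have [measurable]: "f \<in> borel_measurable M" "g \<in> borel_measurable M" using assms by (auto simp: Lq_def)
  have "(\<integral>\<^sup>+z. ennreal (norm (f z + - g z) powr q) \<partial>M)
    \<le> ennreal (2 powr q) * ((\<integral>\<^sup>+z. ennreal (norm (f z) powr q) \<partial>M) + (\<integral>\<^sup>+z. ennreal (norm (- g z) powr q) \<partial>M))"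
    by (rule nn_integral_powr_add_le) (use assms in auto)
  also have "\<dots> < \<infinity>" using assms by (auto simp: Lq_def ennreal_mult_less_top)
  finally show ?thesis by simp
qed

text \<open>\<open>enn2real\<close> would display an infinite integral as 0. Since the differences
  have finite integral, the convergence of \<open>Lq_normp\<close> can be restated for extended
  reals, where nothing is hidden.\<close>

lemma compact_op_extract:
  assumes T: "compact_op p \<omega> q M T" and q: "q > 0"
    and fs: "\<And>k. fs k \<in> Apw p \<omega>" "\<And>k. Apw_normp p \<omega> (fs k) \<le> B"
  obtains s g where "strict_mono (s :: nat \<Rightarrow> nat)" "g \<in> Lq q M"
    "(\<lambda>j. \<integral>\<^sup>+z. ennreal (norm (T (fs (s j)) z - g z) powr q) \<partial>M) \<longlonglongrightarrow> 0"
proof -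
  have "(\<forall>k. fs k \<in> Apw p \<omega>) \<and> (\<exists>B. \<forall>k. Apw_normp p \<omega> (fs k) \<le> B)" using fs by blast
  from T[unfolded compact_op_def, THEN conjunct2, rule_format, OF this]
  obtain s g where s: "strict_mono (s :: nat \<Rightarrow> nat)" "g \<in> Lq q M"
      "(\<lambda>j. Lq_normp q M (\<lambda>z. T (fs (s j)) z - g z)) \<longlonglongrightarrow> 0"
    by blast
  have TL: "T (fs k) \<in> Lq q M" for k using T fs unfolding compact_op_def by blast
  have "(\<lambda>j. ennreal (Lq_normp q M (\<lambda>z. T (fs (s j)) z - g z))) \<longlonglongrightarrow> ennreal 0"
    using s(3) by (rule tendsto_ennrealI)
  moreover have "ennreal (Lq_normp q M (\<lambda>z. T (fs (s j)) z - g z)) = (\<integral>\<^sup>+z. ennreal (norm (T (fs (s j)) z - g z) powr q) \<partial>M)" for j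
    unfolding Lq_normp_def using Lq_diff_finite[OF TL s(2) q] by simp
  ultimately show thesis using s(1,2) by (intro that[of s g]) simp_all
qed

lemma nn_integral_powr_le_diff:
  assumes "f \<in> Lq q M" "g \<in> Lq q M" "q > 0"
  shows "(\<integral>\<^sup>+z. ennreal (norm (f z) powr q) \<partial>M) \<le> ennreal (2 powr q) *
     ((\<integral>\<^sup>+z. ennreal (norm (f z - g z) powr q) \<partial>M) + (\<integral>\<^sup>+z. ennreal (norm (g z) powr q) \<partial>M))"
proof -
  have [measurable]: "f \<in> borel_measurable M" "g \<in> borel_measurable M" using assms by (auto simp: Lq_def)
  have "(\<integral>\<^sup>+z. ennreal (norm ((f z - g z) + g z) powr q) \<partial>M) \<le> ennreal (2 powr q) *
     ((\<integral>\<^sup>+z. ennreal (norm (f z - g z) powr q) \<partial>M) + (\<integral>\<^sup>+z. ennreal (norm (g z) powr q) \<partial>M))"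
    by (rule nn_integral_powr_add_le) (use assms in auto)
  then show ?thesis by simp
qed

text \<open>\<open>compact_op\<close> contains no norm estimate; it is recovered here. Images with
  unbounded norms would have a subsequence close to one fixed \<open>g\<close> in \<open>Lq\<close>,
  hence with bounded norms.\<close>

lemma compact_op_bounded_on:
  assumes T: "compact_op p \<omega> q M T" and q: "q > 0"
    and S: "\<And>f. f \<in> S \<Longrightarrow> f \<in> Apw p \<omega>" "\<And>f. f \<in> S \<Longrightarrow> Apw_normp p \<omega> f \<le> B"
  shows "\<exists>B'\<ge>0. \<forall>f\<in>S. (\<integral>\<^sup>+z. ennreal (norm (T f z) powr q) \<partial>M) \<le> ennreal B'"
proof (rule ccontr)
  assume "\<not> ?thesis"
  then have "\<exists>f\<in>S. ennreal (real k) < (\<integral>\<^sup>+z. ennreal (norm (T f z) powr q) \<partial>M)" for k :: nat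
    using of_nat_0_le_iff[of k] by (meson not_le)
  then obtain fs where fs: "\<And>k. fs k \<in> S" "\<And>k. ennreal (real k) < (\<integral>\<^sup>+z. ennreal (norm (T (fs k) z) powr q) \<partial>M)" by metis
  have fA: "fs k \<in> Apw p \<omega>" "Apw_normp p \<omega> (fs k) \<le> B" for k using fs S by auto
  have TL: "T (fs k) \<in> Lq q M" for k using T fA unfolding compact_op_def by blast
  obtain s g where s: "strict_mono (s :: nat \<Rightarrow> nat)" and g: "g \<in> Lq q M"
      and lim: "(\<lambda>j. \<integral>\<^sup>+z. ennreal (norm (T (fs (s j)) z - g z) powr q) \<partial>M) \<longlonglongrightarrow> 0"
    by (rule compact_op_extract[where fs = fs, OF T q fA])
  define G where "G = (\<integral>\<^sup>+z. ennreal (norm (g z) powr q) \<partial>M)"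
  have G: "G < top" using g by (simp add: G_def Lq_def)
  have "eventually (\<lambda>j. (\<integral>\<^sup>+z. ennreal (norm (T (fs (s j)) z - g z) powr q) \<partial>M) < 1) sequentially"
    using order_tendstoD(2)[OF lim, of 1] by simp
  then obtain N where N: "\<And>j. j \<ge> N \<Longrightarrow> (\<integral>\<^sup>+z. ennreal (norm (T (fs (s j)) z - g z) powr q) \<partial>M) < 1"
    unfolding eventually_sequentially by blast
  have fin: "ennreal (2 powr q) * (1 + G) < top" using G by (simp add: ennreal_mult_less_top)
  obtain m :: nat where m: "enn2real (ennreal (2 powr q) * (1 + G)) < real m" using reals_Archimedean2 by blast
  \<comment> \<open>Strict monotonicity gives \<open>s j \<ge> j \<ge> m\<close>, so the lower bound
    \<open>s j\<close> on the integral exceeds the upper bound that closeness to \<open>g\<close>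
    provides.\<close>
  define j where "j = max N m"
  have "ennreal (real m) \<le> ennreal (real (s j))"
    using seq_suble[OF s, of j] by (intro ennreal_leI) (auto simp: j_def)
  also have "\<dots> \<le> (\<integral>\<^sup>+z. ennreal (norm (T (fs (s j)) z) powr q) \<partial>M)" using fs(2)[of "s j"] by simp
  also have "\<dots> \<le> ennreal (2 powr q) * ((\<integral>\<^sup>+z. ennreal (norm (T (fs (s j)) z - g z) powr q) \<partial>M) + G)"
    unfolding G_def by (rule nn_integral_powr_le_diff[OF TL g q])
  also have "\<dots> \<le> ennreal (2 powr q) * (1 + G)"
    using N[of j] by (intro mult_left_mono add_right_mono) (auto simp: j_def)
  also have "\<dots> = ennreal (enn2real (ennreal (2 powr q) * (1 + G)))" using fin by simp
  also have "\<dots> < ennreal (real m)" using m by (simp add: ennreal_less_iff)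
  finally show False by simp
qed

text \<open>Fatou's lemma identifies the limit: the images tend to 0 pointwise, so the integral of
  \<open>norm g powr q\<close> is at most the lower limit of the integrals of the differences, which
  is 0.\<close>

lemma compact_op_null_sequence:
  assumes T: "compact_op p \<omega> q M T" and q: "q > 0"
    and fs: "\<And>k. fs k \<in> Apw p \<omega>" "\<And>k. Apw_normp p \<omega> (fs k) \<le> B"
    and null: "\<And>z. z \<in> space M \<Longrightarrow> (\<lambda>k. T (fs k) z) \<longlonglongrightarrow> 0"
  obtains s where "strict_mono (s :: nat \<Rightarrow> nat)"
    "(\<lambda>j. \<integral>\<^sup>+z. ennreal (norm (T (fs (s j)) z) powr q) \<partial>M) \<longlonglongrightarrow> 0"
proof -
  have TL: "T (fs k) \<in> Lq q M" for k using T fs unfolding compact_op_def by blast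
  then have [measurable]: "T (fs k) \<in> borel_measurable M" for k by (simp add: Lq_def)
  obtain s g where s: "strict_mono (s :: nat \<Rightarrow> nat)" and g: "g \<in> Lq q M"
      and lim: "(\<lambda>j. \<integral>\<^sup>+z. ennreal (norm (T (fs (s j)) z - g z) powr q) \<partial>M) \<longlonglongrightarrow> 0"
    by (rule compact_op_extract[where fs = fs, OF T q fs])
  have [measurable]: "g \<in> borel_measurable M" using g by (simp add: Lq_def)
  have "(\<integral>\<^sup>+z. ennreal (norm (g z) powr q) \<partial>M) = (\<integral>\<^sup>+z. liminf (\<lambda>j. ennreal (norm (T (fs (s j)) z - g z) powr q)) \<partial>M)"
  proof (rule nn_integral_cong)
    fix z assume z: "z \<in> space M"
    have "(\<lambda>j. T (fs (s j)) z) \<longlonglongrightarrow> 0" using LIMSEQ_subseq_LIMSEQ[OF null[OF z] s] by (simp add: o_def)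
    then have "(\<lambda>j. norm (T (fs (s j)) z - g z) powr q) \<longlonglongrightarrow> norm (0 - g z) powr q"
      using q by (intro tendsto_powr2 tendsto_norm tendsto_diff tendsto_const) auto
    then have "(\<lambda>j. ennreal (norm (T (fs (s j)) z - g z) powr q)) \<longlonglongrightarrow> ennreal (norm (0 - g z) powr q)"
      by (rule tendsto_ennrealI)
    from lim_imp_Liminf[OF _ this] show "ennreal (norm (g z) powr q) = liminf (\<lambda>j. ennreal (norm (T (fs (s j)) z - g z) powr q))"
      by simp
  qed
  also have "\<dots> \<le> liminf (\<lambda>j. \<integral>\<^sup>+z. ennreal (norm (T (fs (s j)) z - g z) powr q) \<partial>M)"
    by (rule nn_integral_liminf) measurable
  also have "\<dots> = 0" using lim_imp_Liminf[OF _ lim] by simp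
  finally have g0: "(\<integral>\<^sup>+z. ennreal (norm (g z) powr q) \<partial>M) = 0" by simp
  have "(\<lambda>j. ennreal (2 powr q) * (\<integral>\<^sup>+z. ennreal (norm (T (fs (s j)) z - g z) powr q) \<partial>M)) \<longlonglongrightarrow> ennreal (2 powr q) * 0"
    by (rule ennreal_tendsto_cmult[OF _ lim]) simp
  then have lim0: "(\<lambda>j. ennreal (2 powr q) * (\<integral>\<^sup>+z. ennreal (norm (T (fs (s j)) z - g z) powr q) \<partial>M)) \<longlonglongrightarrow> 0" by simp
  have "(\<lambda>j. \<integral>\<^sup>+z. ennreal (norm (T (fs (s j)) z) powr q) \<partial>M) \<longlonglongrightarrow> 0"
  proof (rule tendsto_sandwich[OF _ _ tendsto_const lim0])
    show "\<forall>\<^sub>F j in sequentially. (\<integral>\<^sup>+z. ennreal (norm (T (fs (s j)) z) powr q) \<partial>M)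
        \<le> ennreal (2 powr q) * (\<integral>\<^sup>+z. ennreal (norm (T (fs (s j)) z - g z) powr q) \<partial>M)"
      using nn_integral_powr_le_diff[OF TL g q] by (simp add: g0)
  qed simp
  with s show thesis by (rule that)
qed

section \<open>Sufficient conditions for Carleson measures\<close>

text \<open>\<open>measure_of\<close> falls back to the zero measure unless the set function is
  positive and countably additive, so both have to be verified before the sum can be
  evaluated.\<close>

lemma emeasure_measure_add:
  assumes s: "sets N = sets M" and A: "A \<in> sets M"
  shows "emeasure (measure_add M N) A = emeasure M A + emeasure N A"
proof (rule emeasure_measure_of[OF measure_add_def])
  show "sets M \<subseteq> Pow (space M)" by (rule sets.space_closed)
  show "A \<in> sets (measure_add M N)" using A by (simp add: measure_add_def)
  show "positive (sets (measure_add M N)) (\<lambda>A. emeasure M A + emeasure N A)"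
    by (simp add: positive_def)
  show "countably_additive (sets (measure_add M N)) (\<lambda>A. emeasure M A + emeasure N A)"
  proof (rule countably_additiveI)
    fix F :: "nat \<Rightarrow> 'a set" assume F: "range F \<subseteq> sets (measure_add M N)" "disjoint_family F"
    then have "range F \<subseteq> sets M" "range F \<subseteq> sets N" by (auto simp: measure_add_def s)
    then show "(\<Sum>i. emeasure M (F i) + emeasure N (F i)) = emeasure M (\<Union> (range F)) + emeasure N (\<Union> (range F))"
      using F(2) by (subst suminf_add[symmetric]) (auto simp: suminf_emeasure)
  qed
qed

lemma sets_measure_add [simp]: "sets (measure_add M N) = sets M"
  by (simp add: measure_add_def)

lemma space_Bn_borel [simp]: "space Bn_borel = Bn"
  by (simp add: Bn_borel_def)

lemma measurable_holo_Bn_borel: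
  assumes "holo_on f Bn" "sets \<nu> = sets (Bn_borel :: (complex ^ 'n) measure)"
  shows "f \<in> borel_measurable \<nu>"
proof -
  show ?thesis
    unfolding measurable_cong_sets[OF assms(2) refl] Bn_borel_def
    by (intro borel_measurable_continuous_on_restrict holo_on_continuous assms)
qed

lemma pball_Bn_borel: "pball (a :: complex ^ 'n) s \<in> sets Bn_borel"
  unfolding Bn_borel_def using pball_subset_Bn by (subst sets_restrict_space_iff) auto

lemma pball_0: "0 < s \<Longrightarrow> s < 1 \<Longrightarrow> pball 0 s = ball 0 s"
  by (auto simp: pball_iff pseudo_hyp_def autom_0_left)

text \<open>Provides the sigma-finiteness that Tonelli's theorem requires in
  \<open>carleson_embedding\<close>.\<close>

lemma sigma_finite_Bn:
  fixes \<nu> :: "(complex ^ 'n) measure"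
  assumes sets: "sets \<nu> = sets borel" and out: "emeasure \<nu> (- Bn) = 0"
    and fin: "\<And>s. 0 < s \<Longrightarrow> s < 1 \<Longrightarrow> emeasure \<nu> (ball 0 s) < \<infinity>"
  shows "sigma_finite_measure \<nu>"
proof
  \<comment> \<open>The shift by 2 keeps every radius strictly between 0 and 1, already for
    \<open>k = 0\<close>.\<close>
  define A :: "nat \<Rightarrow> (complex ^ 'n) set" where "A k = ball 0 (1 - 1 / (real k + 2))" for k
  have "x \<in> (\<Union>k. A k)" if x: "x \<in> Bn" for x
  proof -
    have "norm x < 1" using x by (simp add: Bn_iff)
    then obtain k :: nat where "1 / (1 - norm x) < real k" using reals_Archimedean2 by blast
    then have "1 < (1 - norm x) * (real k + 2)" using \<open>norm x < 1\<close> by (simp add: field_simps)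
    then have "1 / (real k + 2) < 1 - norm x" by (simp add: field_simps)
    then show ?thesis by (auto simp: A_def intro!: exI[of _ k])
  qed
  then have "\<Union> (insert (- Bn) (range A)) = UNIV" by auto
  moreover have "emeasure \<nu> (A k) \<noteq> \<infinity>" for k
  proof -
    have "0 < 1 - 1 / (real k + 2)" by (simp add: field_simps)
    then show ?thesis unfolding A_def using fin[of "1 - 1 / (real k + 2)"] by simp
  qed
  moreover have "insert (- Bn) (range A) \<subseteq> sets \<nu>" by (auto simp: sets A_def)
  ultimately show "\<exists>A. countable A \<and> A \<subseteq> sets \<nu> \<and> \<Union> A = space \<nu> \<and> (\<forall>a\<in>A. emeasure \<nu> a \<noteq> \<infinity>)"
    using out sets_eq_imp_space_eq[OF sets] by (intro exI[of _ "insert (- Bn) (range A)"]) auto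
qed

context D_weight
begin

text \<open>The growth estimate for the weighted space: norm-bounded sequences are uniformly bounded
  on smaller balls.\<close>

lemma holo_pointwise_J:
  assumes p: "p > 0"
  shows "\<exists>K\<ge>0. \<forall>f. \<forall>z\<in>Bn. holo_on f Bn \<longrightarrow> ennreal (W z * norm (f z) powr p) \<le> ennreal K * J p f"
proof -
  obtain K where K: "K > 0" "\<And>f z. z \<in> Bn \<Longrightarrow> holo_on f Bn \<Longrightarrow> ennreal (W z * norm (f z) powr p) \<le> ennreal K *
    (\<integral>\<^sup>+w. ennreal (norm (f w) powr p) * indicator Bn w * ennreal (tail (norm w) / (1 - norm w)) * indicator (pball z (3/4)) w \<partial>lborel)"
    using holo_pointwise_le[OF p] by blast
  obtain C1 where C1: "C1 \<ge> 0" "\<And>f. holo_on f (Bn :: (complex ^ 'n) set) \<Longrightarrow>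
    (\<integral>\<^sup>+z. ennreal (norm (f z) powr p) * indicator Bn z * ennreal (tail (norm z) / (1 - norm z)) \<partial>lborel) \<le> ennreal C1 * J p f"
    using holo_integral_smooth_weight[OF p] unfolding J_def by blast
  show ?thesis
  proof (intro exI[of _ "K * C1"] conjI allI ballI impI)
    show "K * C1 \<ge> 0" using K C1 by simp
    fix f :: "complex ^ 'n \<Rightarrow> complex" and z :: "complex ^ 'n" assume z: "z \<in> Bn" and f: "holo_on f Bn"
    have "ennreal (W z * norm (f z) powr p) \<le> ennreal K *
      (\<integral>\<^sup>+w. ennreal (norm (f w) powr p) * indicator Bn w * ennreal (tail (norm w) / (1 - norm w)) * indicator (pball z (3/4)) w \<partial>lborel)"
      by (rule K(2)[OF z f])
    also have "\<dots> \<le> ennreal K * (\<integral>\<^sup>+w. ennreal (norm (f w) powr p) * indicator Bn w * ennreal (tail (norm w) / (1 - norm w)) \<partial>lborel)"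
      by (intro mult_left_mono nn_integral_mono) (auto split: split_indicator)
    also have "\<dots> \<le> ennreal K * (ennreal C1 * J p f)" by (intro mult_left_mono C1 f) simp
    also have "\<dots> = ennreal (K * C1) * J p f" using K C1 by (simp add: ennreal_mult mult.assoc)
    finally show "ennreal (W z * norm (f z) powr p) \<le> ennreal (K * C1) * J p f" .
  qed
qed

lemma J_diff_le:
  assumes "holo_on f Bn" "holo_on g Bn" and p: "p > 0"
  shows "J p (\<lambda>z. f z - g z) \<le> ennreal (2 powr p) * (J p f + J p g)"
proof -
  have [measurable]: "(\<lambda>w. ennreal (norm (f w) powr p) * indicator Bn w) \<in> borel_measurable borel"
    "(\<lambda>w. ennreal (norm (g w) powr p) * indicator Bn w) \<in> borel_measurable borel"
    using assms by (auto intro: measurable_holo_powr)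
  have "J p (\<lambda>z. f z - g z) \<le> (\<integral>\<^sup>+z. ennreal (2 powr p) * (ennreal (norm (f z) powr p) * indicator Bn z * ennreal (wt (norm z))
      + ennreal (norm (g z) powr p) * indicator Bn z * ennreal (wt (norm z))) \<partial>lborel)"
    unfolding J_def
  proof (rule nn_integral_mono)
    fix z
    have "norm (f z - g z) powr p \<le> (norm (f z) + norm (g z)) powr p"
      using p by (intro powr_mono2 norm_triangle_ineq4) auto
    also have "\<dots> \<le> 2 powr p * (norm (f z) powr p + norm (g z) powr p)"
      by (rule powr_add_le) (use p in auto)
    finally have "ennreal (norm (f z - g z) powr p) \<le> ennreal (2 powr p) * (ennreal (norm (f z) powr p) + ennreal (norm (g z) powr p))"
      by (simp add: ennreal_leI flip: ennreal_plus ennreal_mult)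
    then have "ennreal (norm (f z - g z) powr p) * (indicator Bn z * ennreal (wt (norm z)))
      \<le> ennreal (2 powr p) * (ennreal (norm (f z) powr p) + ennreal (norm (g z) powr p)) * (indicator Bn z * ennreal (wt (norm z)))"
      by (rule mult_right_mono) simp
    then show "ennreal (norm (f z - g z) powr p) * indicator Bn z * ennreal (wt (norm z))
      \<le> ennreal (2 powr p) * (ennreal (norm (f z) powr p) * indicator Bn z * ennreal (wt (norm z))
      + ennreal (norm (g z) powr p) * indicator Bn z * ennreal (wt (norm z)))"
      by (simp add: distrib_right mult.assoc)
  qed
  also have "\<dots> = ennreal (2 powr p) * (J p f + J p g)"
    unfolding J_def by (subst nn_integral_cmult, measurable, subst nn_integral_add) auto
  finally show ?thesis .
qed

text \<open>Transfers the embedding from Borel measures on the whole space to measures on the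
  subspace \<open>Bn_borel\<close>, by pushing forward along the inclusion. The cut-off
  \<open>X\<close> will be the whole space or the outside of a ball.\<close>

lemma carleson_embedding_Bn:
  assumes p: "p > 0" and pq: "p \<le> q"
  shows "\<exists>C\<ge>0. \<forall>\<nu> X M f. sets \<nu> = sets Bn_borel \<longrightarrow> X \<in> sets borel \<longrightarrow> M \<ge> 0 \<longrightarrow>
    (\<forall>s. 0 < s \<and> s < 1 \<longrightarrow> emeasure \<nu> (ball 0 s) < \<infinity>) \<longrightarrow>
    (\<forall>a\<in>Bn. emeasure \<nu> (pball a (3/4) \<inter> X) \<le> ennreal (M * W a powr (q / p))) \<longrightarrow>
    holo_on f Bn \<longrightarrow> J p f < \<infinity> \<longrightarrow>
    (\<integral>\<^sup>+z. ennreal (norm (f z) powr q) * indicator X z \<partial>\<nu>) \<le> ennreal (C * M * enn2real (J p f) powr (q / p))"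
proof -
  obtain C where C: "C \<ge> 0" "\<And>\<nu> M f. sets \<nu> = sets borel \<Longrightarrow> sigma_finite_measure \<nu> \<Longrightarrow> M \<ge> 0 \<Longrightarrow>
    (\<forall>a\<in>Bn. emeasure \<nu> (pball a (3/4)) \<le> ennreal (M * W a powr (q / p))) \<Longrightarrow>
    holo_on f Bn \<Longrightarrow> J p f < \<infinity> \<Longrightarrow>
    (\<integral>\<^sup>+z. ennreal (norm (f z) powr q) * indicator Bn z \<partial>\<nu>) \<le> ennreal (C * M * enn2real (J p f) powr (q / p))"
    using carleson_embedding[OF p pq] by blast
  show ?thesis
  proof (intro exI[of _ C] conjI C(1) allI impI)
    fix \<nu> :: "(complex ^ 'n) measure" and X and M :: real and f
    assume sets: "sets \<nu> = sets Bn_borel" and X[measurable]: "X \<in> sets borel" and M: "M \<ge> 0"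
      and fin: "\<forall>s. 0 < s \<and> s < 1 \<longrightarrow> emeasure \<nu> (ball 0 s) < \<infinity>"
      and le: "\<forall>a\<in>Bn. emeasure \<nu> (pball a (3/4) \<inter> X) \<le> ennreal (M * W a powr (q / p))"
      and f: "holo_on f Bn" and Jf: "J p f < \<infinity>"
    have sp: "space \<nu> = Bn" using sets_eq_imp_space_eq[OF sets] by simp
    have [measurable]: "(\<lambda>x. x) \<in> measurable \<nu> borel"
      unfolding measurable_cong_sets[OF sets refl] Bn_borel_def by (rule measurable_restrict_space1) simp
    define N where "N = density (distr \<nu> borel (\<lambda>x. x)) (indicator X)"
    have sN: "sets N = sets borel" by (simp add: N_def)
    have iN: "(\<integral>\<^sup>+z. h z \<partial>N) = (\<integral>\<^sup>+z. indicator X z * h z \<partial>\<nu>)" if [measurable]: "h \<in> borel_measurable borel" for h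
      unfolding N_def by (subst nn_integral_density) (auto simp: nn_integral_distr)
    have eN: "emeasure N A = emeasure \<nu> (A \<inter> X \<inter> Bn)" if A[measurable]: "A \<in> sets borel" for A
    proof -
      have "A \<inter> X \<inter> Bn \<in> sets \<nu>" unfolding sets Bn_borel_def by (subst sets_restrict_space_iff) auto
      have "emeasure N A = (\<integral>\<^sup>+z. indicator A z \<partial>N)" using sN A by simp
      also have "\<dots> = (\<integral>\<^sup>+z. indicator X z * indicator A z \<partial>\<nu>)" by (rule iN) simp
      also have "\<dots> = (\<integral>\<^sup>+z. indicator (A \<inter> X \<inter> Bn) z \<partial>\<nu>)"
        by (rule nn_integral_cong) (auto simp: sp split: split_indicator)
      also have "\<dots> = emeasure \<nu> (A \<inter> X \<inter> Bn)" by (rule nn_integral_indicator) fact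
      finally show ?thesis .
    qed
    have sf: "sigma_finite_measure N"
    proof (rule sigma_finite_Bn[OF sN])
      show "emeasure N (- Bn) = 0" by (subst eN) auto
      fix s :: real assume s: "0 < s" "s < 1"
      have "(ball 0 s :: (complex ^ 'n) set) \<in> sets \<nu>" unfolding sets using pball_Bn_borel[of 0 s] s by (simp add: pball_0)
      then have "emeasure N (ball 0 s) \<le> emeasure \<nu> (ball 0 s)" by (subst eN) (auto intro: emeasure_mono)
      also have "\<dots> < \<infinity>" using fin s by blast
      finally show "emeasure N (ball 0 s) < \<infinity>" .
    qed
    have leN: "\<forall>a\<in>Bn. emeasure N (pball a (3/4)) \<le> ennreal (M * W a powr (q / p))"
    proof
      fix a :: "complex ^ 'n" assume "a \<in> Bn"
      have "pball a (3/4) \<inter> X \<inter> Bn = pball a (3/4) \<inter> X" using pball_subset_Bn by blast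
      then show "emeasure N (pball a (3/4)) \<le> ennreal (M * W a powr (q / p))"
        using le \<open>a \<in> Bn\<close> by (subst eN) auto
    qed
    have "(\<integral>\<^sup>+z. ennreal (norm (f z) powr q) * indicator X z \<partial>\<nu>)
      = (\<integral>\<^sup>+z. indicator X z * (ennreal (norm (f z) powr q) * indicator Bn z) \<partial>\<nu>)"
      by (rule nn_integral_cong) (auto simp: sp mult.commute)
    also have "\<dots> = (\<integral>\<^sup>+z. ennreal (norm (f z) powr q) * indicator Bn z \<partial>N)"
      by (rule iN[symmetric]) (rule measurable_holo_powr[OF f])
    also have "\<dots> \<le> ennreal (C * M * enn2real (J p f) powr (q / p))"
      by (rule C(2)[OF sN sf M leN f Jf])
    finally show "(\<integral>\<^sup>+z. ennreal (norm (f z) powr q) * indicator X z \<partial>\<nu>) \<le> ennreal (C * M * enn2real (J p f) powr (q / p))" .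
  qed
qed

text \<open>The balls about 0 are also pseudohyperbolic balls, so the bound at every radius makes
  \<open>\<nu>\<close> finite on smaller balls, as sigma-finiteness requires; the embedding itself
  works with radius 3/4.\<close>

lemma carleson_sufficient:
  assumes p: "p > 0" and pq: "p \<le> q" and sets: "sets \<nu> = sets Bn_borel"
    and H: "\<And>s. 0 < s \<Longrightarrow> s < 1 \<Longrightarrow> \<exists>M\<ge>0. \<forall>a\<in>Bn. emeasure \<nu> (pball a s) \<le> ennreal (M * W a powr (q / p))"
  shows "carleson p \<omega> q \<nu>"
    and "\<And>s. 0 < s \<Longrightarrow> s < 1 \<Longrightarrow> emeasure \<nu> (ball 0 s) < \<infinity>"
proof -
  have q: "q > 0" using p pq by simp
  show fin: "emeasure \<nu> (ball 0 s) < \<infinity>" if s: "0 < s" "s < 1" for s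
  proof -
    obtain M where "\<forall>a\<in>Bn. emeasure \<nu> (pball a s) \<le> ennreal (M * W a powr (q / p))" using H[OF s] by blast
    then have "emeasure \<nu> (pball 0 s) \<le> ennreal (M * W 0 powr (q / p))" by (auto simp: Bn_iff)
    then show ?thesis unfolding pball_0[OF s] by (rule le_less_trans) simp
  qed
  obtain C where C: "C \<ge> 0" "\<And>\<nu> X M f. sets \<nu> = sets Bn_borel \<Longrightarrow> X \<in> sets borel \<Longrightarrow> M \<ge> 0 \<Longrightarrow>
    (\<forall>s. 0 < s \<and> s < 1 \<longrightarrow> emeasure \<nu> (ball 0 s) < \<infinity>) \<Longrightarrow>
    (\<forall>a\<in>Bn. emeasure \<nu> (pball a (3/4) \<inter> X) \<le> ennreal (M * W a powr (q / p))) \<Longrightarrow>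
    holo_on f Bn \<Longrightarrow> J p f < \<infinity> \<Longrightarrow>
    (\<integral>\<^sup>+z. ennreal (norm (f z) powr q) * indicator X z \<partial>\<nu>) \<le> ennreal (C * M * enn2real (J p f) powr (q / p))"
    using carleson_embedding_Bn[OF p pq] by blast
  obtain M where M: "M \<ge> 0" "\<forall>a\<in>Bn. emeasure \<nu> (pball a (3/4)) \<le> ennreal (M * W a powr (q / p))"
    using H[of "3/4"] by auto
  have emb: "(\<integral>\<^sup>+z. ennreal (norm (f z) powr q) \<partial>\<nu>) \<le> ennreal (C * M * enn2real (J p f) powr (q / p))"
    if "f \<in> Apw p \<omega>" for f
    using C(2)[OF sets, of UNIV M f] M fin that by (simp add: Apw_iff)
  define V where "V = Bn_vol TYPE('n)"
  have V: "V > 0" unfolding V_def by (rule Bn_vol_pos)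
  show "carleson p \<omega> q \<nu>"
    unfolding carleson_def bounded_op_def
  proof (intro conjI ballI exI)
    fix f :: "complex ^ 'n \<Rightarrow> complex" assume f: "f \<in> Apw p \<omega>"
    then have hf: "holo_on f Bn" by (simp add: Apw_iff)
    show "f \<in> Lq q \<nu>"
      using measurable_holo_Bn_borel[OF hf sets] le_less_trans[OF emb[OF f]] by (simp add: Lq_def)
    have "Lq_normp q \<nu> f \<le> C * M * enn2real (J p f) powr (q / p)"
      unfolding Lq_normp_def using enn2real_mono[OF emb[OF f]] C(1) M(1) by simp
    then have "Lq_normp q \<nu> f powr (1 / q) \<le> (C * M * enn2real (J p f) powr (q / p)) powr (1 / q)"
      using q by (intro powr_mono2) (auto simp: Lq_normp_def)
    also have "enn2real (J p f) = V * Apw_normp p \<omega> f" using Apw_normp_eq[OF hf, of p] V by (simp add: V_def)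
    also have "(C * M * (V * Apw_normp p \<omega> f) powr (q / p)) powr (1 / q)
      = (C * M) powr (1 / q) * V powr (1 / p) * Apw_normp p \<omega> f powr (1 / p)"
      using q by (simp add: powr_mult powr_powr)
    finally show "Lq_normp q \<nu> f powr (1 / q) \<le> (C * M) powr (1 / q) * V powr (1 / p) * Apw_normp p \<omega> f powr (1 / p)" .
  qed
qed

text \<open>Take a pointwise convergent subsequence and split the ball at a radius \<open>R\<close>.
  Near the boundary the embedding with small averages makes the contribution uniformly small; on the
  inner ball, which has finite measure, the sequence is uniformly bounded and dominated convergence
  applies.\<close>

lemma vanishing_carleson_sufficient:
  assumes p: "p > 0" and pq: "p \<le> q" and sets: "sets \<nu> = sets Bn_borel"
    and H: "\<And>s. 0 < s \<Longrightarrow> s < 1 \<Longrightarrow> \<exists>M\<ge>0. \<forall>a\<in>Bn. emeasure \<nu> (pball a s) \<le> ennreal (M * W a powr (q / p))"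
    and H0: "\<And>\<epsilon>. \<epsilon> > 0 \<Longrightarrow> \<exists>R<1. \<forall>a\<in>Bn. norm a > R \<longrightarrow> emeasure \<nu> (pball a (3/4)) \<le> ennreal (\<epsilon> * W a powr (q / p))"
  shows "vanishing_carleson p \<omega> q \<nu>"
  unfolding vanishing_carleson_def compact_op_def
proof (intro conjI allI impI ballI)
  have q: "q > 0" using p pq by simp
  note car = carleson_sufficient[OF p pq sets H]
  have sp: "space \<nu> = Bn" using sets_eq_imp_space_eq[OF sets] by simp
  have [measurable]: "(\<lambda>x. x) \<in> measurable \<nu> borel"
    unfolding measurable_cong_sets[OF sets refl] Bn_borel_def by (rule measurable_restrict_space1) simp
  show inLq: "f \<in> Lq q \<nu>" if "f \<in> Apw p \<omega>" for f
    using car(1) that by (simp add: carleson_def bounded_op_def)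
  fix fs :: "nat \<Rightarrow> complex ^ 'n \<Rightarrow> complex"
  assume "(\<forall>k. fs k \<in> Apw p \<omega>) \<and> (\<exists>B. \<forall>k. Apw_normp p \<omega> (fs k) \<le> B)"
  then obtain B where fs: "\<And>k. fs k \<in> Apw p \<omega>" "\<And>k. Apw_normp p \<omega> (fs k) \<le> B" by blast
  have hfs: "holo_on (fs k) Bn" and Jfin: "J p (fs k) < \<infinity>" for k using fs(1)[of k] by (auto simp: Apw_iff)
  have [measurable]: "fs k \<in> borel_measurable \<nu>" for k by (rule measurable_holo_Bn_borel[OF hfs sets])
  define V where "V = Bn_vol TYPE('n)"
  have V: "V > 0" unfolding V_def by (rule Bn_vol_pos)
  define B1 where "B1 = V * \<bar>B\<bar>"
  have B1: "B1 \<ge> 0" using V by (simp add: B1_def)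
  have JB: "J p (fs k) \<le> ennreal B1" for k
  proof -
    have "enn2real (J p (fs k)) = V * Apw_normp p \<omega> (fs k)" using Apw_normp_eq[OF hfs, of p k] V by (simp add: V_def)
    also have "\<dots> \<le> B1" unfolding B1_def using fs(2)[of k] V by (intro mult_left_mono) auto
    finally have "ennreal (enn2real (J p (fs k))) \<le> ennreal B1" by (rule ennreal_leI)
    then show ?thesis using Jfin[of k] by simp
  qed
  obtain K where K: "K \<ge> 0" "\<And>f z. z \<in> Bn \<Longrightarrow> holo_on f Bn \<Longrightarrow> ennreal (W z * norm (f z) powr p) \<le> ennreal K * J p f"
    using holo_pointwise_J[OF p] by blast
  have locb: "\<exists>L. \<forall>k z. norm z \<le> r \<longrightarrow> norm (fs k z) \<le> L" if r: "r < 1" for r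
  proof -
    define r' where "r' = max r 0"
    have r': "0 \<le> r'" "r' < 1" "r \<le> r'" using r by (auto simp: r'_def)
    define w where "w = (1 - r') ^ CARD('n) * tail r'"
    have w: "w > 0" using r' tail_pos[of r'] by (simp add: w_def)
    have "norm (fs k z) \<le> (K * B1 / w) powr (1 / p)" if z: "norm z \<le> r" for k z
    proof -
      have zB: "z \<in> Bn" using z r by (simp add: Bn_iff)
      have "w \<le> W z" unfolding w_def W_def using z r' tail_nonneg[of r']
        by (intro mult_mono power_mono tail_antimono) auto
      then have "w * norm (fs k z) powr p \<le> W z * norm (fs k z) powr p" by (intro mult_right_mono) auto
      moreover have "ennreal (W z * norm (fs k z) powr p) \<le> ennreal (K * B1)"
        using order_trans[OF K(2)[OF zB hfs[of k]] mult_left_mono[OF JB[of k], of "ennreal K"]] K(1) B1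
        by (simp add: ennreal_mult)
      then have "W z * norm (fs k z) powr p \<le> K * B1" using K(1) B1 by simp
      ultimately have "norm (fs k z) powr p \<le> K * B1 / w" using w by (simp add: field_simps)
      then have "(norm (fs k z) powr p) powr (1 / p) \<le> (K * B1 / w) powr (1 / p)"
        using p by (intro powr_mono2) auto
      then show ?thesis using p by (simp add: powr_powr)
    qed
    then show ?thesis by blast
  qed
  obtain s where s: "strict_mono (s :: nat \<Rightarrow> nat)" and conv: "\<forall>z\<in>Bn. convergent (\<lambda>j. fs (s j) z)"
    by (rule holo_pointwise_subseq[where fs = fs, OF hfs locb])
  define g where "g z = lim (\<lambda>j. fs (s j) z)" for z
  have lim: "(\<lambda>j. fs (s j) z) \<longlonglongrightarrow> g z" if "z \<in> Bn" for z
    using conv that unfolding g_def by (simp add: convergent_LIMSEQ_iff)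
  have [measurable]: "g \<in> borel_measurable \<nu>"
    unfolding g_def[abs_def] by (rule borel_measurable_lim_metric) measurable
  define P where "P j z = ennreal (norm (fs (s j) z - g z) powr q)" for j z
  have [measurable]: "P j \<in> borel_measurable \<nu>" for j unfolding P_def[abs_def] by measurable
  obtain C where C0: "C \<ge> 0" "\<And>\<nu> X M f. sets \<nu> = sets Bn_borel \<Longrightarrow> X \<in> sets borel \<Longrightarrow> M \<ge> 0 \<Longrightarrow>
    (\<forall>s. 0 < s \<and> s < 1 \<longrightarrow> emeasure \<nu> (ball 0 s) < \<infinity>) \<Longrightarrow>
    (\<forall>a\<in>Bn. emeasure \<nu> (pball a (3/4) \<inter> X) \<le> ennreal (M * W a powr (q / p))) \<Longrightarrow>
    holo_on f Bn \<Longrightarrow> J p f < \<infinity> \<Longrightarrow>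
    (\<integral>\<^sup>+z. ennreal (norm (f z) powr q) * indicator X z \<partial>\<nu>) \<le> ennreal (C * M * enn2real (J p f) powr (q / p))"
    using carleson_embedding_Bn[OF p pq] by blast
  have fin: "\<forall>s. 0 < s \<and> s < 1 \<longrightarrow> emeasure \<nu> (ball 0 s) < \<infinity>" using car(2) by blast
  note C = C0(1) C0(2)[OF sets _ _ fin]
  define B2 where "B2 = 2 powr p * (B1 + B1)"
  have B2: "B2 \<ge> 0" using B1 by (simp add: B2_def)
  have Jd: "J p (\<lambda>z. fs i z - fs j z) \<le> ennreal B2" for i j
  proof -
    have "J p (\<lambda>z. fs i z - fs j z) \<le> ennreal (2 powr p) * (J p (fs i) + J p (fs j))"
      by (rule J_diff_le[OF hfs hfs p])
    also have "\<dots> \<le> ennreal (2 powr p) * (ennreal B1 + ennreal B1)"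
      by (intro mult_left_mono add_mono JB) simp
    also have "\<dots> = ennreal B2" using B1 by (simp add: B2_def flip: ennreal_plus ennreal_mult)
    finally show ?thesis .
  qed
  \<comment> \<open>The limit \<open>g\<close> is not known to be holomorphic, so the embedding is
    applied to the differences of two members of the sequence, and Fatou's lemma in the second index
    passes to \<open>g\<close>.\<close>
  have outer: "\<exists>R<1. \<forall>j. (\<integral>\<^sup>+z. P j z * indicator {z. norm z > R} z \<partial>\<nu>) \<le> ennreal \<epsilon>" if eps: "\<epsilon> > 0" for \<epsilon>
  proof -
    \<comment> \<open>With averages below \<open>\<epsilon> / D\<close> the embedding bounds each
      difference, whose \<open>J\<close> is at most \<open>B2\<close>, by \<open>\<epsilon>\<close>;
      the added 1 keeps \<open>D\<close> positive.\<close>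
    define D where "D = C * B2 powr (q / p) + 1"
    have D: "D > 0" using C(1) by (simp add: D_def add_nonneg_pos)
    obtain R0 where R0: "R0 < 1" "\<forall>a\<in>Bn. norm a > R0 \<longrightarrow> emeasure \<nu> (pball a (3/4)) \<le> ennreal (\<epsilon> / D * W a powr (q / p))"
      using H0[of "\<epsilon> / D"] eps D by auto
    \<comment> \<open>The 16 is the constant of \<open>pball_norm_comparable\<close>: if the ball
      about \<open>a\<close> reaches beyond radius \<open>R\<close>, then
      \<open>norm a > R0\<close>.\<close>
    define R where "R = 1 - (1 - R0) / 16"
    have R: "R < 1" using R0(1) by (simp add: R_def)
    let ?X = "{z :: complex ^ 'n. norm z > R}"
    have X[measurable]: "?X \<in> sets borel" by measurable
    have small: "\<forall>a\<in>Bn. emeasure \<nu> (pball a (3/4) \<inter> ?X) \<le> ennreal (\<epsilon> / D * W a powr (q / p))"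
    proof
      fix a :: "complex ^ 'n" assume a: "a \<in> Bn"
      show "emeasure \<nu> (pball a (3/4) \<inter> ?X) \<le> ennreal (\<epsilon> / D * W a powr (q / p))"
      proof (cases "pball a (3/4) \<inter> ?X = {}")
        case False
        then obtain z where z: "z \<in> pball a (3/4)" "norm z > R" by auto
        have "1 - norm a \<le> 2 ^ 4 * (1 - norm z)" by (rule pball_norm_comparable(2)[OF z(1)])
        also have "\<dots> < 2 ^ 4 * (1 - R)" using z(2) by simp
        also have "\<dots> = 1 - R0" by (simp add: R_def)
        finally have "norm a > R0" by simp
        then have "emeasure \<nu> (pball a (3/4)) \<le> ennreal (\<epsilon> / D * W a powr (q / p))" using R0(2) a by blast
        moreover have "emeasure \<nu> (pball a (3/4) \<inter> ?X) \<le> emeasure \<nu> (pball a (3/4))"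
          using pball_Bn_borel[of a "3/4"] by (intro emeasure_mono) (auto simp: sets)
        ultimately show ?thesis by (rule order_trans[rotated])
      qed simp
    qed
    have "(\<integral>\<^sup>+z. P j z * indicator ?X z \<partial>\<nu>) \<le> ennreal \<epsilon>" for j
    proof -
      have "(\<integral>\<^sup>+z. P j z * indicator ?X z \<partial>\<nu>) = (\<integral>\<^sup>+z. liminf (\<lambda>l. ennreal (norm (fs (s j) z - fs (s l) z) powr q) * indicator ?X z) \<partial>\<nu>)"
      proof (rule nn_integral_cong)
        fix z assume "z \<in> space \<nu>"
        then have "z \<in> Bn" by (simp add: sp)
        have "(\<lambda>l. norm (fs (s j) z - fs (s l) z) powr q) \<longlonglongrightarrow> norm (fs (s j) z - g z) powr q"
          using q lim[OF \<open>z \<in> Bn\<close>] by (intro tendsto_powr2 tendsto_norm tendsto_diff tendsto_const) auto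
        then have "(\<lambda>l. ennreal (norm (fs (s j) z - fs (s l) z) powr q)) \<longlonglongrightarrow> P j z"
          unfolding P_def by (rule tendsto_ennrealI)
        then have "(\<lambda>l. ennreal (norm (fs (s j) z - fs (s l) z) powr q) * indicator ?X z) \<longlonglongrightarrow> P j z * indicator ?X z"
          by (cases "z \<in> ?X") auto
        from lim_imp_Liminf[OF _ this] show "P j z * indicator ?X z = liminf (\<lambda>l. ennreal (norm (fs (s j) z - fs (s l) z) powr q) * indicator ?X z)"
          by simp
      qed
      also have "\<dots> \<le> liminf (\<lambda>l. \<integral>\<^sup>+z. ennreal (norm (fs (s j) z - fs (s l) z) powr q) * indicator ?X z \<partial>\<nu>)"
        by (rule nn_integral_liminf) measurable
      also have "\<dots> \<le> liminf (\<lambda>l::nat. ennreal \<epsilon>)"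
      proof (rule Liminf_mono, rule always_eventually, rule allI)
        fix l
        have Jl: "J p (\<lambda>z. fs (s j) z - fs (s l) z) < \<infinity>" using Jd[of "s j" "s l"] by (rule le_less_trans) simp
        have "enn2real (J p (\<lambda>z. fs (s j) z - fs (s l) z)) \<le> B2"
          using enn2real_mono[OF Jd[of "s j" "s l"]] B2 by simp
        then have "C * (\<epsilon> / D) * enn2real (J p (\<lambda>z. fs (s j) z - fs (s l) z)) powr (q / p) \<le> C * (\<epsilon> / D) * B2 powr (q / p)"
          using C(1) eps D p q by (intro mult_left_mono powr_mono2) auto
        also have "\<dots> = (C * B2 powr (q / p)) / D * \<epsilon>" by simp
        also have "\<dots> \<le> 1 * \<epsilon>" using eps D by (intro mult_right_mono) (auto simp: D_def)
        finally have b: "C * (\<epsilon> / D) * enn2real (J p (\<lambda>z. fs (s j) z - fs (s l) z)) powr (q / p) \<le> \<epsilon>" by simp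
        have "(\<integral>\<^sup>+z. ennreal (norm (fs (s j) z - fs (s l) z) powr q) * indicator ?X z \<partial>\<nu>)
          \<le> ennreal (C * (\<epsilon> / D) * enn2real (J p (\<lambda>z. fs (s j) z - fs (s l) z)) powr (q / p))"
          using eps D by (intro C(2)[OF X _ small _ Jl] holo_on_diff hfs) auto
        also have "\<dots> \<le> ennreal \<epsilon>" using b by (rule ennreal_leI)
        finally show "(\<integral>\<^sup>+z. ennreal (norm (fs (s j) z - fs (s l) z) powr q) * indicator ?X z \<partial>\<nu>) \<le> ennreal \<epsilon>" .
      qed
      also have "\<dots> = ennreal \<epsilon>" by (simp add: Liminf_const)
      finally show ?thesis .
    qed
    with R show ?thesis by blast
  qed
  have inner: "(\<lambda>j. \<integral>\<^sup>+z. P j z * indicator {z. norm z \<le> R} z \<partial>\<nu>) \<longlonglongrightarrow> 0" if R: "R < 1" for R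
  proof -
    obtain L where L: "\<And>k z. norm z \<le> R \<Longrightarrow> norm (fs k z) \<le> L" using locb[OF R] by blast
    let ?Y = "{z :: complex ^ 'n. norm z \<le> R}"
    have [measurable]: "?Y \<in> sets borel" by measurable
    have gL: "norm (g z) \<le> L" if "z \<in> Bn" "norm z \<le> R" for z
      using Lim_bounded[OF tendsto_norm[OF lim[OF that(1)]], of 0 L] L that by auto
    have "(\<lambda>j. \<integral>\<^sup>+z. P j z * indicator ?Y z \<partial>\<nu>) \<longlonglongrightarrow> (\<integral>\<^sup>+z. 0 \<partial>\<nu>)"
    proof (rule nn_integral_dominated_convergence[where w = "\<lambda>z. ennreal ((2 * L) powr q) * indicator ?Y z"])
      show "AE z in \<nu>. P j z * indicator ?Y z \<le> ennreal ((2 * L) powr q) * indicator ?Y z" for j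
      proof (rule AE_I2)
        fix z assume "z \<in> space \<nu>"
        then have z: "z \<in> Bn" by (simp add: sp)
        show "P j z * indicator ?Y z \<le> ennreal ((2 * L) powr q) * indicator ?Y z"
        proof (cases "norm z \<le> R")
          case True
          have "norm (fs (s j) z - g z) \<le> norm (fs (s j) z) + norm (g z)" by (rule norm_triangle_ineq4)
          also have "\<dots> \<le> 2 * L" using L[OF True, of "s j"] gL[OF z True] by simp
          finally show ?thesis unfolding P_def using True q by (auto intro!: ennreal_leI powr_mono2)
        qed simp
      qed
      have "ball 0 ((1 + max R 0) / 2) \<in> sets \<nu>" (is "?A \<in> _")
        unfolding sets using pball_Bn_borel[of 0 "(1 + max R 0) / 2"] R by (simp add: pball_0)
      then have "(\<integral>\<^sup>+z. ennreal ((2 * L) powr q) * indicator ?Y z \<partial>\<nu>) \<le> ennreal ((2 * L) powr q) * emeasure \<nu> ?A"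
        by (subst nn_integral_cmult_indicator[symmetric]) (use R in \<open>auto intro!: nn_integral_mono split: split_indicator\<close>)
      also have "\<dots> < \<infinity>" using car(2)[of "(1 + max R 0) / 2"] R by (simp add: ennreal_mult_less_top)
      finally show "(\<integral>\<^sup>+z. ennreal ((2 * L) powr q) * indicator ?Y z \<partial>\<nu>) < \<infinity>" .
      show "AE z in \<nu>. (\<lambda>j. P j z * indicator ?Y z) \<longlonglongrightarrow> 0"
      proof (rule AE_I2)
        fix z assume "z \<in> space \<nu>"
        then have z: "z \<in> Bn" by (simp add: sp)
        have "(\<lambda>j. norm (fs (s j) z - g z) powr q) \<longlonglongrightarrow> norm (g z - g z) powr q"
          using q lim[OF z] by (intro tendsto_powr2 tendsto_norm tendsto_diff tendsto_const) auto
        then have "(\<lambda>j. P j z) \<longlonglongrightarrow> ennreal 0" unfolding P_def using q by (intro tendsto_ennrealI) simp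
        then show "(\<lambda>j. P j z * indicator ?Y z) \<longlonglongrightarrow> 0" by (cases "z \<in> ?Y") auto
      qed
    qed measurable
    then show ?thesis by simp
  qed
  have to0: "(\<lambda>j. \<integral>\<^sup>+z. P j z \<partial>\<nu>) \<longlonglongrightarrow> 0"
  proof (rule order_tendstoI)
    fix e :: ennreal assume "e > 0"
    then obtain \<epsilon> where eps: "\<epsilon> > 0" "ennreal (\<epsilon> + \<epsilon>) < e"
    proof -
      obtain x where x: "0 < x" "x < e" using dense[OF \<open>e > 0\<close>] by blast
      then have "x < top" using less_le_trans[of x e top] by simp
      then obtain y where y: "x = ennreal y" "y \<ge> 0" by (cases x) auto
      then have "y > 0" using x(1) by auto
      then show thesis using that[of "y / 2"] x(2) y(1) by simp
    qed
    obtain R where R: "R < 1" "\<And>j. (\<integral>\<^sup>+z. P j z * indicator {z. norm z > R} z \<partial>\<nu>) \<le> ennreal \<epsilon>"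
      using outer[OF eps(1)] by blast
    have "eventually (\<lambda>j. (\<integral>\<^sup>+z. P j z * indicator {z. norm z \<le> R} z \<partial>\<nu>) < ennreal \<epsilon>) sequentially"
      using order_tendstoD(2)[OF inner[OF R(1)], of "ennreal \<epsilon>"] eps(1) by simp
    then show "eventually (\<lambda>j. (\<integral>\<^sup>+z. P j z \<partial>\<nu>) < e) sequentially"
    proof eventually_elim
      case (elim j)
      have "(\<integral>\<^sup>+z. P j z \<partial>\<nu>) = (\<integral>\<^sup>+z. P j z * indicator {z. norm z \<le> R} z + P j z * indicator {z. norm z > R} z \<partial>\<nu>)"
        by (rule nn_integral_cong) (auto split: split_indicator)
      also have "\<dots> = (\<integral>\<^sup>+z. P j z * indicator {z. norm z \<le> R} z \<partial>\<nu>) + (\<integral>\<^sup>+z. P j z * indicator {z. norm z > R} z \<partial>\<nu>)"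
        by (rule nn_integral_add) measurable
      also have "\<dots> \<le> ennreal \<epsilon> + ennreal \<epsilon>" using elim R(2)[of j] by (intro add_mono) auto
      also have "\<dots> < e" using eps by (simp flip: ennreal_plus)
      finally show ?case .
    qed
  qed simp
  have gLq: "g \<in> Lq q \<nu>"
  proof -
    have "eventually (\<lambda>j. (\<integral>\<^sup>+z. P j z \<partial>\<nu>) < 1) sequentially" using order_tendstoD(2)[OF to0, of 1] by simp
    then obtain j where j: "(\<integral>\<^sup>+z. P j z \<partial>\<nu>) < 1" by (auto simp: eventually_sequentially)
    have "(\<integral>\<^sup>+z. ennreal (norm (fs (s j) z + (g z - fs (s j) z)) powr q) \<partial>\<nu>)
      \<le> ennreal (2 powr q) * ((\<integral>\<^sup>+z. ennreal (norm (fs (s j) z) powr q) \<partial>\<nu>) + (\<integral>\<^sup>+z. ennreal (norm (g z - fs (s j) z) powr q) \<partial>\<nu>))"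
      by (rule nn_integral_powr_add_le) (use q in auto)
    also have "\<dots> < \<infinity>"
      using inLq[OF fs(1), of "s j"] less_trans[OF j ennreal_one_less_top]
      by (simp add: Lq_def ennreal_mult_less_top P_def norm_minus_commute)
    finally show ?thesis by (simp add: Lq_def)
  qed
  have "(\<lambda>j. Lq_normp q \<nu> (\<lambda>z. fs (s j) z - g z)) \<longlonglongrightarrow> 0"
  proof -
    have "(\<lambda>j. \<integral>\<^sup>+z. P j z \<partial>\<nu>) \<longlonglongrightarrow> ennreal 0" using to0 by simp
    from tendsto_enn2real[OF this] show ?thesis unfolding Lq_normp_def P_def by simp
  qed
  with s gLq show "\<exists>s g. strict_mono s \<and> g \<in> Lq q \<nu> \<and> (\<lambda>j. Lq_normp q \<nu> (\<lambda>z. fs (s j) z - g z)) \<longlonglongrightarrow> 0"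
    by blast
qed

end

section \<open>Differences of weighted composition operators\<close>

lemma holo_map_on_continuous:
  fixes F :: "complex ^ 'n \<Rightarrow> complex ^ 'm"
  assumes "holo_map_on F S" shows "continuous_on S F"
proof -
  have "continuous_on S (\<lambda>z. \<chi> j. F z $ j)"
    using assms by (intro continuous_on_vec_lambda holo_on_continuous) (simp add: holo_map_on_def)
  then show ?thesis by simp
qed

lemma holo_self_map_measurable:
  fixes \<phi> :: "complex ^ 'n \<Rightarrow> complex ^ 'n"
  assumes \<phi>: "holo_self_map \<phi>" and sets: "sets \<mu> = sets (Bn_borel :: (complex ^ 'n) measure)"
  shows "\<phi> \<in> measurable \<mu> borel" "\<phi> \<in> measurable \<mu> Bn_borel"
proof -
  have "\<phi> \<in> measurable Bn_borel borel"
    using \<phi> unfolding holo_self_map_def Bn_borel_def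
    by (intro borel_measurable_continuous_on_restrict holo_map_on_continuous) simp
  then show 1: "\<phi> \<in> measurable \<mu> borel" unfolding measurable_cong_sets[OF sets refl] .
  show "\<phi> \<in> measurable \<mu> Bn_borel"
    unfolding Bn_borel_def
    using 1 \<phi> sets_eq_imp_space_eq[OF sets] by (intro measurable_restrict_space2) (auto simp: holo_self_map_def)
qed

lemma emeasure_pushfwd:
  assumes sets: "sets \<mu> = sets (Bn_borel :: (complex ^ 'n) measure)"
    and [measurable]: "\<phi> \<in> measurable \<mu> Bn_borel" "g \<in> borel_measurable \<mu>" and A[measurable]: "A \<in> sets Bn_borel"
  shows "emeasure (pushfwd \<mu> g \<phi>) A = (\<integral>\<^sup>+z. g z * indicator A (\<phi> z) \<partial>\<mu>)"
proof -
  have "emeasure (pushfwd \<mu> g \<phi>) A = emeasure (density \<mu> g) (\<phi> -` A \<inter> space \<mu>)"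
    unfolding pushfwd_def by (subst emeasure_distr) auto
  also have "\<dots> = (\<integral>\<^sup>+z. g z * indicator (\<phi> -` A \<inter> space \<mu>) z \<partial>\<mu>)"
    by (subst emeasure_density) auto
  also have "\<dots> = (\<integral>\<^sup>+z. g z * indicator A (\<phi> z) \<partial>\<mu>)"
    by (rule nn_integral_cong) (auto split: split_indicator)
  finally show ?thesis .
qed

lemma sets_pushfwd [simp]: "sets (pushfwd \<mu> g \<phi>) = sets Bn_borel"
  by (simp add: pushfwd_def)

section \<open>Isolating rho u and u - v by test functions\<close>

locale wcomp_pair = D_weight \<omega> ty for \<omega> and ty :: "'n::finite itself" +
  fixes p q :: real and \<phi> \<psi> :: "complex ^ 'n \<Rightarrow> complex ^ 'n" and u v :: "complex ^ 'n \<Rightarrow> complex"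
    and \<mu> :: "(complex ^ 'n) measure"
  assumes p: "0 < p" and pq: "p \<le> q"
    and phi: "holo_self_map \<phi>" and psi: "holo_self_map \<psi>"
    and u: "u \<in> borel_measurable Bn_borel" and v: "v \<in> borel_measurable Bn_borel"
    and sets_mu: "sets \<mu> = sets (Bn_borel :: (complex ^ 'n) measure)"
begin

lemma q: "0 < q" using p pq by simp

lemma space_mu: "space \<mu> = Bn"
  using sets_eq_imp_space_eq[OF sets_mu] by simp

lemma phi_Bn: "z \<in> Bn \<Longrightarrow> \<phi> z \<in> Bn" and psi_Bn: "z \<in> Bn \<Longrightarrow> \<psi> z \<in> Bn"
  using phi psi by (auto simp: holo_self_map_def)

lemma measurable_mu [measurable]:
  "\<phi> \<in> measurable \<mu> borel" "\<psi> \<in> measurable \<mu> borel" "\<phi> \<in> measurable \<mu> Bn_borel" "\<psi> \<in> measurable \<mu> Bn_borel"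
  "u \<in> borel_measurable \<mu>" "v \<in> borel_measurable \<mu>"
  using holo_self_map_measurable[OF phi sets_mu] holo_self_map_measurable[OF psi sets_mu] u v
  by (auto simp: measurable_cong_sets[OF sets_mu refl])

definition \<rho> :: "complex ^ 'n \<Rightarrow> real" where "\<rho> z = pseudo_hyp (\<phi> z) (\<psi> z)"

lemma rho_measurable [measurable]: "\<rho> \<in> borel_measurable \<mu>"
  unfolding \<rho>_def[abs_def]
  by (rule borel_measurable_pseudo_hyp) (use phi_Bn psi_Bn in \<open>auto simp: space_mu Bn_iff\<close>)

abbreviation T :: "(complex ^ 'n \<Rightarrow> complex) \<Rightarrow> complex ^ 'n \<Rightarrow> complex" where
  "T \<equiv> wcomp_diff u \<phi> v \<psi>"

lemma T_measurable: "holo_on f Bn \<Longrightarrow> T f \<in> borel_measurable \<mu>"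
proof -
  assume f: "holo_on f Bn"
  have [measurable]: "f \<in> borel_measurable Bn_borel" by (rule measurable_holo_Bn_borel[OF f refl])
  show ?thesis unfolding wcomp_diff_def by measurable
qed

definition TI :: "(complex ^ 'n \<Rightarrow> complex) \<Rightarrow> ennreal" where
  "TI f = (\<integral>\<^sup>+z. ennreal (norm (T f z) powr q) \<partial>\<mu>)"

text \<open>The one quantity through which the operator enters: bounded in \<open>a\<close> when
  \<open>T\<close> is bounded on the test functions, and tending to 0 at the boundary when
  \<open>T\<close> is compact.\<close>

definition TS :: "nat \<Rightarrow> complex ^ 'n \<Rightarrow> ennreal" where
  "TS \<gamma> a = (\<Sum>i\<in>UNIV. TI (tests p \<gamma> a i))"

text \<open>For each component of the automorphism the combination of two test functions yields one
  component of \<open>X - Y\<close>, and \<open>pseudo_hyp_le\<close> recovers the distance from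
  their sum. One factor \<open>1 - s\<close> is spent there and \<open>\<gamma>\<close> of them on
  the lower bound for \<open>tfun\<close>; \<open>CARD('n)\<close> counts the components.\<close>

lemma rho_u_le:
  assumes a: "a \<in> Bn" and z: "z \<in> Bn" and s: "0 < s" "s < 1" and ph: "\<phi> z \<in> pball a s"
  shows "norm (of_real (\<rho> z) * u z) * (W a powr (- 1 / p) * (1 - s) ^ (\<gamma> + 1))
    \<le> real CARD('n) * (\<Sum>i\<in>UNIV. norm (T (tests p \<gamma> a i) z))"
proof -
  define X Y where "X = autom a (\<phi> z)" and "Y = autom a (\<psi> z)"
  have n: "norm a < 1" "norm (\<phi> z) < 1" "norm (\<psi> z) < 1" using a phi_Bn[OF z] psi_Bn[OF z] by (auto simp: Bn_iff)
  have XY: "norm X < 1" "norm Y < 1" using n by (auto simp: X_def Y_def norm_autom_less_1)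
  have Xs: "norm X < s" using ph n s by (simp add: pball_iff pseudo_hyp_def X_def)
  define f where "f = tfun p \<gamma> a"
  define S where "S = (\<Sum>i\<in>UNIV. norm (T (tests p \<gamma> a i) z))"
  have S: "S = norm (T (tests p \<gamma> a None) z) + (\<Sum>j\<in>UNIV. norm (T (tests p \<gamma> a (Some j)) z))"
    unfolding S_def UNIV_option_conv by (subst sum.insert) (auto simp: sum.reindex)
  have comp: "norm (u z) * norm (f (\<phi> z)) * norm ((X - Y) $ j) \<le> S" for j
  proof -
    have "u z * f (\<phi> z) * (X - Y) $ j = T (tests p \<gamma> a (Some j)) z - Y $ j * T (tests p \<gamma> a None) z"
      by (simp add: wcomp_diff_def tests_def f_def X_def Y_def algebra_simps)
    then have "norm (u z) * norm (f (\<phi> z)) * norm ((X - Y) $ j) = norm (T (tests p \<gamma> a (Some j)) z - Y $ j * T (tests p \<gamma> a None) z)"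
      by (metis norm_mult)
    also have "\<dots> \<le> norm (T (tests p \<gamma> a (Some j)) z) + norm (Y $ j) * norm (T (tests p \<gamma> a None) z)"
      by (metis norm_mult norm_triangle_ineq4)
    also have "\<dots> \<le> (\<Sum>j\<in>UNIV. norm (T (tests p \<gamma> a (Some j)) z)) + norm (T (tests p \<gamma> a None) z)"
      using norm_vec_nth_le_1[OF XY(2), of j]
      by (intro add_mono member_le_sum mult_left_le_one_le) auto
    finally show ?thesis by (simp add: S)
  qed
  have "(1 - s) * \<rho> z \<le> (1 - norm X) * \<rho> z" using Xs by (intro mult_right_mono) (auto simp: \<rho>_def)
  also have "\<dots> \<le> norm (X - Y)"
    using pseudo_hyp_le[OF XY] n by (simp add: X_def Y_def pseudo_hyp_autom \<rho>_def)
  also have "\<dots> \<le> (\<Sum>j\<in>UNIV. norm ((X - Y) $ j))" by (rule norm_vec_le_sum)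
  finally have r: "(1 - s) * \<rho> z \<le> (\<Sum>j\<in>UNIV. norm ((X - Y) $ j))" .
  have r0: "\<rho> z \<ge> 0" by (simp add: \<rho>_def)
  have "norm (of_real (\<rho> z) * u z) * (W a powr (- 1 / p) * (1 - s) ^ (\<gamma> + 1))
    = norm (u z) * (W a powr (- 1 / p) * (1 - s) ^ \<gamma>) * ((1 - s) * \<rho> z)"
    using r0 by (simp add: norm_mult)
  also have "\<dots> \<le> norm (u z) * norm (f (\<phi> z)) * (\<Sum>j\<in>UNIV. norm ((X - Y) $ j))"
    using norm_tfun_ge[OF a s ph, of p \<gamma>] r r0 s by (intro mult_mono mult_left_mono) (auto simp: f_def)
  also have "\<dots> = (\<Sum>j\<in>UNIV. norm (u z) * norm (f (\<phi> z)) * norm ((X - Y) $ j))" by (simp add: sum_distrib_left)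
  also have "\<dots> \<le> (\<Sum>j\<in>(UNIV :: 'n set). S)" by (intro sum_mono comp)
  finally show ?thesis by (simp add: S_def)
qed

lemma eta_le:
  assumes s: "0 < s" "s < 1"
  shows "\<exists>K\<ge>0. \<forall>a\<in>Bn. (\<integral>\<^sup>+z. ennreal (norm (of_real (\<rho> z) * u z) powr q) * indicator (pball a s) (\<phi> z) \<partial>\<mu>)
    \<le> ennreal (K * W a powr (q / p)) * TS \<gamma> a"
proof -
  define N where "N = real (card (UNIV :: 'n option set))"
  define c where "c = (1 - s) ^ (\<gamma> + 1)"
  have c: "c > 0" using s by (simp add: c_def)
  define K where "K = (real CARD('n) / c) powr q * N powr q"
  show ?thesis
  proof (intro exI[of _ K] conjI ballI)
    show "K \<ge> 0" by (simp add: K_def)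
    fix a :: "complex ^ 'n" assume a: "a \<in> Bn"
    note W = W_pos[OF a]
    have hol: "holo_on (tests p \<gamma> a i) Bn" for i by (rule holo_tests[OF a])
    have [measurable]: "T (tests p \<gamma> a i) \<in> borel_measurable \<mu>" for i by (rule T_measurable[OF hol])
    have "(\<integral>\<^sup>+z. ennreal (norm (of_real (\<rho> z) * u z) powr q) * indicator (pball a s) (\<phi> z) \<partial>\<mu>)
      \<le> (\<integral>\<^sup>+z. ennreal (K * W a powr (q / p)) * (\<Sum>i\<in>UNIV. ennreal (norm (T (tests p \<gamma> a i) z) powr q)) \<partial>\<mu>)"
    proof (rule nn_integral_mono)
      fix z assume "z \<in> space \<mu>"
      then have z: "z \<in> Bn" by (simp add: space_mu)
      show "ennreal (norm (of_real (\<rho> z) * u z) powr q) * indicator (pball a s) (\<phi> z)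
        \<le> ennreal (K * W a powr (q / p)) * (\<Sum>i\<in>UNIV. ennreal (norm (T (tests p \<gamma> a i) z) powr q))"
      proof (cases "\<phi> z \<in> pball a s")
        case True
        let ?S = "\<Sum>i\<in>UNIV. norm (T (tests p \<gamma> a i) z)"
        have S0: "?S \<ge> 0" by (intro sum_nonneg) auto
        have Wp: "W a powr (- 1 / p) * W a powr (1 / p) = 1" using W by (simp flip: powr_add)
        define x where "x = norm (of_real (\<rho> z) * u z)"
        have "x * (W a powr (- 1 / p) * c) \<le> real CARD('n) * ?S"
          unfolding x_def c_def by (rule rho_u_le[OF a z s True])
        then have "x * (W a powr (- 1 / p) * c) * (W a powr (1 / p) / c) \<le> real CARD('n) * ?S * (W a powr (1 / p) / c)"
          using c by (intro mult_right_mono) auto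
        moreover have "x * (W a powr (- 1 / p) * c) * (W a powr (1 / p) / c) = x * (W a powr (- 1 / p) * W a powr (1 / p))"
          using c by simp
        ultimately have "x \<le> real CARD('n) / c * W a powr (1 / p) * ?S" unfolding Wp by (simp add: mult_ac)
        then have "x powr q \<le> (real CARD('n) / c * W a powr (1 / p) * ?S) powr q"
          using q by (intro powr_mono2) (auto simp: x_def)
        also have "\<dots> = (real CARD('n) / c) powr q * W a powr (q / p) * ?S powr q"
          unfolding powr_mult powr_powr by simp
        also have "\<dots> \<le> (real CARD('n) / c) powr q * W a powr (q / p) * (N powr q * (\<Sum>i\<in>UNIV. norm (T (tests p \<gamma> a i) z) powr q))"
          unfolding N_def using q by (intro mult_left_mono powr_sum_le) auto
        also have "\<dots> = K * W a powr (q / p) * (\<Sum>i\<in>UNIV. norm (T (tests p \<gamma> a i) z) powr q)"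
          by (simp add: K_def)
        finally have "ennreal (x powr q) \<le> ennreal (K * W a powr (q / p) * (\<Sum>i\<in>UNIV. norm (T (tests p \<gamma> a i) z) powr q))"
          by (rule ennreal_leI)
        also have "\<dots> = ennreal (K * W a powr (q / p)) * (\<Sum>i\<in>UNIV. ennreal (norm (T (tests p \<gamma> a i) z) powr q))"
          by (subst ennreal_mult) (auto simp: K_def sum_nonneg sum_ennreal)
        finally show ?thesis using True by (simp add: x_def)
      qed simp
    qed
    also have "\<dots> = ennreal (K * W a powr (q / p)) * (\<integral>\<^sup>+z. (\<Sum>i\<in>UNIV. ennreal (norm (T (tests p \<gamma> a i) z) powr q)) \<partial>\<mu>)"
      by (rule nn_integral_cmult) measurable
    also have "(\<integral>\<^sup>+z. (\<Sum>i\<in>UNIV. ennreal (norm (T (tests p \<gamma> a i) z) powr q)) \<partial>\<mu>) = TS \<gamma> a"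
      unfolding TS_def TI_def by (rule nn_integral_sum) measurable
    finally show "(\<integral>\<^sup>+z. ennreal (norm (of_real (\<rho> z) * u z) powr q) * indicator (pball a s) (\<phi> z) \<partial>\<mu>)
      \<le> ennreal (K * W a powr (q / p)) * TS \<gamma> a" .
  qed
qed

text \<open>Moving the test function from \<open>\<phi> z\<close> to \<open>\<psi> z\<close> costs a
  factor \<open>\<rho> z\<close>, so the error is of the form \<open>\<rho> v\<close>, which the
  estimate for \<open>\<psi>\<close> already controls. Multiplying through by
  \<open>W a powr (1 / p)\<close> removes the normalisation from the error term.\<close>

lemma u_minus_v_le:
  assumes a: "a \<in> Bn" and z: "z \<in> Bn" and s: "0 < s" "s < 1" and ph: "\<phi> z \<in> pball a s"
  shows "norm (u z - v z) * (1 - s) ^ \<gamma> \<le>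
     W a powr (1 / p) * norm (T (tests p \<gamma> a None) z) + 2 ^ \<gamma> * real \<gamma> * (2 / (1 - s)) * norm (of_real (\<rho> z) * v z)"
proof -
  note W = W_pos[OF a]
  have Wp: "W a powr (1 / p) * W a powr (- 1 / p) = 1" using W by (simp flip: powr_add)
  let ?f = "tfun p \<gamma> a"
  have "(u z - v z) * ?f (\<phi> z) = T (tests p \<gamma> a None) z - v z * (?f (\<phi> z) - ?f (\<psi> z))"
    by (simp add: wcomp_diff_def tests_def algebra_simps)
  then have "norm (u z - v z) * norm (?f (\<phi> z)) \<le> norm (T (tests p \<gamma> a None) z) + norm (v z) * norm (?f (\<phi> z) - ?f (\<psi> z))"
    by (metis norm_mult norm_triangle_ineq4)
  also have "\<dots> \<le> norm (T (tests p \<gamma> a None) z) + norm (v z) * (W a powr (- 1 / p) * (2 ^ \<gamma> * real \<gamma> * (2 / (1 - s)) * \<rho> z))"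
    unfolding \<rho>_def by (intro add_left_mono mult_left_mono norm_tfun_diff_le[OF a s ph psi_Bn[OF z]]) auto
  finally have "norm (u z - v z) * (W a powr (- 1 / p) * (1 - s) ^ \<gamma>) \<le> norm (T (tests p \<gamma> a None) z) + norm (v z) * (W a powr (- 1 / p) * (2 ^ \<gamma> * real \<gamma> * (2 / (1 - s)) * \<rho> z))"
    using mult_left_mono[OF norm_tfun_ge[OF a s ph, of p \<gamma>], of "norm (u z - v z)"] by simp
  then have "W a powr (1 / p) * (norm (u z - v z) * (W a powr (- 1 / p) * (1 - s) ^ \<gamma>))
    \<le> W a powr (1 / p) * (norm (T (tests p \<gamma> a None) z) + norm (v z) * (W a powr (- 1 / p) * (2 ^ \<gamma> * real \<gamma> * (2 / (1 - s)) * \<rho> z)))"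
    by (rule mult_left_mono) simp
  also have "W a powr (1 / p) * (norm (u z - v z) * (W a powr (- 1 / p) * (1 - s) ^ \<gamma>))
    = (W a powr (1 / p) * W a powr (- 1 / p)) * (norm (u z - v z) * (1 - s) ^ \<gamma>)" by (simp only: mult_ac)
  also have "W a powr (1 / p) * (norm (T (tests p \<gamma> a None) z) + norm (v z) * (W a powr (- 1 / p) * (2 ^ \<gamma> * real \<gamma> * (2 / (1 - s)) * \<rho> z)))
    = W a powr (1 / p) * norm (T (tests p \<gamma> a None) z) + (W a powr (1 / p) * W a powr (- 1 / p)) * (2 ^ \<gamma> * real \<gamma> * (2 / (1 - s)) * (\<rho> z * norm (v z)))"
    by (simp only: distrib_left mult_ac)
  finally show ?thesis unfolding Wp by (simp add: norm_mult \<rho>_def)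
qed

text \<open>On \<open>G\<close> the points \<open>\<phi> z\<close> and \<open>\<psi> z\<close> are
  at distance below \<open>r\<close>, so \<open>\<phi> z\<close> in the ball of radius
  \<open>s\<close> about \<open>a\<close> forces \<open>\<psi> z\<close> into the ball of the larger
  radius \<open>s'\<close> from \<open>pseudo_hyp_enlarge\<close>. The error \<open>\<rho> v\<close>
  is then bounded by the assumption \<open>eta\<close> at radius \<open>s'\<close>, and for this it
  is assumed at all radii.\<close>

lemma sigma_le:
  assumes s: "0 < s" "s < 1" and r: "0 < r" "r < 1"
    and G: "\<And>z. z \<in> G \<Longrightarrow> z \<in> Bn \<and> \<rho> z < r"
    and eta: "\<And>s. 0 < s \<Longrightarrow> s < 1 \<Longrightarrow> \<exists>K\<ge>0. \<forall>a\<in>Bn. (\<integral>\<^sup>+z. ennreal (norm (of_real (\<rho> z) * v z) powr q) * indicator (pball a s) (\<psi> z) \<partial>\<mu>)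
    \<le> ennreal (K * W a powr (q / p)) * TS \<gamma> a"
  shows "\<exists>K\<ge>0. \<forall>a\<in>Bn. (\<integral>\<^sup>+z. indicator G z * ennreal (norm (u z - v z) powr q) * indicator (pball a s) (\<phi> z) \<partial>\<mu>)
    \<le> ennreal (K * W a powr (q / p)) * TS \<gamma> a"
proof -
  define s' where "s' = sqrt (1 - (1 - r\<^sup>2) * (1 - s)\<^sup>2)"
  have "0 < (1 - r\<^sup>2) * (1 - s)\<^sup>2" using r s by (intro mult_pos_pos) (auto simp: abs_square_less_1)
  moreover have "(1 - r\<^sup>2) * (1 - s)\<^sup>2 < 1 * 1"
    using r s by (intro mult_strict_mono) (auto simp: power_less_one_iff abs_square_less_1)
  ultimately have s': "0 < s'" "s' < 1" by (auto simp: s'_def)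
  obtain K0 where K0: "K0 \<ge> 0" "\<And>a. a \<in> Bn \<Longrightarrow> (\<integral>\<^sup>+z. ennreal (norm (of_real (\<rho> z) * v z) powr q) * indicator (pball a s') (\<psi> z) \<partial>\<mu>)
    \<le> ennreal (K0 * W a powr (q / p)) * TS \<gamma> a"
    using eta[OF s'] by blast
  define c where "c = (1 - s) ^ \<gamma>"
  have c: "c > 0" using s by (simp add: c_def)
  define D where "D = 2 ^ \<gamma> * real \<gamma> * (2 / (1 - s))"
  have D: "D \<ge> 0" using s by (simp add: D_def)
  define A where "A = (1 / c) powr q * 2 powr q"
  have A: "A \<ge> 0" by (simp add: A_def)
  show ?thesis
  proof (intro exI[of _ "A * (1 + D powr q * K0)"] conjI ballI)
    show "A * (1 + D powr q * K0) \<ge> 0" using A K0 by simp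
    fix a :: "complex ^ 'n" assume a: "a \<in> Bn"
    note W = W_pos[OF a]
    have [measurable]: "T (tests p \<gamma> a i) \<in> borel_measurable \<mu>" for i by (rule T_measurable[OF holo_tests[OF a]])
    let ?E = "\<lambda>z. ennreal (norm (of_real (\<rho> z) * v z) powr q) * indicator (pball a s') (\<psi> z)"
    let ?F = "\<lambda>z. ennreal (norm (T (tests p \<gamma> a None) z) powr q)"
    have "(\<integral>\<^sup>+z. indicator G z * ennreal (norm (u z - v z) powr q) * indicator (pball a s) (\<phi> z) \<partial>\<mu>)
      \<le> (\<integral>\<^sup>+z. ennreal A * (ennreal (W a powr (q / p)) * ?F z + ennreal (D powr q) * ?E z) \<partial>\<mu>)"
    proof (rule nn_integral_mono)
      fix z assume "z \<in> space \<mu>"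
      then have z: "z \<in> Bn" by (simp add: space_mu)
      show "indicator G z * ennreal (norm (u z - v z) powr q) * indicator (pball a s) (\<phi> z)
        \<le> ennreal A * (ennreal (W a powr (q / p)) * ?F z + ennreal (D powr q) * ?E z)"
      proof (cases "z \<in> G \<and> \<phi> z \<in> pball a s")
        case True
        have n: "norm a < 1" "norm (\<phi> z) < 1" "norm (\<psi> z) < 1" using a phi_Bn[OF z] psi_Bn[OF z] by (auto simp: Bn_iff)
        have "pseudo_hyp a (\<phi> z) < s" using True n s by (simp add: pball_iff)
        moreover have "pseudo_hyp (\<phi> z) (\<psi> z) < r" using True G[of z] by (simp add: \<rho>_def)
        ultimately have "pseudo_hyp a (\<psi> z) < s'"
          unfolding s'_def using n s r by (intro pseudo_hyp_enlarge) auto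
        then have ps: "\<psi> z \<in> pball a s'" using n s' by (simp add: pball_iff)
        define x where "x = W a powr (1 / p) * norm (T (tests p \<gamma> a None) z)"
        define y where "y = D * norm (of_real (\<rho> z) * v z)"
        have "norm (u z - v z) * c \<le> x + y"
          unfolding c_def x_def y_def D_def using True by (intro u_minus_v_le[OF a z s]) auto
        then have "norm (u z - v z) \<le> 1 / c * (x + y)" using c by (simp add: field_simps)
        then have "norm (u z - v z) powr q \<le> (1 / c * (x + y)) powr q" using q by (intro powr_mono2) auto
        also have "\<dots> = (1 / c) powr q * (x + y) powr q" by (rule powr_mult)
        also have "\<dots> \<le> (1 / c) powr q * (2 powr q * (x powr q + y powr q))"
          using D q by (intro mult_left_mono powr_add_le) (auto simp: x_def y_def)
        also have "\<dots> = A * (W a powr (q / p) * norm (T (tests p \<gamma> a None) z) powr q + D powr q * norm (of_real (\<rho> z) * v z) powr q)"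
          by (simp add: A_def x_def y_def powr_mult powr_powr)
        finally have "ennreal (norm (u z - v z) powr q) \<le> ennreal (A * (W a powr (q / p) * norm (T (tests p \<gamma> a None) z) powr q + D powr q * norm (of_real (\<rho> z) * v z) powr q))"
          by (rule ennreal_leI)
        also have "\<dots> = ennreal A * (ennreal (W a powr (q / p)) * ?F z + ennreal (D powr q) * ennreal (norm (of_real (\<rho> z) * v z) powr q))"
          using A by (simp add: ennreal_mult ennreal_plus)
        finally show ?thesis using True ps by simp
      qed auto
    qed
    also have "\<dots> = ennreal A * (\<integral>\<^sup>+z. ennreal (W a powr (q / p)) * ?F z + ennreal (D powr q) * ?E z \<partial>\<mu>)"
      by (rule nn_integral_cmult) measurable
    also have "(\<integral>\<^sup>+z. ennreal (W a powr (q / p)) * ?F z + ennreal (D powr q) * ?E z \<partial>\<mu>)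
      = (\<integral>\<^sup>+z. ennreal (W a powr (q / p)) * ?F z \<partial>\<mu>) + (\<integral>\<^sup>+z. ennreal (D powr q) * ?E z \<partial>\<mu>)"
      by (rule nn_integral_add) measurable
    also have "(\<integral>\<^sup>+z. ennreal (W a powr (q / p)) * ?F z \<partial>\<mu>) = ennreal (W a powr (q / p)) * TI (tests p \<gamma> a None)"
      unfolding TI_def by (rule nn_integral_cmult) measurable
    also have "(\<integral>\<^sup>+z. ennreal (D powr q) * ?E z \<partial>\<mu>) = ennreal (D powr q) * (\<integral>\<^sup>+z. ?E z \<partial>\<mu>)"
      by (rule nn_integral_cmult) measurable
    also have "ennreal A * (ennreal (W a powr (q / p)) * TI (tests p \<gamma> a None) + ennreal (D powr q) * (\<integral>\<^sup>+z. ?E z \<partial>\<mu>))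
      \<le> ennreal A * (ennreal (W a powr (q / p)) * TS \<gamma> a + ennreal (D powr q) * (ennreal (K0 * W a powr (q / p)) * TS \<gamma> a))"
    proof (intro mult_left_mono add_mono K0(2) a)
      show "TI (tests p \<gamma> a None) \<le> TS \<gamma> a" unfolding TS_def by (rule member_le_sum) auto
    qed auto
    also have "\<dots> = ennreal (A * (1 + D powr q * K0) * W a powr (q / p)) * TS \<gamma> a"
    proof -
      have "ennreal (A * (1 + D powr q * K0) * W a powr (q / p)) = ennreal A * (ennreal (W a powr (q / p)) + ennreal (D powr q) * ennreal (K0 * W a powr (q / p)))"
        using A K0(1) by (simp add: algebra_simps flip: ennreal_mult ennreal_plus)
      then show ?thesis by (simp add: distrib_right mult.assoc)
    qed
    finally show "(\<integral>\<^sup>+z. indicator G z * ennreal (norm (u z - v z) powr q) * indicator (pball a s) (\<phi> z) \<partial>\<mu>)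
      \<le> ennreal (A * (1 + D powr q * K0) * W a powr (q / p)) * TS \<gamma> a" .
  qed
qed

end

lemma (in wcomp_pair) wcomp_pair_swap:
  "wcomp_pair \<omega> p q \<psi> \<phi> v u \<mu>"
  by unfold_locales (use p pq phi psi u v sets_mu in auto)

lemma (in wcomp_pair) emeasure_pball_le_TS:
  assumes r: "0 < r" "r < 1" and s: "0 < s" "s < 1"
  defines "G \<equiv> {z \<in> Bn. pseudo_hyp (\<phi> z) (\<psi> z) < r}"
  shows "\<exists>K\<ge>0. \<forall>a\<in>Bn. emeasure (measure_add
      (pushfwd \<mu> (\<lambda>z. ennreal (norm (complex_of_real (pseudo_hyp (\<phi> z) (\<psi> z)) * u z) powr q)) \<phi>)
      (pushfwd \<mu> (\<lambda>z. indicator G z * ennreal (norm (u z - v z) powr q)) \<phi>)) (pball a s)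
    \<le> ennreal (K * W a powr (q / p)) * TS \<gamma> a"
proof -
  interpret sw: wcomp_pair \<omega> ty p q \<psi> \<phi> v u \<mu> by (rule wcomp_pair_swap)
  \<comment> \<open>Exchanging the two symbols replaces \<open>T\<close> by its negative, which
    leaves all norms unchanged.\<close>
  have TSsw: "sw.TS \<gamma> a = TS \<gamma> a" for a
    unfolding TS_def sw.TS_def TI_def sw.TI_def wcomp_diff_def by (simp add: norm_minus_commute)
  have rsw: "sw.\<rho> z = \<rho> z" if "z \<in> Bn" for z
    unfolding \<rho>_def sw.\<rho>_def using phi_Bn[OF that] psi_Bn[OF that] by (intro pseudo_hyp_commute) (auto simp: Bn_iff)
  \<comment> \<open>The bound for \<open>u - v\<close> along \<open>\<phi>\<close> consumes the
    estimate for \<open>\<rho> v\<close> along \<open>\<psi>\<close>, which is \<open>eta_le\<close>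
    of the exchanged instance.\<close>
  have etapsi: "\<exists>K\<ge>0. \<forall>a\<in>Bn. (\<integral>\<^sup>+z. ennreal (norm (of_real (\<rho> z) * v z) powr q) * indicator (pball a s) (\<psi> z) \<partial>\<mu>)
    \<le> ennreal (K * W a powr (q / p)) * TS \<gamma> a" if "0 < s" "s < 1" for s
  proof -
    have "(\<integral>\<^sup>+z. ennreal (norm (of_real (\<rho> z) * v z) powr q) * indicator (pball a s) (\<psi> z) \<partial>\<mu>)
      = (\<integral>\<^sup>+z. ennreal (norm (of_real (sw.\<rho> z) * v z) powr q) * indicator (pball a s) (\<psi> z) \<partial>\<mu>)" for a
      by (rule nn_integral_cong) (simp add: rsw space_mu)
    then show ?thesis using sw.eta_le[OF that, of \<gamma>] by (simp add: TSsw)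
  qed
  obtain K1 where K1: "K1 \<ge> 0" "\<And>a. a \<in> Bn \<Longrightarrow> (\<integral>\<^sup>+z. ennreal (norm (of_real (\<rho> z) * u z) powr q) * indicator (pball a s) (\<phi> z) \<partial>\<mu>)
    \<le> ennreal (K1 * W a powr (q / p)) * TS \<gamma> a"
    using eta_le[OF s, of \<gamma>] by blast
  have Gr: "z \<in> Bn \<and> \<rho> z < r" if "z \<in> G" for z using that by (auto simp: G_def \<rho>_def)
  obtain K2 where K2: "K2 \<ge> 0" "\<And>a. a \<in> Bn \<Longrightarrow> (\<integral>\<^sup>+z. indicator G z * ennreal (norm (u z - v z) powr q) * indicator (pball a s) (\<phi> z) \<partial>\<mu>)
    \<le> ennreal (K2 * W a powr (q / p)) * TS \<gamma> a"
    using sigma_le[OF s r Gr etapsi] by blast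
  have Gm: "G \<in> sets \<mu>"
  proof -
    have "G = {z \<in> space \<mu>. \<rho> z < r}" by (simp add: G_def \<rho>_def space_mu)
    also have "\<dots> \<in> sets \<mu>" by measurable
    finally show ?thesis .
  qed
  note [measurable] = Gm
  have e1: "emeasure (pushfwd \<mu> (\<lambda>z. ennreal (norm (complex_of_real (pseudo_hyp (\<phi> z) (\<psi> z)) * u z) powr q)) \<phi>) (pball a s)
    = (\<integral>\<^sup>+z. ennreal (norm (of_real (\<rho> z) * u z) powr q) * indicator (pball a s) (\<phi> z) \<partial>\<mu>)" for a
    unfolding \<rho>_def[symmetric] by (rule emeasure_pushfwd[OF sets_mu _ _ pball_Bn_borel]) measurable
  have e2: "emeasure (pushfwd \<mu> (\<lambda>z. indicator G z * ennreal (norm (u z - v z) powr q)) \<phi>) (pball a s)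
    = (\<integral>\<^sup>+z. indicator G z * ennreal (norm (u z - v z) powr q) * indicator (pball a s) (\<phi> z) \<partial>\<mu>)" for a
    by (rule emeasure_pushfwd[OF sets_mu _ _ pball_Bn_borel]) measurable
  show ?thesis
  proof (intro exI[of _ "K1 + K2"] conjI ballI)
    show "K1 + K2 \<ge> 0" using K1 K2 by simp
    fix a :: "complex ^ 'n" assume a: "a \<in> Bn"
    have "ennreal (K1 * W a powr (q / p)) * TS \<gamma> a + ennreal (K2 * W a powr (q / p)) * TS \<gamma> a = ennreal ((K1 + K2) * W a powr (q / p)) * TS \<gamma> a"
      using K1(1) K2(1) by (simp add: distrib_right ennreal_plus)
    then show "emeasure (measure_add
      (pushfwd \<mu> (\<lambda>z. ennreal (norm (complex_of_real (pseudo_hyp (\<phi> z) (\<psi> z)) * u z) powr q)) \<phi>)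
      (pushfwd \<mu> (\<lambda>z. indicator G z * ennreal (norm (u z - v z) powr q)) \<phi>)) (pball a s)
    \<le> ennreal ((K1 + K2) * W a powr (q / p)) * TS \<gamma> a"
      using add_mono[OF K1(2)[OF a] K2(2)[OF a]]
      by (subst emeasure_measure_add) (simp_all add: pball_Bn_borel e1 e2)
  qed
qed

section \<open>From the test functions to the Carleson conditions\<close>

context wcomp_pair
begin

text \<open>\<open>tests_bounded\<close> leaves the sign of \<open>B\<close> open and
  \<open>ennreal\<close> truncates negative numbers, so the real bound is stated with
  \<open>max B 0\<close>.\<close>

lemma tests_Apw:
  assumes "J p (tests p \<gamma> a i) \<le> ennreal B" "a \<in> Bn"
  shows "tests p \<gamma> a i \<in> Apw p \<omega>" "Apw_normp p \<omega> (tests p \<gamma> a i) \<le> max B 0 / Bn_vol TYPE('n)"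
proof -
  have J: "J p (tests p \<gamma> a i) \<le> ennreal (max B 0)" using assms(1)
    by (rule order_trans) (simp add: ennreal_leI)
  have "J p (tests p \<gamma> a i) < \<infinity>" using J by (rule le_less_trans) simp
  then show "tests p \<gamma> a i \<in> Apw p \<omega>" by (simp add: Apw_iff holo_tests[OF assms(2)])
  have "enn2real (J p (tests p \<gamma> a i)) \<le> max B 0" using enn2real_mono[OF J] by simp
  then show "Apw_normp p \<omega> (tests p \<gamma> a i) \<le> max B 0 / Bn_vol TYPE('n)"
    using Bn_vol_pos[where 'n='n] by (simp add: Apw_normp_eq[OF holo_tests[OF assms(2)]] divide_right_mono)
qed

lemma TS_bounded_of_TI:
  assumes "\<And>a i. a \<in> Bn \<Longrightarrow> TI (tests p \<gamma> a i) \<le> ennreal B" "B \<ge> 0"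
  shows "\<exists>B'\<ge>0. \<forall>a\<in>Bn. TS \<gamma> a \<le> ennreal B'"
proof (intro exI[of _ "real (card (UNIV :: 'n option set)) * B"] conjI ballI)
  fix a :: "complex ^ 'n" assume "a \<in> Bn"
  then have "TS \<gamma> a \<le> (\<Sum>i\<in>(UNIV :: 'n option set). ennreal B)" unfolding TS_def by (intro sum_mono assms)
  also have "\<dots> = ennreal (real (card (UNIV :: 'n option set)) * B)" using assms(2)
    by (simp add: ennreal_mult ennreal_of_nat_eq_real_of_nat)
  finally show "TS \<gamma> a \<le> ennreal (real (card (UNIV :: 'n option set)) * B)" .
qed (use assms in auto)

lemma bounded_op_TI:
  assumes T: "bounded_op p \<omega> q \<mu> T"
  shows "\<exists>C\<ge>0. \<forall>f\<in>Apw p \<omega>. Apw_normp p \<omega> f \<le> B \<longrightarrow> TI f \<le> ennreal C"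
proof -
  obtain C where C: "\<And>f. f \<in> Apw p \<omega> \<Longrightarrow> T f \<in> Lq q \<mu>"
     "\<And>f. f \<in> Apw p \<omega> \<Longrightarrow> Lq_normp q \<mu> (T f) powr (1/q) \<le> C * Apw_normp p \<omega> f powr (1/p)"
    using T unfolding bounded_op_def by blast
  show ?thesis
  proof (intro exI[of _ "(\<bar>C\<bar> * \<bar>B\<bar> powr (1/p)) powr q"] conjI ballI impI)
    fix f :: "complex ^ 'n \<Rightarrow> complex" assume f: "f \<in> Apw p \<omega>" and B: "Apw_normp p \<omega> f \<le> B"
    have n0: "Apw_normp p \<omega> f \<ge> 0" by (simp add: Apw_normp_def)
    have "Lq_normp q \<mu> (T f) powr (1/q) \<le> C * Apw_normp p \<omega> f powr (1/p)" by (rule C(2)[OF f])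
    also have "\<dots> \<le> \<bar>C\<bar> * \<bar>B\<bar> powr (1/p)" using B n0 p by (intro mult_mono powr_mono2) auto
    finally have "(Lq_normp q \<mu> (T f) powr (1/q)) powr q \<le> (\<bar>C\<bar> * \<bar>B\<bar> powr (1/p)) powr q"
      using q by (intro powr_mono2) auto
    then have le: "Lq_normp q \<mu> (T f) \<le> (\<bar>C\<bar> * \<bar>B\<bar> powr (1/p)) powr q"
      using q by (simp add: powr_powr Lq_normp_def)
    have "TI f < \<infinity>" using C(1)[OF f] by (simp add: Lq_def TI_def)
    then have "TI f = ennreal (Lq_normp q \<mu> (T f))" by (simp add: Lq_normp_def TI_def)
    then show "TI f \<le> ennreal ((\<bar>C\<bar> * \<bar>B\<bar> powr (1/p)) powr q)" using le by (simp add: ennreal_leI)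
  qed simp
qed

text \<open>Otherwise there are points \<open>a k\<close> tending to the boundary whose images stay
  above \<open>\<epsilon>\<close>. Their test functions are norm-bounded and tend to 0 pointwise,
  hence so do the images at every point, and compactness gives a subsequence of images tending to 0
  in \<open>Lq\<close>.\<close>

lemma compact_op_TI_null:
  assumes T: "compact_op p \<omega> q \<mu> T"
    and JB: "\<And>a i. a \<in> Bn \<Longrightarrow> J p (tests p \<gamma> a i) \<le> ennreal B"
    and null: "\<And>z. z \<in> Bn \<Longrightarrow> \<exists>K. \<forall>a\<in>Bn. \<forall>i. norm (tests p \<gamma> a i z) powr p \<le> K * (1 - norm a)"
    and e: "\<epsilon> > 0"
  shows "\<exists>R<1. \<forall>a\<in>Bn. norm a > R \<longrightarrow> TI (tests p \<gamma> a i) \<le> ennreal \<epsilon>"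
proof (rule ccontr)
  assume neg: "\<not> ?thesis"
  have "\<exists>a\<in>Bn. norm a > 1 - 1 / (real k + 1) \<and> TI (tests p \<gamma> a i) > ennreal \<epsilon>" for k :: nat
  proof -
    have "1 - 1 / (real k + 1) < 1" by simp
    then show ?thesis using neg by (meson not_le)
  qed
  then obtain a where a: "\<And>k. a k \<in> Bn" "\<And>k. norm (a k) > 1 - 1 / (real k + 1)" "\<And>k. TI (tests p \<gamma> (a k) i) > ennreal \<epsilon>"
    by metis
  define fs where "fs k = tests p \<gamma> (a k) i" for k
  have fA: "fs k \<in> Apw p \<omega>" "Apw_normp p \<omega> (fs k) \<le> max B 0 / Bn_vol TYPE('n)" for k
    unfolding fs_def using tests_Apw[OF JB[OF a(1)] a(1)] by auto
  have ptw: "(\<lambda>k. fs k z) \<longlonglongrightarrow> 0" if z: "z \<in> Bn" for z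
  proof -
    obtain K where K: "\<And>a i. a \<in> Bn \<Longrightarrow> norm (tests p \<gamma> a i z) powr p \<le> K * (1 - norm a)" using null[OF z] by blast
    have le: "norm (fs k z) powr p \<le> \<bar>K\<bar> * (1 / (real k + 1))" for k
    proof -
      have "norm (fs k z) powr p \<le> K * (1 - norm (a k))" unfolding fs_def by (rule K[OF a(1)])
      also have "\<dots> \<le> \<bar>K\<bar> * (1 / (real k + 1))"
        using a(1)[of k] a(2)[of k] by (intro mult_mono) (auto simp: Bn_iff)
      finally show ?thesis .
    qed
    have "(\<lambda>k. \<bar>K\<bar> * (1 / (real k + 1))) \<longlonglongrightarrow> \<bar>K\<bar> * 0"
      using LIMSEQ_inverse_real_of_nat by (intro tendsto_mult tendsto_const) (simp add: inverse_eq_divide add.commute)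
    then have lim: "(\<lambda>k. \<bar>K\<bar> * (1 / (real k + 1))) \<longlonglongrightarrow> 0" by (simp only: mult_zero_right)
    have "(\<lambda>k. norm (fs k z) powr p) \<longlonglongrightarrow> 0"
      by (rule tendsto_sandwich[OF always_eventually always_eventually tendsto_const lim])
        (simp, rule allI, rule le)
    then have "(\<lambda>k. (norm (fs k z) powr p) powr (1 / p)) \<longlonglongrightarrow> 0 powr (1 / p)"
      using p by (intro tendsto_powr2 tendsto_const) auto
    then have "(\<lambda>k. norm (fs k z)) \<longlonglongrightarrow> 0" using p by (simp add: powr_powr)
    then show ?thesis by (rule tendsto_norm_zero_cancel)
  qed
  have Tptw: "(\<lambda>k. T (fs k) z) \<longlonglongrightarrow> 0" if "z \<in> space \<mu>" for z
  proof -
    have z: "z \<in> Bn" using that by (simp add: space_mu)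
    have "(\<lambda>k. u z * fs k (\<phi> z) - v z * fs k (\<psi> z)) \<longlonglongrightarrow> u z * 0 - v z * 0"
      by (intro tendsto_intros ptw phi_Bn psi_Bn z)
    then show ?thesis by (simp add: wcomp_diff_def)
  qed
  obtain s where s: "strict_mono (s :: nat \<Rightarrow> nat)"
    and lim: "(\<lambda>j. \<integral>\<^sup>+z. ennreal (norm (T (fs (s j)) z) powr q) \<partial>\<mu>) \<longlonglongrightarrow> 0"
    by (rule compact_op_null_sequence[where fs = fs, OF T q fA Tptw])
  have "eventually (\<lambda>j. (\<integral>\<^sup>+z. ennreal (norm (T (fs (s j)) z) powr q) \<partial>\<mu>) < ennreal \<epsilon>) sequentially"
    using order_tendstoD(2)[OF lim, of "ennreal \<epsilon>"] e by simp
  then obtain j where "(\<integral>\<^sup>+z. ennreal (norm (T (fs (s j)) z) powr q) \<partial>\<mu>) < ennreal \<epsilon>"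
    by (auto simp: eventually_sequentially)
  with a(3)[of "s j"] show False by (simp add: TI_def fs_def)
qed

text \<open>A bounded \<open>T\<close> bounds \<open>TS\<close> uniformly in \<open>a\<close>, and a
  compact one moreover makes it small near the boundary; these feed the two sufficient conditions.
  In the compact case the uniform bound comes from \<open>compact_op_bounded_on\<close>.\<close>

lemma carleson_of_wcomp_diff:
  assumes r: "0 < r" "r < 1"
  defines "G \<equiv> {z \<in> Bn. pseudo_hyp (\<phi> z) (\<psi> z) < r}"
  defines "\<nu> \<equiv> measure_add
      (pushfwd \<mu> (\<lambda>z. ennreal (norm (complex_of_real (pseudo_hyp (\<phi> z) (\<psi> z)) * u z) powr q)) \<phi>)
      (pushfwd \<mu> (\<lambda>z. indicator G z * ennreal (norm (u z - v z) powr q)) \<phi>)"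
  shows "bounded_op p \<omega> q \<mu> T \<Longrightarrow> carleson p \<omega> q \<nu>"
    and "compact_op p \<omega> q \<mu> T \<Longrightarrow> vanishing_carleson p \<omega> q \<nu>"
proof -
  have sets: "sets \<nu> = sets Bn_borel" by (simp add: \<nu>_def)
  obtain \<gamma> B where JB: "\<And>a i. a \<in> Bn \<Longrightarrow> J p (tests p \<gamma> a i) \<le> ennreal B"
    and null: "\<And>z. z \<in> Bn \<Longrightarrow> \<exists>K. \<forall>a\<in>Bn. \<forall>i. norm (tests p \<gamma> a i z) powr p \<le> K * (1 - norm a)"
    by (rule tests_bounded[OF p]) blast
  have nu: "\<exists>K\<ge>0. \<forall>a\<in>Bn. emeasure \<nu> (pball a s) \<le> ennreal (K * W a powr (q / p)) * TS \<gamma> a" if "0 < s" "s < 1" for s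
    unfolding \<nu>_def G_def by (rule emeasure_pball_le_TS[OF r that])
  have H: "\<exists>M\<ge>0. \<forall>a\<in>Bn. emeasure \<nu> (pball a s) \<le> ennreal (M * W a powr (q / p))"
    if TS: "\<exists>B'\<ge>0. \<forall>a\<in>Bn. TS \<gamma> a \<le> ennreal B'" and s: "0 < s" "s < 1" for s
  proof -
    obtain B' where B': "B' \<ge> 0" "\<And>a. a \<in> Bn \<Longrightarrow> TS \<gamma> a \<le> ennreal B'" using TS by blast
    obtain K where K: "K \<ge> 0" "\<And>a. a \<in> Bn \<Longrightarrow> emeasure \<nu> (pball a s) \<le> ennreal (K * W a powr (q / p)) * TS \<gamma> a" using nu[OF s] by blast
    have "emeasure \<nu> (pball a s) \<le> ennreal (K * B' * W a powr (q / p))" if a: "a \<in> Bn" for a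
    proof -
      have "emeasure \<nu> (pball a s) \<le> ennreal (K * W a powr (q / p)) * TS \<gamma> a" by (rule K(2)[OF a])
      also have "\<dots> \<le> ennreal (K * W a powr (q / p)) * ennreal B'" by (intro mult_left_mono B' a) simp
      also have "\<dots> = ennreal (K * B' * W a powr (q / p))" using K(1) B'(1) by (simp add: mult_ac flip: ennreal_mult)
      finally show ?thesis .
    qed
    then show ?thesis using K(1) B'(1) by (intro exI[of _ "K * B'"]) auto
  qed
  show "carleson p \<omega> q \<nu>" if T: "bounded_op p \<omega> q \<mu> T"
  proof -
    obtain C where C: "C \<ge> 0" "\<forall>f\<in>Apw p \<omega>. Apw_normp p \<omega> f \<le> max B 0 / Bn_vol TYPE('n) \<longrightarrow> TI f \<le> ennreal C"
      using bounded_op_TI[OF T] by blast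
    have "TI (tests p \<gamma> a i) \<le> ennreal C" if "a \<in> Bn" for a i using C(2) tests_Apw[OF JB[OF that] that] by blast
    then have TS: "\<exists>B'\<ge>0. \<forall>a\<in>Bn. TS \<gamma> a \<le> ennreal B'" using C(1) by (rule TS_bounded_of_TI)
    show ?thesis by (rule carleson_sufficient(1)[OF p pq sets H[OF TS]])
  qed
  show "vanishing_carleson p \<omega> q \<nu>" if T: "compact_op p \<omega> q \<mu> T"
  proof -
    define S :: "(complex ^ 'n \<Rightarrow> complex) set" where "S = {f \<in> Apw p \<omega>. Apw_normp p \<omega> f \<le> max B 0 / Bn_vol TYPE('n)}"
    have "\<exists>C\<ge>0. \<forall>f\<in>S. (\<integral>\<^sup>+z. ennreal (norm (T f z) powr q) \<partial>\<mu>) \<le> ennreal C"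
      by (rule compact_op_bounded_on[OF T q]) (auto simp: S_def)
    then obtain C where C: "C \<ge> 0" "\<And>f. f \<in> S \<Longrightarrow> TI f \<le> ennreal C" unfolding TI_def by blast
    have "TI (tests p \<gamma> a i) \<le> ennreal C" if "a \<in> Bn" for a i using tests_Apw[OF JB[OF that] that] by (intro C) (simp add: S_def)
    then have TS: "\<exists>B'\<ge>0. \<forall>a\<in>Bn. TS \<gamma> a \<le> ennreal B'" using C(1) by (rule TS_bounded_of_TI)
    show ?thesis
    proof (rule vanishing_carleson_sufficient[OF p pq sets H[OF TS]])
      fix \<epsilon> :: real assume eps: "\<epsilon> > 0"
      obtain K where K: "K \<ge> 0" "\<And>a. a \<in> Bn \<Longrightarrow> emeasure \<nu> (pball a (3/4)) \<le> ennreal (K * W a powr (q / p)) * TS \<gamma> a"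
        using nu[of "3/4"] by auto
      define m where "m = real (card (UNIV :: 'n option set))"
      have m: "m > 0" by (simp add: m_def card_gt_0_iff)
      \<comment> \<open>Summed over the \<open>m\<close> test functions and multiplied by
        \<open>K\<close>, this stays below \<open>\<epsilon>\<close>; \<open>K + 1\<close> avoids
        division by 0.\<close>
      define e where "e = \<epsilon> / ((K + 1) * m)"
      have e: "e > 0" using eps K m by (simp add: e_def)
      have "\<exists>R. R < 1 \<and> (\<forall>a\<in>Bn. norm a > R \<longrightarrow> TI (tests p \<gamma> a i) \<le> ennreal e)" for i
        using compact_op_TI_null[OF T JB null e] by blast
      then obtain R where R: "\<And>i. R i < 1" "\<And>i a. a \<in> Bn \<Longrightarrow> norm a > R i \<Longrightarrow> TI (tests p \<gamma> a i) \<le> ennreal e" by metis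
      define R' where "R' = Max (range R)"
      have R': "R' < 1" "R i \<le> R' " for i using R(1) by (auto simp: R'_def)
      have "emeasure \<nu> (pball a (3/4)) \<le> ennreal (\<epsilon> * W a powr (q / p))" if a: "a \<in> Bn" "norm a > R'" for a
      proof -
        have "TS \<gamma> a \<le> (\<Sum>i\<in>(UNIV :: 'n option set). ennreal e)"
          unfolding TS_def using a R'(2) by (intro sum_mono R(2)) (auto intro: le_less_trans)
        also have "\<dots> = ennreal (m * e)" using e by (simp add: m_def ennreal_mult ennreal_of_nat_eq_real_of_nat)
        finally have TS: "TS \<gamma> a \<le> ennreal (m * e)" .
        have "emeasure \<nu> (pball a (3/4)) \<le> ennreal (K * W a powr (q / p)) * TS \<gamma> a" by (rule K(2)[OF a(1)])
        also have "\<dots> \<le> ennreal (K * W a powr (q / p)) * ennreal (m * e)" by (intro mult_left_mono TS) simp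
        also have "\<dots> = ennreal (K * (m * e) * W a powr (q / p))" using K(1) m e by (simp add: mult_ac flip: ennreal_mult)
        also have "\<dots> \<le> ennreal (\<epsilon> * W a powr (q / p))"
        proof (intro ennreal_leI mult_right_mono)
          have "m * e = \<epsilon> / (K + 1)" using m K(1) by (simp add: e_def)
          then have "K * (m * e) = K / (K + 1) * \<epsilon>" by simp
          also have "\<dots> \<le> 1 * \<epsilon>" using K(1) eps by (intro mult_right_mono) auto
          finally show "K * (m * e) \<le> \<epsilon>" by simp
        qed simp
        finally show ?thesis .
      qed
      then show "\<exists>R<1. \<forall>a\<in>Bn. norm a > R \<longrightarrow> emeasure \<nu> (pball a (3/4)) \<le> ennreal (\<epsilon> * W a powr (q / p))"
        using R'(1) by blast
    qed
  qed
qed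

end

theorem theorem4p3:
  fixes p q r :: real
    and \<omega> :: "real \<Rightarrow> real"
    and \<phi> \<psi> :: "complex ^ 'n \<Rightarrow> complex ^ 'n"
    and u v :: "complex ^ 'n \<Rightarrow> complex"
    and \<mu> :: "(complex ^ 'n) measure"
  assumes "0 < p" "p \<le> q" and "0 < r" "r < 1"
    and "radial_weight \<omega> TYPE('n)" "D_class \<omega>"
    and "holo_self_map \<phi>" "holo_self_map \<psi>"
    and "u \<in> borel_measurable Bn_borel" "v \<in> borel_measurable Bn_borel"
    and "sets \<mu> = sets (Bn_borel :: (complex ^ 'n) measure)"
  defines "\<rho> \<equiv> (\<lambda>z. pseudo_hyp (\<phi> z) (\<psi> z))"
    and "G \<equiv> {z \<in> Bn. pseudo_hyp (\<phi> z) (\<psi> z) < r}"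
  defines "\<eta>\<phi> \<equiv> pushfwd \<mu> (\<lambda>z. ennreal (norm (complex_of_real (\<rho> z) * u z) powr q)) \<phi>"
    and "\<eta>\<psi> \<equiv> pushfwd \<mu> (\<lambda>z. ennreal (norm (complex_of_real (\<rho> z) * v z) powr q)) \<psi>"
    and "\<sigma>\<phi> \<equiv> pushfwd \<mu> (\<lambda>z. indicator G z * ennreal (norm (u z - v z) powr q)) \<phi>"
    and "\<sigma>\<psi> \<equiv> pushfwd \<mu> (\<lambda>z. indicator G z * ennreal (norm (u z - v z) powr q)) \<psi>"
  shows "(bounded_op p \<omega> q \<mu> (wcomp_diff u \<phi> v \<psi>) \<longrightarrow>
            carleson p \<omega> q (measure_add \<eta>\<phi> \<sigma>\<phi>) \<and> carleson p \<omega> q (measure_add \<eta>\<psi> \<sigma>\<psi>))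
       \<and> (compact_op p \<omega> q \<mu> (wcomp_diff u \<phi> v \<psi>) \<longrightarrow>
            vanishing_carleson p \<omega> q (measure_add \<eta>\<phi> \<sigma>\<phi>)
            \<and> vanishing_carleson p \<omega> q (measure_add \<eta>\<psi> \<sigma>\<psi>))"
proof -
  interpret A: wcomp_pair \<omega> "TYPE('n)" p q \<phi> \<psi> u v \<mu>
    by unfold_locales (use assms(1-11) in auto)
  \<comment> \<open>The claims for \<open>\<psi>\<close> are those for \<open>\<phi>\<close> after
    exchanging the two symbols. It remains to match the measures and to pass from the operator to
    its negative.\<close>
  interpret B: wcomp_pair \<omega> "TYPE('n)" p q \<psi> \<phi> v u \<mu>
    by (rule A.wcomp_pair_swap)
  have comm: "pseudo_hyp (\<psi> z) (\<phi> z) = pseudo_hyp (\<phi> z) (\<psi> z)" if "z \<in> Bn" for z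
    using A.phi_Bn[OF that] A.psi_Bn[OF that] by (intro pseudo_hyp_commute) (auto simp: Bn_iff)
  have G: "{z \<in> Bn. pseudo_hyp (\<psi> z) (\<phi> z) < r} = G" using comm by (auto simp: G_def)
  \<comment> \<open>The symmetry of \<open>pseudo_hyp\<close> is available for points of the ball,
    so the densities are compared through their values on \<open>Bn\<close>, the space of
    \<open>\<mu>\<close>.\<close>
  have density_cong': "density \<mu> f = density \<mu> g" if "\<And>z. z \<in> Bn \<Longrightarrow> f z = g z" for f g :: "complex ^ 'n \<Rightarrow> ennreal"
  proof -
    have "(\<integral>\<^sup>+z. f z * indicator A z \<partial>\<mu>) = (\<integral>\<^sup>+z. g z * indicator A z \<partial>\<mu>)" for A
      by (rule nn_integral_cong) (simp add: A.space_mu that)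
    then show ?thesis by (simp add: density_def)
  qed
  have \<eta>: "pushfwd \<mu> (\<lambda>z. ennreal (norm (complex_of_real (pseudo_hyp (\<psi> z) (\<phi> z)) * v z) powr q)) \<psi> = \<eta>\<psi>"
    unfolding \<eta>\<psi>_def \<rho>_def pushfwd_def by (subst density_cong') (auto simp: comm)
  have \<sigma>: "pushfwd \<mu> (\<lambda>z. indicator G z * ennreal (norm (v z - u z) powr q)) \<psi> = \<sigma>\<psi>"
    by (simp add: \<sigma>\<psi>_def norm_minus_commute)
  have T: "wcomp_diff v \<psi> u \<phi> f z = - wcomp_diff u \<phi> v \<psi> f z" for f z
    by (simp add: wcomp_diff_def)
  have Lq_uminus: "(\<lambda>z. - g z) \<in> Lq q \<mu>" if "g \<in> Lq q \<mu>" for g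
    using that by (simp add: Lq_def)
  have bdd: "bounded_op p \<omega> q \<mu> (wcomp_diff v \<psi> u \<phi>)" if "bounded_op p \<omega> q \<mu> (wcomp_diff u \<phi> v \<psi>)"
  proof -
    have "wcomp_diff v \<psi> u \<phi> f = (\<lambda>z. - wcomp_diff u \<phi> v \<psi> f z)" for f using T by auto
    then show ?thesis using that Lq_uminus by (simp add: bounded_op_def Lq_normp_def)
  qed
  have cpt: "compact_op p \<omega> q \<mu> (wcomp_diff v \<psi> u \<phi>)" if c: "compact_op p \<omega> q \<mu> (wcomp_diff u \<phi> v \<psi>)"
    unfolding compact_op_def
  proof (intro conjI ballI allI impI)
    fix f :: "complex ^ 'n \<Rightarrow> complex" assume "f \<in> Apw p \<omega>"
    then have "wcomp_diff u \<phi> v \<psi> f \<in> Lq q \<mu>" using c by (simp add: compact_op_def)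
    from Lq_uminus[OF this] show "wcomp_diff v \<psi> u \<phi> f \<in> Lq q \<mu>" by (simp flip: T)
  next
    fix fs :: "nat \<Rightarrow> complex ^ 'n \<Rightarrow> complex"
    assume "(\<forall>k. fs k \<in> Apw p \<omega>) \<and> (\<exists>B. \<forall>k. Apw_normp p \<omega> (fs k) \<le> B)"
    from c[unfolded compact_op_def, THEN conjunct2, rule_format, OF this]
    obtain s g where s: "strict_mono (s :: nat \<Rightarrow> nat)" "g \<in> Lq q \<mu>"
      "(\<lambda>j. Lq_normp q \<mu> (\<lambda>z. wcomp_diff u \<phi> v \<psi> (fs (s j)) z - g z)) \<longlonglongrightarrow> 0" by blast
    \<comment> \<open>If the original images converge to \<open>g\<close>, those of the negative
      operator converge to the negative of \<open>g\<close>, with the same distances.\<close>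
    have "Lq_normp q \<mu> (\<lambda>z. wcomp_diff v \<psi> u \<phi> (fs (s j)) z - (- g z))
        = Lq_normp q \<mu> (\<lambda>z. wcomp_diff u \<phi> v \<psi> (fs (s j)) z - g z)" for j
      unfolding Lq_normp_def T by (simp add: norm_minus_commute)
    then have "(\<lambda>j. Lq_normp q \<mu> (\<lambda>z. wcomp_diff v \<psi> u \<phi> (fs (s j)) z - (- g z))) \<longlonglongrightarrow> 0"
      using s(3) by (simp only:)
    with s(1) Lq_uminus[OF s(2)]
    show "\<exists>s g. strict_mono s \<and> g \<in> Lq q \<mu> \<and> (\<lambda>j. Lq_normp q \<mu> (\<lambda>z. wcomp_diff v \<psi> u \<phi> (fs (s j)) z - g z)) \<longlonglongrightarrow> 0"
      by (intro exI[of _ s] exI[of _ "\<lambda>z. - g z"] conjI)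
  qed
  note mB = B.carleson_of_wcomp_diff[OF assms(3,4), unfolded G \<eta> \<sigma>]
  show ?thesis
    using A.carleson_of_wcomp_diff[OF assms(3,4)] mB bdd cpt unfolding \<eta>\<phi>_def \<sigma>\<phi>_def \<rho>_def G_def by blast
qed

end
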